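(* For any element $g$ in R. Thompson's group $F$, the centralizer $C_F(g)$ of this element embeds into $F$ quasi-isometrically.
   Context: R. Thompson's group $F$ is the group, under composition, of all increasing continuous piecewise linear maps of $[0,1]$ onto itself whose singularities occur at finitely many dyadic points (points of the form $m/2^n$) and all of whose slopes are integer powers of $2$. It is finitely generated, and the centralizer of each element of $F$ is known to be a finite direct product of groups each isomorphic to $F$ or to $\mathbf{Z}$, hence finitely generated. Quasi-isometric embedding. For a group with finite generating set $X$, $|g|_X$ denotes the word length of $g$ with respect to $X$. If $A\le B$ are finitely generated groups with finite generating sets $X$ of $A$ and $Y$ of $B$, then $A$ embeds into $B$ quasi-isometrically (without distortion) if there is a positive integer constant $C$ with $|g|_X\le C|g|_Y$ for all $g\in A$; this does not depend on the choice of $X$ and $Y$. *)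

theory Defs
  imports Complex_Main "HOL-Algebra.Bij" "HOL-Algebra.Generated_Groups"
begin

definition dyadic :: "real set"
  where "dyadic = {of_int m / 2 ^ n | (m::int) (n::nat). True}"

(* The set D contains all singularities of f: on every closed subinterval of [0,1]
   without a point of D in its interior, f is affine with slope 2^k. *)
definition dyadic_piecewise_linear :: "(real \<Rightarrow> real) \<Rightarrow> bool"
  where "dyadic_piecewise_linear f \<longleftrightarrow>
    (\<exists>D. finite D \<and> D \<subseteq> dyadic \<and>
      (\<forall>a b. 0 \<le> a \<and> a < b \<and> b \<le> 1 \<and> {a<..<b} \<inter> D = {} \<longrightarrow>
        (\<exists>(k::int) c. \<forall>t\<in>{a..b}. f t = 2 powi k * t + c)))"

(* A map of [0,1] is represented by its extensional extension to the reals, as in BijGroup;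
   membership in Bij says that f maps [0,1] bijectively onto itself. *)
definition thompson_F :: "(real \<Rightarrow> real) monoid"
  where "thompson_F = (BijGroup {0..1})
    \<lparr>carrier := {f \<in> Bij {0..1}. strict_mono_on {0..1} f \<and> continuous_on {0..1} f \<and>
                  dyadic_piecewise_linear f}\<rparr>"

definition centralizer :: "('a, 'b) monoid_scheme \<Rightarrow> 'a \<Rightarrow> 'a set"
  where "centralizer G g = {h \<in> carrier G. h \<otimes>\<^bsub>G\<^esub> g = g \<otimes>\<^bsub>G\<^esub> h}"

(* Only meaningful for g in generate G X; otherwise the LEAST is taken over an empty set. *)
definition word_length :: "('a, 'b) monoid_scheme \<Rightarrow> 'a set \<Rightarrow> 'a \<Rightarrow> nat"
  where "word_length G X g =
    (LEAST n. \<exists>ws. length ws = n \<and> set ws \<subseteq> X \<union> (\<lambda>x. inv\<^bsub>G\<^esub> x) ` X \<and>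
      foldr (\<lambda>x y. x \<otimes>\<^bsub>G\<^esub> y) ws \<one>\<^bsub>G\<^esub> = g)"

definition finite_generating_set :: "('a, 'b) monoid_scheme \<Rightarrow> 'a set \<Rightarrow> 'a set \<Rightarrow> bool"
  where "finite_generating_set G A X \<longleftrightarrow> finite X \<and> X \<subseteq> A \<and> generate G X = A"

(* Products and inverses of elements of the subgroup A are computed in the ambient group B,
   so word lengths in A and in B can both be taken with respect to B.
   Finite generation of A and B is part of the notion, so that the comparison of word lengths,
   which is required for all finite generating sets, is not vacuous. *)
definition qi_embedded :: "'a set \<Rightarrow> ('a, 'b) monoid_scheme \<Rightarrow> bool"
  where "qi_embedded A B \<longleftrightarrow>
    group B \<and> subgroup A B \<and>
    (\<exists>X. finite_generating_set B A X) \<and> (\<exists>Y. finite_generating_set B (carrier B) Y) \<and>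
    (\<forall>X Y. finite_generating_set B A X \<and> finite_generating_set B (carrier B) Y \<longrightarrow>
      (\<exists>C::nat. C > 0 \<and> (\<forall>g\<in>A. word_length B X g \<le> C * word_length B Y g)))"

end

theory Submission
  imports Defs
begin

text \<open>
  Word length in Thompson's group \<open>F\<close> is comparable to a combinatorial complexity that behaves
  well under restriction.  Call a standard dyadic interval \<open>[m/2^n, (m+1)/2^n]\<close> good for \<open>f\<close> if \<open>f\<close>
  maps it affinely onto a standard dyadic interval, and let the complexity of \<open>f\<close> be the number of
  bad intervals inside \<open>[0,1]\<close>.  This number is finite exactly for the maps in \<open>F\<close>
  (\<open>thompson_carrier_iff\<close>), and it is subadditive under composition (\<open>bad_comp\<close>): if an interval is
  bad for \<open>g \<circ> f\<close>, then it is bad for \<open>f\<close> or \<open>f\<close> carries it to an interval that is bad for \<open>g\<close>.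
  A subadditive function is at most linear in every word length of \<open>F\<close>.  To show that a subgroup is
  undistorted it is therefore enough to write each of its elements as a word in finitely many
  elements of the subgroup, of length linear in the complexity (\<open>qi_embeddedI_subadditive\<close>).

  For \<open>F\<close> itself such a bound comes from tree pairs (\<open>thompson_word_bound\<close>).  The bad intervals of
  \<open>f\<close> are the inner nodes of a binary tree, the maximal good ones are its leaves, and \<open>f\<close> matches
  them with the leaves of a second tree.  The generators \<open>x0\<close> and \<open>x1\<close> act on trees by a rotation at
  the root and a rotation at its right child.  Moving a pointer through the tree with \<open>x0\<close> and
  dissolving inner nodes with \<open>x1\<close> brings every tree to a comb in linearly many steps.
  Conjugation by a chart carries the bound over to the elements supported in a dyadic interval
  (\<open>supported_word_bound\<close>).

  Every \<open>h\<close> that commutes with \<open>g\<close> permutes the finitely many frontier points of the fixed point set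
  of \<open>g\<close>, hence fixes them, and can be cut at those of them that are dyadic.  Cutting
  changes the complexity by a bounded amount.  Between consecutive cut points there are two
  possibilities (\<open>id_near_everywhere_or_nowhere\<close>).  Either \<open>g\<close> is the identity there, and the
  pieces of the centralizer form a copy of \<open>F\<close>; or \<open>g\<close> is nowhere locally the identity, and a piece
  is determined by its slope \<open>2^k\<close> at the left end (\<open>centralizer_identity_propagates\<close>), so that
  the pieces are powers of a single element.  In the second case \<open>\<bar>k\<bar>\<close> is bounded by
  the complexities of \<open>h\<close> and of its inverse up to a constant (\<open>germ_le_complexity\<close>), because an
  interval at the left end can be good only if its image fits into \<open>[0,1]\<close>.
\<close>

section \<open>Word metrics\<close>

definition word_ball :: "('a, 'b) monoid_scheme \<Rightarrow> 'a set \<Rightarrow> nat \<Rightarrow> 'a set"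
  where "word_ball G X n = {g. \<exists>ws. length ws \<le> n \<and> set ws \<subseteq> X \<union> (\<lambda>x. inv\<^bsub>G\<^esub> x) ` X \<and>
    foldr (\<lambda>x y. x \<otimes>\<^bsub>G\<^esub> y) ws \<one>\<^bsub>G\<^esub> = g}"

lemma word_ballI:
  assumes "length ws \<le> n" "set ws \<subseteq> X \<union> (\<lambda>x. inv\<^bsub>G\<^esub> x) ` X"
    "foldr (\<lambda>x y. x \<otimes>\<^bsub>G\<^esub> y) ws \<one>\<^bsub>G\<^esub> = g"
  shows "g \<in> word_ball G X n"
  using assms unfolding word_ball_def by blast

lemma word_ballE:
  assumes "g \<in> word_ball G X n"
  obtains ws where "length ws \<le> n" "set ws \<subseteq> X \<union> (\<lambda>x. inv\<^bsub>G\<^esub> x) ` X"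
    "foldr (\<lambda>x y. x \<otimes>\<^bsub>G\<^esub> y) ws \<one>\<^bsub>G\<^esub> = g"
  using assms unfolding word_ball_def by blast

lemma word_ball_mono:
  assumes "X \<subseteq> Y" "m \<le> n"
  shows "word_ball G X m \<subseteq> word_ball G Y n"
proof
  fix g assume "g \<in> word_ball G X m"
  then obtain ws where "length ws \<le> m" "set ws \<subseteq> X \<union> (\<lambda>x. inv\<^bsub>G\<^esub> x) ` X"
    "foldr (\<lambda>x y. x \<otimes>\<^bsub>G\<^esub> y) ws \<one>\<^bsub>G\<^esub> = g"
    by (rule word_ballE)
  moreover have "X \<union> (\<lambda>x. inv\<^bsub>G\<^esub> x) ` X \<subseteq> Y \<union> (\<lambda>x. inv\<^bsub>G\<^esub> x) ` Y"
    using assms(1) by blast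
  ultimately show "g \<in> word_ball G Y n"
    using assms(2) by (meson le_trans subset_trans word_ballI)
qed

lemma word_ball_le: "x \<in> word_ball G X m \<Longrightarrow> m \<le> n \<Longrightarrow> x \<in> word_ball G X n"
  by (rule subsetD[OF word_ball_mono[OF order_refl]])

lemma word_length_le:
  assumes "g \<in> word_ball G X n"
  shows "word_length G X g \<le> n"
proof -
  obtain ws where ws: "length ws \<le> n" "set ws \<subseteq> X \<union> (\<lambda>x. inv\<^bsub>G\<^esub> x) ` X"
    "foldr (\<lambda>x y. x \<otimes>\<^bsub>G\<^esub> y) ws \<one>\<^bsub>G\<^esub> = g"
    using assms by (rule word_ballE)
  have "word_length G X g \<le> length ws"
    unfolding word_length_def by (rule Least_le) (use ws in blast)
  with ws(1) show ?thesis by simp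
qed

lemma in_word_ball_word_length:
  assumes "g \<in> word_ball G X n"
  shows "g \<in> word_ball G X (word_length G X g)"
proof -
  obtain ws where ws: "length ws \<le> n" "set ws \<subseteq> X \<union> (\<lambda>x. inv\<^bsub>G\<^esub> x) ` X"
    "foldr (\<lambda>x y. x \<otimes>\<^bsub>G\<^esub> y) ws \<one>\<^bsub>G\<^esub> = g"
    using assms by (rule word_ballE)
  have "\<exists>ws. length ws = word_length G X g \<and> set ws \<subseteq> X \<union> (\<lambda>x. inv\<^bsub>G\<^esub> x) ` X \<and>
      foldr (\<lambda>x y. x \<otimes>\<^bsub>G\<^esub> y) ws \<one>\<^bsub>G\<^esub> = g"
    unfolding word_length_def by (rule LeastI) (use ws in blast)
  then show ?thesis using word_ballI[of _ "word_length G X g" X G g] by (metis order_refl)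
qed

context group
begin

lemma one_in_word_ball: "\<one> \<in> word_ball G X n"
  by (rule word_ballI[of "[]"]) auto

lemma generator_in_word_ball:
  "x \<in> X \<Longrightarrow> X \<subseteq> carrier G \<Longrightarrow> x \<in> word_ball G X 1"
  by (rule word_ballI[of "[x]"]) auto

lemma inv_generator_in_word_ball:
  "x \<in> X \<Longrightarrow> X \<subseteq> carrier G \<Longrightarrow> inv x \<in> word_ball G X 1"
  by (rule word_ballI[of "[inv x]"]) auto

lemma foldr_mult_closed:
  "set ws \<subseteq> carrier G \<Longrightarrow> foldr (\<otimes>) ws \<one> \<in> carrier G"
  by (induction ws) auto

lemma foldr_mult_append:
  assumes "set us \<subseteq> carrier G" "set vs \<subseteq> carrier G"
  shows "foldr (\<otimes>) (us @ vs) \<one> = foldr (\<otimes>) us \<one> \<otimes> foldr (\<otimes>) vs \<one>"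
  using assms by (induction us) (auto simp: foldr_mult_closed m_assoc)

lemma generators_closed:
  "X \<subseteq> carrier G \<Longrightarrow> X \<union> (\<lambda>x. inv x) ` X \<subseteq> carrier G"
  by auto

lemma word_ball_mult:
  assumes X: "X \<subseteq> carrier G" and g: "g \<in> word_ball G X m" and h: "h \<in> word_ball G X n"
  shows "g \<otimes> h \<in> word_ball G X (m + n)"
proof -
  obtain us where us: "length us \<le> m" "set us \<subseteq> X \<union> (\<lambda>x. inv x) ` X" "foldr (\<otimes>) us \<one> = g"
    using g by (rule word_ballE)
  obtain vs where vs: "length vs \<le> n" "set vs \<subseteq> X \<union> (\<lambda>x. inv x) ` X" "foldr (\<otimes>) vs \<one> = h"
    using h by (rule word_ballE)
  have "set us \<subseteq> carrier G" "set vs \<subseteq> carrier G"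
    using us(2) vs(2) generators_closed[OF X] by auto
  from foldr_mult_append[OF this] us vs show ?thesis
    by (intro word_ballI[of "us @ vs"]) auto
qed

lemma word_ball_induct [consumes 2, case_names one step]:
  assumes "g \<in> word_ball G X n" "X \<subseteq> carrier G"
    and one: "\<And>n. P n \<one>"
    and step: "\<And>x g n. \<lbrakk>x \<in> X \<union> (\<lambda>x. inv x) ` X; x \<in> carrier G; g \<in> word_ball G X n; g \<in> carrier G; P n g\<rbrakk>
      \<Longrightarrow> P (Suc n) (x \<otimes> g)"
  shows "P n g"
proof -
  obtain ws where ws: "length ws \<le> n" "set ws \<subseteq> X \<union> (\<lambda>x. inv x) ` X" "foldr (\<otimes>) ws \<one> = g"
    using assms(1) by (rule word_ballE)
  have "P n (foldr (\<otimes>) ws \<one>)"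
    using ws(1,2)
  proof (induction ws arbitrary: n)
    case Nil
    then show ?case using one by simp
  next
    case (Cons x ws)
    then obtain m where m: "n = Suc m" "length ws \<le> m" by (cases n) auto
    have "set ws \<subseteq> carrier G" using Cons.prems(2) generators_closed[OF assms(2)] by auto
    moreover have "foldr (\<otimes>) ws \<one> \<in> word_ball G X m"
      using m Cons.prems(2) by (intro word_ballI) auto
    ultimately show ?case
      using step[of x "foldr (\<otimes>) ws \<one>" m] Cons m generators_closed[OF assms(2)] foldr_mult_closed
      by auto
  qed
  with ws(3) show ?thesis by simp
qed

lemma word_ball_closed:
  "g \<in> word_ball G X n \<Longrightarrow> X \<subseteq> carrier G \<Longrightarrow> g \<in> carrier G"
  by (induction rule: word_ball_induct) auto

lemma word_ball_inv:
  assumes g: "g \<in> word_ball G X n" and X: "X \<subseteq> carrier G"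
  shows "inv g \<in> word_ball G X n"
  using g X
proof (induction rule: word_ball_induct)
  case (one n)
  then show ?case by (simp add: one_in_word_ball)
next
  case (step x g n)
  have "inv x \<in> word_ball G X 1"
    using step(1) X generator_in_word_ball[of _ X] inv_generator_in_word_ball[of _ X] by auto
  then have "inv g \<otimes> inv x \<in> word_ball G X (n + 1)"
    using step X by (intro word_ball_mult) auto
  then show ?case using step by (simp add: inv_mult_group)
qed

lemma word_ball_subset_generate:
  assumes "X \<subseteq> carrier G"
  shows "word_ball G X n \<subseteq> generate G X"
proof
  fix g assume "g \<in> word_ball G X n"
  then show "g \<in> generate G X"
    using assms
  proof (induction rule: word_ball_induct)
    case (one n)
    then show ?case by (rule generate.one)
  next
    case (step x g n)
    then have "x \<in> generate G X" by (auto intro: generate.incl generate.inv)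
    with step show ?case by (auto intro: generate.eng)
  qed
qed

lemma generate_in_word_ball:
  assumes "X \<subseteq> carrier G" "g \<in> generate G X"
  shows "\<exists>n. g \<in> word_ball G X n"
  using assms(2)
proof (induction rule: generate.induct)
  case one
  then show ?case using one_in_word_ball by blast
next
  case (incl h)
  then show ?case using generator_in_word_ball assms by blast
next
  case (inv h)
  then show ?case using inv_generator_in_word_ball assms by blast
next
  case (eng h1 h2)
  then show ?case using word_ball_mult assms by blast
qed

lemma word_length_in_word_ball:
  assumes "X \<subseteq> carrier G" "g \<in> generate G X"
  shows "g \<in> word_ball G X (word_length G X g)"
proof -
  obtain n where "g \<in> word_ball G X n" using generate_in_word_ball[OF assms] ..
  then show ?thesis by (rule in_word_ball_word_length)
qed

lemma word_ball_change_generators: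
  assumes X: "finite X" "X \<subseteq> carrier G" and Y: "Y \<subseteq> carrier G" and XY: "X \<subseteq> generate G Y"
  shows "\<exists>K. \<forall>n. word_ball G X n \<subseteq> word_ball G Y (K * n)"
proof -
  define K where "K = Max (insert 0 (word_length G Y ` X))"
  have gen: "x \<in> word_ball G Y K" if "x \<in> X" for x
  proof -
    have "word_length G Y x \<le> K" unfolding K_def using X that by (intro Max_ge) auto
    then show ?thesis
      using word_length_in_word_ball[of Y x] that XY Y word_ball_mono[of Y Y] by blast
  qed
  have "g \<in> word_ball G Y (K * n)" if "g \<in> word_ball G X n" for g n
    using that X(2)
  proof (induction rule: word_ball_induct)
    case (one n)
    then show ?case by (rule one_in_word_ball)
  next
    case (step x g n)
    have "x \<in> word_ball G Y K"
      using step(1) gen word_ball_inv[OF _ Y] by blast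
    then have "x \<otimes> g \<in> word_ball G Y (K + K * n)"
      using step by (intro word_ball_mult Y) auto
    then show ?case by simp
  qed
  then show ?thesis by blast
qed

text \<open>
  The map \<open>\<rho>\<close> has to be multiplicative on a subgroup only: cutting a map down to an interval is
  multiplicative on the maps that fix the ends of the interval.
\<close>

lemma word_ball_hom_image:
  assumes A: "subgroup A G" and X: "X \<subseteq> A"
    and closed: "\<And>x. x \<in> A \<Longrightarrow> \<rho> x \<in> carrier G"
    and hom: "\<And>x y. x \<in> A \<Longrightarrow> y \<in> A \<Longrightarrow> \<rho> (x \<otimes> y) = \<rho> x \<otimes> \<rho> y"
    and g: "g \<in> word_ball G X n"
  shows "\<rho> g \<in> word_ball G (\<rho> ` X) n"
proof -
  have Ac: "A \<subseteq> carrier G" using A by (rule subgroup.subset)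
  have one: "\<rho> \<one> = \<one>"
  proof -
    have "\<one> \<in> A" using A by (rule subgroup.one_closed)
    note c = closed[OF this] and h = hom[OF this this]
    from h[unfolded r_one[OF one_closed]] show ?thesis
      unfolding r_cancel_one'[OF c c] .
  qed
  have inv: "\<rho> (inv x) = inv (\<rho> x)" if "x \<in> A" for x
  proof -
    have ix: "inv x \<in> A" using A that by (rule subgroup.m_inv_closed)
    have "\<rho> (inv x) \<otimes> \<rho> x = \<one>"
      by (rule trans[OF hom[OF ix that, symmetric]]) (simp only: l_inv[OF subsetD[OF Ac that]] one)
    from inv_equality[OF this closed[OF that] closed[OF ix]] show ?thesis by (rule sym)
  qed
  have Xc: "\<rho> ` X \<subseteq> carrier G" using X closed by auto
  have "\<rho> g \<in> word_ball G (\<rho> ` X) n \<and> g \<in> A"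
    using g subset_trans[OF X Ac]
  proof (induction rule: word_ball_induct)
    case (one n)
    then show ?case using one_in_word_ball subgroup.one_closed[OF A] \<open>\<rho> \<one> = \<one>\<close> by simp
  next
    case (step x g n)
    have xA: "x \<in> A" using step(1) X subgroup.m_inv_closed[OF A] by blast
    have "\<rho> x \<in> word_ball G (\<rho> ` X) 1"
      using step(1)
    proof
      assume "x \<in> X"
      then show ?thesis by (intro generator_in_word_ball Xc imageI)
    next
      assume "x \<in> (\<lambda>x. inv x) ` X"
      then obtain y where y: "y \<in> X" "x = inv y" by blast
      then have "\<rho> x = inv (\<rho> y)" using X inv by blast
      then show ?thesis using y(1) inv_generator_in_word_ball[OF _ Xc] by simp
    qed
    then have "\<rho> x \<otimes> \<rho> g \<in> word_ball G (\<rho> ` X) (1 + n)"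
      using step(5) by (intro word_ball_mult Xc) blast+
    moreover have "\<rho> (x \<otimes> g) = \<rho> x \<otimes> \<rho> g" using hom xA step(5) by blast
    ultimately show ?case using xA step(5) subgroup.m_closed[OF A] by simp
  qed
  then show ?thesis by blast
qed

lemma word_ball_int_pow:
  assumes "x \<in> carrier G"
  shows "x [^] (q::int) \<in> word_ball G {x} (nat \<bar>q\<bar>)"
proof -
  have pow: "x [^] n \<in> word_ball G {x} n" for n :: nat
  proof (induction n)
    case 0
    then show ?case by (simp add: one_in_word_ball)
  next
    case (Suc n)
    then have "x [^] n \<otimes> x \<in> word_ball G {x} (n + 1)"
      using assms by (intro word_ball_mult generator_in_word_ball) auto
    then show ?case by simp
  qed
  show ?thesis
  proof (cases q rule: int_cases2)
    case (nonneg n)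
    then show ?thesis using pow[of n] by (simp add: int_pow_int)
  next
    case (nonpos n)
    then have "x [^] q = inv (x [^] n)" using assms by (simp add: int_pow_neg int_pow_int)
    then show ?thesis using word_ball_inv[OF pow[of n]] assms nonpos by simp
  qed
qed

lemma subadditive_linear_on_word_ball:
  fixes N :: "'a \<Rightarrow> nat"
  assumes Y: "finite Y" "Y \<subseteq> carrier G"
    and one: "N \<one> = 0"
    and sub: "\<And>x y. x \<in> carrier G \<Longrightarrow> y \<in> carrier G \<Longrightarrow> N (x \<otimes> y) \<le> N x + N y"
  shows "\<exists>K. \<forall>n. \<forall>h \<in> word_ball G Y n. N h \<le> K * n"
proof -
  define K where "K = Max (insert 0 (N ` (Y \<union> (\<lambda>x. inv x) ` Y)))"
  have K: "N x \<le> K" if "x \<in> Y \<union> (\<lambda>x. inv x) ` Y" for x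
    unfolding K_def using Y that by (intro Max_ge) auto
  have "N h \<le> K * n" if "h \<in> word_ball G Y n" for h n
    using that Y(2)
  proof (induction rule: word_ball_induct)
    case (one n)
    then show ?case using \<open>N \<one> = 0\<close> by simp
  next
    case (step x g n)
    then show ?case using sub[of x g] K[OF step(1)] by simp
  qed
  then show ?thesis by blast
qed

text \<open>
  A subadditive function is bounded on finitely many generators, hence at most linear in
  word length for any finite generating set of the ambient group.  So it suffices to bound word
  length in the subgroup by such a function.  The summand \<open>1\<close> is harmless, since only
  the neutral element has length \<open>0\<close>.
\<close>

lemma qi_embeddedI_subadditive:
  fixes N :: "'a \<Rightarrow> nat"
  assumes A: "subgroup A G"
    and Y0: "finite_generating_set G (carrier G) Y0"
    and one: "N \<one> = 0"
    and sub: "\<And>x y. x \<in> carrier G \<Longrightarrow> y \<in> carrier G \<Longrightarrow> N (x \<otimes> y) \<le> N x + N y"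
    and X0: "finite X0" "X0 \<subseteq> A"
    and bound: "\<And>h. h \<in> A \<Longrightarrow> h \<in> word_ball G X0 (C * (N h + 1))"
  shows "qi_embedded A G"
proof -
  have Ac: "A \<subseteq> carrier G" using A by (rule subgroup.subset)
  have X0c: "X0 \<subseteq> carrier G" using X0 Ac by auto
  have "generate G X0 = A"
    using generate_subgroup_incl[OF X0(2) A] word_ball_subset_generate[OF X0c] bound by blast
  then have gX0: "finite_generating_set G A X0"
    using X0 by (simp add: finite_generating_set_def)
  have "\<exists>D::nat. D > 0 \<and> (\<forall>h\<in>A. word_length G X h \<le> D * word_length G Y h)"
    if X: "finite_generating_set G A X" and Y: "finite_generating_set G (carrier G) Y" for X Y
  proof -
    have Xc: "X \<subseteq> carrier G" and Yc: "Y \<subseteq> carrier G"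
      using X Y Ac by (auto simp: finite_generating_set_def)
    obtain K where K: "\<And>n. word_ball G X0 n \<subseteq> word_ball G X (K * n)"
      using word_ball_change_generators[OF X0(1) X0c Xc] X X0(2)
      by (auto simp: finite_generating_set_def)
    obtain L where L: "\<And>n h. h \<in> word_ball G Y n \<Longrightarrow> N h \<le> L * n"
      using subadditive_linear_on_word_ball[OF _ Yc one sub] Y
      by (auto simp: finite_generating_set_def)
    have "word_length G X h \<le> (K * C * (L + 1) + 1) * word_length G Y h" if h: "h \<in> A" for h
    proof (cases "word_length G Y h = 0")
      case True
      have "h \<in> word_ball G Y (word_length G Y h)"
        using h Ac Y Yc word_length_in_word_ball by (auto simp: finite_generating_set_def)
      then have "h = \<one>" using True by (auto simp: word_ball_def)
      then have "h \<in> word_ball G X 0" by (simp add: one_in_word_ball)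
      then show ?thesis using word_length_le[of h G X 0] True by simp
    next
      case False
      have "h \<in> word_ball G Y (word_length G Y h)"
        using h Ac Y Yc word_length_in_word_ball by (auto simp: finite_generating_set_def)
      then have "N h \<le> L * word_length G Y h" by (rule L)
      then have "N h + 1 \<le> L * word_length G Y h + word_length G Y h" using False by linarith
      then have "N h + 1 \<le> (L + 1) * word_length G Y h" by (simp only: add_mult_distrib mult_1)
      then have "K * (C * (N h + 1)) \<le> K * (C * ((L + 1) * word_length G Y h))"
        by (intro mult_le_mono2)
      also have "\<dots> \<le> (K * C * (L + 1) + 1) * word_length G Y h"
        by (simp only: add_mult_distrib mult.assoc le_add1)
      finally have "K * (C * (N h + 1)) \<le> (K * C * (L + 1) + 1) * word_length G Y h" .
      moreover have "word_length G X h \<le> K * (C * (N h + 1))"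
        by (rule word_length_le[OF subsetD[OF K bound[OF h]]])
      ultimately show ?thesis by (rule order_trans[rotated])
    qed
    then show ?thesis by (intro exI[of _ "K * C * (L + 1) + 1"]) simp
  qed
  moreover have "\<exists>X. finite_generating_set G A X" "\<exists>Y. finite_generating_set G (carrier G) Y"
    using gX0 Y0 by blast+
  ultimately show ?thesis
    using A is_group unfolding qi_embedded_def by simp
qed

end

section \<open>Standard dyadic intervals\<close>

text \<open>
  The pair \<open>(m, n)\<close> stands for the interval from \<open>m/2^n\<close> to \<open>(m+1)/2^n\<close>, which \<open>cell_pt\<close>
  parametrizes by the unit interval.  Saying that a map respects these parametrizations makes
  composition and restriction to subintervals immediate, and determines the image cell.
\<close>

type_synonym cell = "int \<times> nat"

fun cell_pt :: "cell \<Rightarrow> real \<Rightarrow> real"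
  where "cell_pt (m, n) s = (of_int m + s) / 2 ^ n"

definition lo :: "cell \<Rightarrow> real" where "lo I = cell_pt I 0"
definition hi :: "cell \<Rightarrow> real" where "hi I = cell_pt I 1"
definition carries :: "(real \<Rightarrow> real) \<Rightarrow> cell \<Rightarrow> cell \<Rightarrow> bool"
  where "carries f I J \<longleftrightarrow> (\<forall>s\<in>{0..1}. f (cell_pt I s) = cell_pt J s)"

definition good :: "(real \<Rightarrow> real) \<Rightarrow> cell \<Rightarrow> bool"
  where "good f I \<longleftrightarrow> (\<exists>J. carries f I J)"

definition bad :: "real set \<Rightarrow> (real \<Rightarrow> real) \<Rightarrow> cell set"
  where "bad A f = {I. {lo I..hi I} \<subseteq> A \<and> \<not> good f I}"

fun descendant :: "cell \<Rightarrow> nat \<Rightarrow> int \<Rightarrow> cell"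
  where "descendant (m, n) d r = (m * 2 ^ d + r, n + d)"

lemma lo_simps: "lo (m, n) = of_int m / 2 ^ n"
  by (simp add: lo_def)

lemma hi_simps: "hi (m, n) = (of_int m + 1) / 2 ^ n"
  by (simp add: hi_def)

lemma cell_pt_eq: "cell_pt I s = lo I + s / 2 ^ snd I"
  by (cases I) (simp add: lo_def add_divide_distrib)

lemma hi_eq: "hi I = lo I + 1 / 2 ^ snd I"
  by (simp add: hi_def cell_pt_eq)

lemma lo_less_hi: "lo I < hi I"
  by (simp add: hi_eq)

lemma cell_eqI:
  assumes "lo I = lo J" "snd I = snd J"
  shows "I = J"
  using assms by (cases I, cases J) (simp add: lo_simps)

lemma in_cellE:
  assumes "x \<in> {lo I..hi I}"
  obtains s where "s \<in> {0..1}" "x = cell_pt I s"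
proof
  show "(x - lo I) * 2 ^ snd I \<in> {0..1}"
    using assms by (auto simp: hi_eq field_simps)
  show "x = cell_pt I ((x - lo I) * 2 ^ snd I)"
    by (simp add: cell_pt_eq)
qed

lemma cell_pt_in_cell: "s \<in> {0..1} \<Longrightarrow> cell_pt I s \<in> {lo I..hi I}"
  by (auto simp: cell_pt_eq hi_eq divide_right_mono)

lemma image_cell_pt: "cell_pt I ` {0..1} = {lo I..hi I}"
  using cell_pt_in_cell in_cellE by blast

lemma carries_lo_hi:
  assumes "carries f I J"
  shows "f (lo I) = lo J" "f (hi I) = hi J"
  using assms by (auto simp: carries_def lo_def hi_def)

lemma carries_eq:
  assumes "carries f I J" "x \<in> {lo I..hi I}"
  shows "f x = lo J + 2 ^ snd I / 2 ^ snd J * (x - lo I)"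
proof -
  obtain s where s: "s \<in> {0..1}" "x = cell_pt I s" using assms(2) by (rule in_cellE)
  then have "f x = cell_pt J s" using assms(1) by (simp add: carries_def)
  moreover have "s = (x - lo I) * 2 ^ snd I" using s by (simp add: cell_pt_eq)
  ultimately show ?thesis by (simp add: cell_pt_eq)
qed

lemma carries_strict_mono:
  assumes "carries f I J"
  shows "strict_mono_on {lo I..hi I} f"
  by (rule strict_mono_onI) (auto simp: carries_eq[OF assms] intro!: divide_strict_right_mono)

lemma carries_image:
  assumes "carries f I J"
  shows "f ` {lo I..hi I} = {lo J..hi J}"
proof -
  have "f ` cell_pt I ` {0..1} = cell_pt J ` {0..1}"
    unfolding image_image by (rule image_cong) (use assms in \<open>auto simp: carries_def\<close>)
  then show ?thesis by (simp add: image_cell_pt)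
qed

lemma carries_inj:
  assumes "carries f I J" "carries f I' J" "inj_on f A" "{lo I..hi I} \<subseteq> A" "{lo I'..hi I'} \<subseteq> A"
  shows "I = I'"
proof -
  have A: "lo I \<in> A" "hi I \<in> A" "lo I' \<in> A" "hi I' \<in> A"
    using assms(4,5) lo_less_hi[of I] lo_less_hi[of I'] by auto
  have "lo I = lo I'" "hi I = hi I'"
    using inj_onD[OF assms(3)] A carries_lo_hi[OF assms(1)] carries_lo_hi[OF assms(2)] by metis+
  then show ?thesis by (intro cell_eqI) (auto simp: hi_eq)
qed

lemma carries_comp:
  assumes "carries f I J" "carries g J K"
  shows "carries (g \<circ> f) I K"
  using assms by (simp add: carries_def)

lemma carries_cong:
  assumes "\<And>x. x \<in> {lo I..hi I} \<Longrightarrow> f x = g x"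
  shows "carries f I J \<longleftrightarrow> carries g I J"
  unfolding carries_def using assms cell_pt_in_cell by (metis (no_types, lifting))

lemma carries_inverse:
  assumes "carries f I J" "\<And>x. x \<in> {lo I..hi I} \<Longrightarrow> g (f x) = x"
  shows "carries g J I"
  unfolding carries_def
proof
  fix s :: real assume s: "s \<in> {0..1}"
  then have "g (f (cell_pt I s)) = cell_pt I s" by (intro assms(2) cell_pt_in_cell)
  with s assms(1) show "g (cell_pt J s) = cell_pt I s" by (simp add: carries_def)
qed

lemma carries_id:
  assumes "\<And>x. x \<in> {lo I..hi I} \<Longrightarrow> f x = x"
  shows "carries f I I"
  unfolding carries_def using assms cell_pt_in_cell by blast

lemma good_cong:
  assumes "\<And>x. x \<in> {lo I..hi I} \<Longrightarrow> f x = g x"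
  shows "good f I \<longleftrightarrow> good g I"
  unfolding good_def using carries_cong[of I f g] assms by blast

lemma bad_cong:
  assumes "\<And>x. x \<in> A \<Longrightarrow> f x = g x"
  shows "bad A f = bad A g"
  unfolding bad_def using good_cong[of _ f g] assms by blast

lemma bad_id:
  assumes "\<And>x. x \<in> A \<Longrightarrow> f x = x"
  shows "bad A f = {}"
  unfolding bad_def good_def using carries_id assms by blast

lemma cell_pt_descendant:
  "cell_pt (descendant I d r) s = cell_pt I ((of_int r + s) / 2 ^ d)"
  by (cases I) (simp add: power_add field_simps)

lemma descendant_unit_interval:
  fixes r :: int
  assumes "0 \<le> r" "r < 2 ^ d" "s \<in> {0..1::real}"
  shows "(of_int r + s) / 2 ^ d \<in> {0..1}"
proof -
  have "real_of_int (r + 1) \<le> real_of_int (2 ^ d)"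
    unfolding of_int_le_iff using assms(2) by simp
  then have r: "of_int r + 1 \<le> (2::real) ^ d" by simp
  have "of_int r + s \<le> 2 ^ d" using r assms(3) by simp
  moreover have "0 \<le> of_int r + s" using assms(1,3) by simp
  ultimately show ?thesis by simp
qed

lemma carries_descendant:
  assumes "carries f I J" "0 \<le> r" "r < 2 ^ d"
  shows "carries f (descendant I d r) (descendant J d r)"
  unfolding carries_def
proof
  fix s :: real assume "s \<in> {0..1}"
  then show "f (cell_pt (descendant I d r) s) = cell_pt (descendant J d r) s"
    unfolding cell_pt_descendant
    using assms(1) descendant_unit_interval[OF assms(2,3)] by (simp add: carries_def)
qed

text \<open>
  Scaled by \<open>2\<close> to the power of the finer level, the ends of both intervals are integers and the
  finer interval has length \<open>1\<close>.  So it cannot stick out of the coarser one once it starts inside.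
\<close>

lemma nested_cell:
  assumes lev: "snd I \<le> snd J" and l: "lo I \<le> lo J" and h: "lo J < hi I"
  obtains d r where "0 \<le> r" "r < 2 ^ d" "J = descendant I d r"
proof -
  obtain m n where I: "I = (m, n)" by (cases I)
  obtain p d where J: "J = (p, n + d)"
    using lev I by (cases J) (auto simp: le_iff_add)
  have "real_of_int (m * 2 ^ d) \<le> real_of_int p"
    using l unfolding I J by (simp add: lo_simps power_add field_simps)
  then have "m * 2 ^ d \<le> p" by (simp only: of_int_le_iff)
  moreover have "real_of_int p < real_of_int ((m + 1) * 2 ^ d)"
    using h unfolding I J by (simp add: lo_simps hi_simps power_add field_simps)
  then have "p < (m + 1) * 2 ^ d" by (simp only: of_int_less_iff)
  ultimately show ?thesis
    using that[of "p - m * 2 ^ d" d] I J by (simp add: algebra_simps)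
qed

lemma cell_descendant_subset:
  assumes "0 \<le> r" "r < 2 ^ d"
  shows "{lo (descendant I d r)..hi (descendant I d r)} \<subseteq> {lo I..hi I}"
  unfolding image_cell_pt[symmetric] image_subset_iff cell_pt_descendant
  using descendant_unit_interval[OF assms] by blast

lemma nested_cell_hi:
  assumes "snd I \<le> snd J" "lo I \<le> lo J" "lo J < hi I"
  shows "hi J \<le> hi I"
proof -
  obtain d r where r: "0 \<le> r" "r < 2 ^ d" "J = descendant I d r"
    using assms by (rule nested_cell)
  show ?thesis
    using cell_descendant_subset[OF r(1,2), of I] lo_less_hi[of J] unfolding r(3)[symmetric] by auto
qed

lemma good_nested:
  assumes "good f I" "snd I \<le> snd J" "lo I \<le> lo J" "lo J < hi I"
  shows "good f J"
proof -
  obtain d r where "0 \<le> r" "r < 2 ^ d" "J = descendant I d r"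
    using assms(2-4) by (rule nested_cell)
  with assms(1) show ?thesis unfolding good_def using carries_descendant by blast
qed

lemma level_le_of_subset:
  assumes "{lo J..hi J} \<subseteq> {lo I..hi I}"
  shows "snd I \<le> snd J"
proof -
  have "hi J - lo J \<le> hi I - lo I" using assms lo_less_hi[of J] by auto
  then have "1 / 2 ^ snd J \<le> (1 / 2 ^ snd I :: real)" by (simp add: hi_eq)
  then show ?thesis by (simp add: field_simps)
qed

lemma good_subset:
  assumes "good f I" "{lo J..hi J} \<subseteq> {lo I..hi I}"
  shows "good f J"
proof (rule good_nested[OF assms(1)])
  show "snd I \<le> snd J" using assms(2) by (rule level_le_of_subset)
  show "lo I \<le> lo J" "lo J < hi I" using assms(2) lo_less_hi[of J] by auto
qed

lemma bad_eq_empty_of_good: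
  "good f I \<Longrightarrow> bad {lo I..hi I} f = {}"
  unfolding bad_def using good_subset by blast

lemma finite_cells_bounded_level:
  "finite {I. a \<le> lo I \<and> hi I \<le> b \<and> snd I < K}"
proof -
  have "{I. a \<le> lo I \<and> hi I \<le> b \<and> snd I < K}
      \<subseteq> (\<Union>n<K. (\<lambda>m. (m, n)) ` {\<lfloor>a * 2 ^ n\<rfloor>..\<lceil>b * 2 ^ n\<rceil>})"
  proof
    fix I assume "I \<in> {I. a \<le> lo I \<and> hi I \<le> b \<and> snd I < K}"
    then obtain m n where I: "I = (m, n)" "a \<le> lo (m, n)" "hi (m, n) \<le> b" "n < K"
      by (cases I) auto
    have "a * 2 ^ n \<le> of_int m" using I(2) by (simp add: lo_simps field_simps)
    moreover have "of_int m \<le> b * 2 ^ n" using I(3) by (simp add: hi_simps field_simps)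
    ultimately have "m \<in> {\<lfloor>a * 2 ^ n\<rfloor>..\<lceil>b * 2 ^ n\<rceil>}" by (auto simp: floor_le_iff le_ceiling_iff)
    then have "I \<in> (\<lambda>m. (m, n)) ` {\<lfloor>a * 2 ^ n\<rfloor>..\<lceil>b * 2 ^ n\<rceil>}" using I(1) by blast
    then show "I \<in> (\<Union>n<K. (\<lambda>m. (m, n)) ` {\<lfloor>a * 2 ^ n\<rfloor>..\<lceil>b * 2 ^ n\<rceil>})"
      using I(4) by (intro UN_I[of n]) auto
  qed
  then show ?thesis by (rule finite_subset) auto
qed

text \<open>
  If the composition is bad on an interval that \<open>f\<close> carries to another one, then the latter is bad
  for \<open>g\<close>, and by injectivity of \<open>f\<close> it determines the former.
\<close>

lemma bad_comp:
  assumes inj: "inj_on f A" and im: "f ` A \<subseteq> B" and fin: "finite (bad A f)" "finite (bad B g)"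
  shows "finite (bad A (g \<circ> f))" "card (bad A (g \<circ> f)) \<le> card (bad A f) + card (bad B g)"
proof -
  \<comment> \<open>The intervals that \<open>f\<close> still carries to an interval; the image is then bad for \<open>g\<close>.\<close>
  define V where "V = bad A (g \<circ> f) - bad A f"
  have "\<forall>I\<in>V. \<exists>J. carries f I J" by (auto simp: V_def bad_def good_def)
  then obtain F where F: "\<And>I. I \<in> V \<Longrightarrow> carries f I (F I)" by metis
  have injF: "inj_on F V"
  proof (rule inj_onI)
    fix I I' assume "I \<in> V" "I' \<in> V" "F I = F I'"
    then have "carries f I (F I)" "carries f I' (F I)" "{lo I..hi I} \<subseteq> A" "{lo I'..hi I'} \<subseteq> A"
      using F[of I] F[of I'] by (auto simp: V_def bad_def)
    then show "I = I'" using carries_inj inj by blast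
  qed
  have imF: "F ` V \<subseteq> bad B g"
  proof
    fix J assume "J \<in> F ` V"
    then obtain I where I: "I \<in> V" "J = F I" by blast
    have IA: "{lo I..hi I} \<subseteq> A" and ng: "\<not> good (g \<circ> f) I" using I by (auto simp: V_def bad_def)
    have "{lo J..hi J} \<subseteq> B"
      using carries_image[OF F[OF I(1)]] IA im I(2) by auto
    moreover have "\<not> good g J"
      using ng carries_comp[OF F[OF I(1)]] I(2) unfolding good_def by blast
    ultimately show "J \<in> bad B g" by (simp add: bad_def)
  qed
  have "finite V" using finite_imageD[OF finite_subset[OF imF fin(2)] injF] .
  have sub: "bad A (g \<circ> f) \<subseteq> bad A f \<union> V" by (auto simp: V_def)
  show "finite (bad A (g \<circ> f))" by (rule finite_subset[OF sub]) (use fin \<open>finite V\<close> in simp)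
  have "card (bad A (g \<circ> f)) \<le> card (bad A f \<union> V)"
    by (rule card_mono[OF _ sub]) (use fin \<open>finite V\<close> in simp)
  also have "\<dots> \<le> card (bad A f) + card V" by (rule card_Un_le)
  also have "card V \<le> card (bad B g)" by (rule card_inj_on_le[OF injF imF fin(2)])
  finally show "card (bad A (g \<circ> f)) \<le> card (bad A f) + card (bad B g)" by simp
qed

section \<open>Subdivisions into standard dyadic intervals\<close>

fun chain :: "real \<Rightarrow> cell list \<Rightarrow> real \<Rightarrow> bool"
  where "chain a [] b \<longleftrightarrow> a = b"
  | "chain a (I # Is) b \<longleftrightarrow> lo I = a \<and> chain (hi I) Is b"

lemma chain_append: "chain a (xs @ ys) c \<longleftrightarrow> (\<exists>b. chain a xs b \<and> chain b ys c)"
  by (induction xs arbitrary: a) auto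

lemma chain_le: "chain a xs b \<Longrightarrow> a \<le> b"
proof (induction xs arbitrary: a)
  case (Cons I xs)
  then have "hi I \<le> b" "lo I = a" by auto
  then show ?case using lo_less_hi[of I] by simp
qed simp

lemma chain_less: "chain a xs b \<Longrightarrow> xs \<noteq> [] \<Longrightarrow> a < b"
proof (cases xs)
  case (Cons I ys)
  assume "chain a xs b"
  then have "hi I \<le> b" "lo I = a" using Cons chain_le by auto
  then show ?thesis using lo_less_hi[of I] by simp
qed simp

lemma chain_cell_subset:
  "chain a xs b \<Longrightarrow> I \<in> set xs \<Longrightarrow> {lo I..hi I} \<subseteq> {a..b}"
proof (induction xs arbitrary: a)
  case (Cons J xs)
  have "hi J \<le> b" "lo J = a" using Cons.prems chain_le by auto
  then show ?case
    using Cons lo_less_hi[of J] by (cases "I = J") fastforce+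
qed simp

lemma chain_covers:
  "chain a xs b \<Longrightarrow> x \<in> {a..<b} \<Longrightarrow> \<exists>I\<in>set xs. x \<in> {lo I..<hi I}"
proof (induction xs arbitrary: a)
  case (Cons J xs)
  then show ?case by (cases "x < hi J") fastforce+
qed simp

text \<open>
  By nestedness, an interval inside \<open>[a,b]\<close> either lies in a member of the subdivision or is
  coarser than some member, and only finitely many intervals are that coarse.
\<close>

lemma finite_bad_of_chain:
  assumes "chain a xs b" "\<And>I. I \<in> set xs \<Longrightarrow> finite (bad {lo I..hi I} f)"
  shows "finite (bad {a..b} f)"
proof -
  define K where "K = Max (insert 0 (snd ` set xs))"
  have K: "snd I \<le> K" if "I \<in> set xs" for I unfolding K_def using that by (intro Max_ge) auto
  have "bad {a..b} f \<subseteq> {I. a \<le> lo I \<and> hi I \<le> b \<and> snd I < K} \<union> (\<Union>I\<in>set xs. bad {lo I..hi I} f)"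
  proof
    fix J assume J: "J \<in> bad {a..b} f"
    then have ab: "a \<le> lo J" "hi J \<le> b" using lo_less_hi[of J] by (auto simp: bad_def)
    then obtain I where I: "I \<in> set xs" "lo I \<le> lo J" "lo J < hi I"
      using chain_covers[OF assms(1), of "lo J"] lo_less_hi[of J] by auto
    show "J \<in> {I. a \<le> lo I \<and> hi I \<le> b \<and> snd I < K} \<union> (\<Union>I\<in>set xs. bad {lo I..hi I} f)"
    proof (cases "snd I \<le> snd J")
      case True
      then have "hi J \<le> hi I" using I(2,3) by (rule nested_cell_hi)
      then have "J \<in> bad {lo I..hi I} f" using J I(2) by (auto simp: bad_def)
      then show ?thesis using I(1) by blast
    next
      case False
      then have "snd J < K" using K[OF I(1)] by simp
      then show ?thesis using ab by blast
    qed
  qed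
  then show ?thesis
    by (rule finite_subset) (use assms(2) in \<open>auto intro: finite_cells_bounded_level\<close>)
qed

lemma chain_images:
  assumes "list_all2 (carries f) xs ys" "chain a xs b" "xs \<noteq> []"
  shows "chain (f a) ys (f b)"
  using assms
proof (induction arbitrary: a rule: list_all2_induct)
  case (Cons I xs J ys)
  have J: "lo J = f a" "hi J = f (hi I)" using Cons carries_lo_hi by auto
  show ?case
  proof (cases "xs = []")
    case True
    then show ?thesis using Cons J by simp
  next
    case False
    then show ?thesis using Cons.IH[of "hi I"] Cons.prems J by simp
  qed
qed simp

lemma chain_map_strict_mono:
  assumes "list_all2 (carries f) xs ys" "chain a xs b" "chain c ys d" "xs \<noteq> []"
  shows "strict_mono_on {a..b} f \<and> f ` {a..b} = {c..d}"
  using assms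
proof (induction arbitrary: a c rule: list_all2_induct)
  case (Cons I xs J ys)
  have I: "lo I = a" "lo J = c" and IJ: "carries f I J" using Cons by auto
  note m1 = carries_strict_mono[OF IJ] and i1 = carries_image[OF IJ]
  show ?case
  proof (cases "xs = []")
    case True
    then show ?thesis using Cons m1 i1 I by simp
  next
    case False
    then have m2: "strict_mono_on {hi I..b} f" and i2: "f ` {hi I..b} = {hi J..d}"
      using Cons by auto
    have le: "lo I \<le> hi I" "hi I \<le> b" "lo J \<le> hi J" "hi J \<le> d"
      using lo_less_hi[of I] lo_less_hi[of J] Cons.prems chain_le by auto
    have u: "{a..b} = {lo I..hi I} \<union> {hi I..b}" "{c..d} = {lo J..hi J} \<union> {hi J..d}"
      using I le by auto
    have "strict_mono_on ({lo I..hi I} \<union> {hi I..b}) f"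
    proof (rule strict_mono_onI)
      fix x y assume xy: "x \<in> {lo I..hi I} \<union> {hi I..b}" "y \<in> {lo I..hi I} \<union> {hi I..b}" "x < y"
      consider "y \<le> hi I" | "hi I \<le> x" | "x < hi I" "hi I < y" by linarith
      then show "f x < f y"
      proof cases
        case 1
        then show ?thesis using xy by (intro strict_mono_onD[OF m1]) auto
      next
        case 2
        then show ?thesis using xy by (intro strict_mono_onD[OF m2]) auto
      next
        case 3
        then have "f x < f (hi I)" using xy by (intro strict_mono_onD[OF m1]) auto
        also have "\<dots> < f y" using xy 3 by (intro strict_mono_onD[OF m2]) auto
        finally show ?thesis .
      qed
    qed
    moreover have "f ` {a..b} = {c..d}" unfolding u image_Un i1 i2 ..
    ultimately show ?thesis by (simp add: u)
  qed
qed simp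

lemma chain_map_exists:
  assumes "chain a xs b" "chain c ys d" "length xs = length ys"
  shows "\<exists>f. list_all2 (carries f) xs ys \<and> f a = c"
  using assms(3,1,2)
proof (induction xs ys arbitrary: a c rule: list_induct2)
  case Nil
  then show ?case by auto
next
  case (Cons I xs J ys)
  then obtain f where f: "list_all2 (carries f) xs ys" "f (hi I) = hi J" by auto
  have I: "lo I = a" "lo J = c" "chain (hi I) xs b" using Cons.prems by auto
  \<comment> \<open>The common end point is left to the map on the remaining intervals, which has the right value there.\<close>
  define h where "h x = (if x < hi I then lo J + (x - lo I) * 2 ^ snd I / 2 ^ snd J else f x)" for x
  have "carries h I J"
    unfolding carries_def
  proof
    fix s :: real assume s: "s \<in> {0..1}"
    show "h (cell_pt I s) = cell_pt J s"
    proof (cases "s = 1")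
      case True
      then show ?thesis using f(2) by (simp add: h_def hi_def)
    next
      case False
      then have "cell_pt I s < hi I" using s by (simp add: cell_pt_eq hi_eq divide_strict_right_mono)
      then show ?thesis by (simp add: h_def cell_pt_eq)
    qed
  qed
  moreover have "list_all2 (carries h) xs ys"
    using f(1)
  proof (rule list.rel_mono_strong)
    fix I' J' assume I': "I' \<in> set xs" and "carries f I' J'"
    have "h x = f x" if "x \<in> {lo I'..hi I'}" for x
      using chain_cell_subset[OF I(3) I'] that lo_less_hi[of I'] by (auto simp: h_def)
    then show "carries h I' J'" using \<open>carries f I' J'\<close> carries_cong by blast
  qed
  moreover have "h a = c" using I lo_less_hi[of I] by (simp add: h_def)
  ultimately show ?case by auto
qed

subsection \<open>Binary trees of subdivisions\<close>

datatype tree = Leaf | Node tree tree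

fun leaves :: "cell \<Rightarrow> tree \<Rightarrow> cell list"
  where "leaves I Leaf = [I]"
  | "leaves I (Node S T) = leaves (descendant I 1 0) S @ leaves (descendant I 1 1) T"

fun num_leaves :: "tree \<Rightarrow> nat"
  where "num_leaves Leaf = 1"
  | "num_leaves (Node S T) = num_leaves S + num_leaves T"

lemma length_leaves [simp]: "length (leaves I T) = num_leaves T"
  by (induction T arbitrary: I) auto

lemma num_leaves_pos [simp]: "0 < num_leaves T"
  by (induction T) auto

lemma leaves_nonempty [simp]: "leaves I T \<noteq> []"
  by (metis length_leaves length_0_conv num_leaves_pos less_irrefl)

lemma halves:
  "lo (descendant I 1 0) = lo I" "hi (descendant I 1 0) = lo (descendant I 1 1)"
  "hi (descendant I 1 1) = hi I"
  by (cases I; simp add: lo_simps hi_simps field_simps)+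

lemma chain_leaves: "chain (lo I) (leaves I T) (hi I)"
proof (induction T arbitrary: I)
  case (Node S T)
  have "chain (lo I) (leaves (descendant I 1 0) S) (lo (descendant I 1 1))"
    using Node(1)[of "descendant I 1 0"] by (simp only: halves)
  moreover have "chain (lo (descendant I 1 1)) (leaves (descendant I 1 1) T) (hi I)"
    using Node(2)[of "descendant I 1 1"] by (simp only: halves)
  ultimately show ?case unfolding leaves.simps chain_append by blast
qed simp

lemma carries_leaves:
  "carries f I J \<Longrightarrow> list_all2 (carries f) (leaves I T) (leaves J T)"
proof (induction T arbitrary: I J)
  case (Node S T)
  have "carries f (descendant I 1 0) (descendant J 1 0)" "carries f (descendant I 1 1) (descendant J 1 1)"
    using Node.prems by (auto intro!: carries_descendant simp del: descendant.simps)
  then show ?case unfolding leaves.simps by (intro list_all2_appendI Node.IH)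
qed simp

text \<open>
  Subintervals of good intervals are good, so the bad intervals inside \<open>I\<close> form the inner nodes of a
  binary tree, whose leaves are the maximal good intervals.  A binary tree has one leaf more than
  inner nodes.
\<close>

lemma good_tree_exists:
  assumes "finite (bad {lo I..hi I} f)"
  shows "\<exists>T. num_leaves T \<le> card (bad {lo I..hi I} f) + 1 \<and> (\<forall>J\<in>set (leaves I T). good f J)"
  using assms
proof (induction "card (bad {lo I..hi I} f)" arbitrary: I rule: less_induct)
  case less
  show ?case
  proof (cases "good f I")
    case True
    then show ?thesis by (intro exI[of _ Leaf]) simp
  next
    case False
    define L R where "L = descendant I 1 0" and "R = descendant I 1 1"
    have LR: "lo L = lo I" "hi L = lo R" "hi R = hi I" unfolding L_def R_def by (rule halves)+
    note pos = lo_less_hi[of L] lo_less_hi[of R]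
    have sub: "bad {lo L..hi L} f \<subseteq> bad {lo I..hi I} f" "bad {lo R..hi R} f \<subseteq> bad {lo I..hi I} f"
      unfolding bad_def using LR pos by fastforce+
    have I: "I \<in> bad {lo I..hi I} f" "I \<notin> bad {lo L..hi L} f" "I \<notin> bad {lo R..hi R} f"
      using False LR pos by (auto simp: bad_def)
    have disj: "bad {lo L..hi L} f \<inter> bad {lo R..hi R} f = {}"
    proof -
      have False if "{lo J..hi J} \<subseteq> {lo L..hi L}" "{lo J..hi J} \<subseteq> {lo R..hi R}" for J
        using that lo_less_hi[of J] LR(2) by auto
      then show ?thesis by (auto simp: bad_def)
    qed
    note fin = finite_subset[OF sub(1) less.prems] finite_subset[OF sub(2) less.prems]
    have "card (bad {lo I..hi I} f) \<ge> card (insert I (bad {lo L..hi L} f \<union> bad {lo R..hi R} f))"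
      by (rule card_mono[OF less.prems]) (use sub I in auto)
    also have "card (insert I (bad {lo L..hi L} f \<union> bad {lo R..hi R} f))
        = Suc (card (bad {lo L..hi L} f) + card (bad {lo R..hi R} f))"
      using fin I by (simp add: card_Un_disjoint disj)
    finally have c: "Suc (card (bad {lo L..hi L} f) + card (bad {lo R..hi R} f)) \<le> card (bad {lo I..hi I} f)" .
    obtain S where S: "num_leaves S \<le> card (bad {lo L..hi L} f) + 1" "\<forall>J\<in>set (leaves L S). good f J"
      using less.hyps[of L] fin(1) c by auto
    obtain T where T: "num_leaves T \<le> card (bad {lo R..hi R} f) + 1" "\<forall>J\<in>set (leaves R T). good f J"
      using less.hyps[of R] fin(2) c by auto
    show ?thesis
      using S T c by (intro exI[of _ "Node S T"]) (auto simp: L_def R_def)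
  qed
qed

lemma chain_split:
  assumes "chain a xs c" "a \<le> b" "b \<le> c" "\<And>J. J \<in> set xs \<Longrightarrow> lo J < b \<Longrightarrow> hi J \<le> b"
  shows "\<exists>us vs. xs = us @ vs \<and> chain a us b \<and> chain b vs c"
  using assms
proof (induction xs arbitrary: a)
  case Nil
  then show ?case by auto
next
  case (Cons J xs)
  show ?case
  proof (cases "a = b")
    case True
    then show ?thesis using Cons.prems(1) by (intro exI[of _ "[]"] exI[of _ "J # xs"]) simp
  next
    case False
    then have "hi J \<le> b" using Cons.prems by auto
    then obtain us vs where "xs = us @ vs" "chain (hi J) us b" "chain b vs c"
      using Cons.IH[of "hi J"] Cons.prems by auto
    then show ?thesis using Cons.prems(1) by (intro exI[of _ "J # us"] exI[of _ vs]) simp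
  qed
qed

text \<open>
  Unless the subdivision is trivial, each of its members is finer than \<open>I\<close>, so by nestedness none
  has the midpoint of \<open>I\<close> in its interior.  The subdivision thus splits into subdivisions of the
  two halves.
\<close>

lemma chain_is_leaves:
  assumes "chain (lo I) xs (hi I)"
  shows "\<exists>T. leaves I T = xs"
  using assms
proof (induction "length xs" arbitrary: I xs rule: less_induct)
  case less
  show ?case
  proof (cases "I \<in> set xs")
    case True
    then obtain us vs where xs: "xs = us @ I # vs" by (auto simp: in_set_conv_decomp)
    then have "chain (lo I) us (lo I)" "chain (hi I) vs (hi I)"
      using less.prems by (auto simp: chain_append)
    then have "xs = [I]" using xs chain_less by blast
    then show ?thesis by (intro exI[of _ Leaf]) simp
  next
    case False
    define L R where "L = descendant I 1 0" and "R = descendant I 1 1"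
    have LR: "lo L = lo I" "hi L = lo R" "hi R = hi I" unfolding L_def R_def by (rule halves)+
    have lev: "snd L = Suc (snd I)" unfolding L_def by (cases I) simp
    note pos = lo_less_hi[of L] lo_less_hi[of R]
    have "hi J \<le> hi L" if J: "J \<in> set xs" "lo J < hi L" for J
    proof -
      have JI: "{lo J..hi J} \<subseteq> {lo I..hi I}" using chain_cell_subset[OF less.prems J(1)] .
      then have "snd I \<le> snd J" by (rule level_le_of_subset)
      moreover have "snd I \<noteq> snd J"
      proof
        assume eq: "snd I = snd J"
        then have "lo I = lo J" using JI lo_less_hi[of J] by (auto simp: hi_eq)
        with eq have "I = J" by (intro cell_eqI)
        with J False show False by simp
      qed
      ultimately show ?thesis using JI J(2) lev LR lo_less_hi[of J] by (intro nested_cell_hi) auto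
    qed
    then obtain us vs where xs: "xs = us @ vs" "chain (lo L) us (hi L)" "chain (lo R) vs (hi R)"
      using chain_split[OF less.prems, of "hi L"] LR pos by auto
    have "us \<noteq> []" "vs \<noteq> []" using xs(2,3) pos by auto
    then obtain S T where "leaves L S = us" "leaves R T = vs"
      using less.hyps[of us L] less.hyps[of vs R] xs by auto
    then show ?thesis using xs by (intro exI[of _ "Node S T"]) (simp add: L_def R_def)
  qed
qed

section \<open>Thompson's group in terms of standard dyadic intervals\<close>

lemma dyadicI: "of_int m / 2 ^ n \<in> dyadic"
  by (auto simp: dyadic_def)

lemma dyadic_common_level:
  assumes "finite D" "D \<subseteq> dyadic"
  shows "\<exists>n. \<forall>x\<in>D. \<exists>m::int. x = of_int m / 2 ^ n"
  using assms
proof (induction D rule: finite_induct)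
  case empty
  then show ?case by simp
next
  case (insert x D)
  then obtain n where n: "\<And>y. y \<in> D \<Longrightarrow> \<exists>m::int. y = of_int m / 2 ^ n" by auto
  obtain i k where x: "x = of_int (i::int) / 2 ^ k" using insert.prems by (auto simp: dyadic_def)
  have "\<exists>m::int. y = of_int m / 2 ^ (n + k)" if "y \<in> insert x D" for y
    using that
  proof
    assume "y = x"
    then have "y = of_int (i * 2 ^ n) / 2 ^ (n + k)" by (simp add: x power_add)
    then show ?thesis ..
  next
    assume "y \<in> D"
    then obtain m :: int where "y = of_int m / 2 ^ n" using n by blast
    then have "y = of_int (m * 2 ^ k) / 2 ^ (n + k)" by (simp add: power_add)
    then show ?thesis ..
  qed
  then show ?case by blast
qed

lemma dyadic_add:
  assumes "x \<in> dyadic" "y \<in> dyadic"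
  shows "x + y \<in> dyadic"
proof -
  obtain n where n: "\<forall>z\<in>{x, y}. \<exists>m::int. z = of_int m / 2 ^ n"
    using dyadic_common_level[of "{x, y}"] assms by auto
  then obtain i j :: int where "x = of_int i / 2 ^ n" "y = of_int j / 2 ^ n" by auto
  then have "x + y = of_int (i + j) / 2 ^ n" by (simp add: add_divide_distrib)
  then show ?thesis using dyadicI by metis
qed

lemma dyadic_power_int: "2 powi k / 2 ^ n \<in> dyadic"
proof (cases "k \<ge> 0")
  case True
  then have "2 powi k / 2 ^ n = real_of_int (2 ^ nat k) / 2 ^ n" by (simp add: power_int_def)
  then show ?thesis using dyadicI by metis
next
  case False
  then have "2 powi k / 2 ^ n = real_of_int 1 / 2 ^ (nat (- k) + n)"
    by (simp add: power_int_def power_add field_simps)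
  then show ?thesis using dyadicI by metis
qed

lemma chain_grid:
  "i \<le> j \<Longrightarrow> chain (of_int i / 2 ^ n) (map (\<lambda>m. (m, n)) [i..j - 1]) (of_int j / 2 ^ n)"
proof (induction "nat (j - i)" arbitrary: i)
  case 0
  then show ?case by simp
next
  case (Suc d)
  then have "[i..j - 1] = i # [i + 1..j - 1]" by (subst upto.simps) simp
  moreover have "chain (of_int (i + 1) / 2 ^ n) (map (\<lambda>m. (m, n)) [i + 1..j - 1]) (of_int j / 2 ^ n)"
    using Suc by (intro Suc.hyps(1)) auto
  ultimately show ?case by (simp add: lo_simps hi_simps)
qed

lemma dyadic_chain_exists:
  assumes "a \<in> dyadic" "b \<in> dyadic" "a \<le> b"
  shows "\<exists>xs. chain a xs b"
proof -
  obtain n where "\<forall>z\<in>{a, b}. \<exists>m::int. z = of_int m / 2 ^ n"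
    using dyadic_common_level[of "{a, b}"] assms by auto
  then obtain i j :: int where ij: "a = of_int i / 2 ^ n" "b = of_int j / 2 ^ n" by auto
  with assms(3) have "i \<le> j" by (simp add: divide_le_cancel)
  with chain_grid ij show ?thesis by blast
qed

lemma strict_mono_onto_endpoints:
  fixes f :: "real \<Rightarrow> real"
  assumes "strict_mono_on {a..b} f" "f ` {a..b} = {c..d}" "a \<le> b"
  shows "f a = c" "f b = d"
proof -
  have m: "f x \<le> f y" if "a \<le> x" "x \<le> y" "y \<le> b" for x y
    using strict_mono_onD[OF assms(1), of x y] that by (cases "x = y") auto
  have fa: "f a \<in> {c..d}" "f b \<in> {c..d}" using assms by auto
  then have "c \<in> f ` {a..b}" "d \<in> f ` {a..b}" unfolding assms(2) by auto
  then show "f a = c" "f b = d" using m fa by (auto intro!: order_antisym)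
qed

text \<open>
  The image of an interval of level \<open>p\<close> has length \<open>1/2^(p-k)\<close>.  Its left end is a multiple of this
  length as soon as \<open>p\<close> is large compared with \<open>k\<close> and with the denominator of \<open>f (lo I)\<close>.
\<close>

lemma finite_bad_of_affine:
  assumes aff: "\<And>t. t \<in> {lo I..hi I} \<Longrightarrow> f t = 2 powi k * t + c" and f: "f (lo I) \<in> dyadic"
  shows "finite (bad {lo I..hi I} f)"
proof -
  obtain j n where I: "I = (j, n)" by (cases I)
  obtain u e where u: "f (lo I) = of_int (u::int) / 2 ^ e" using f by (auto simp: dyadic_def)
  have "bad {lo I..hi I} f \<subseteq> {J. lo I \<le> lo J \<and> hi J \<le> hi I \<and> snd J < nat \<bar>k\<bar> + e}"
  proof
    fix J assume J: "J \<in> bad {lo I..hi I} f"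
    then have sub: "{lo J..hi J} \<subseteq> {lo I..hi I}" and ng: "\<not> good f J" by (auto simp: bad_def)
    have lev: "snd I \<le> snd J" using sub by (rule level_le_of_subset)
    have "\<not> nat \<bar>k\<bar> + e \<le> snd J"
    proof
      assume big: "nat \<bar>k\<bar> + e \<le> snd J"
      obtain m p where Jmp: "J = (m, p)" by (cases J)
      define q where "q = nat (int p - k)"
      have q: "int q = int p - k" "e \<le> q" using big Jmp by (auto simp: q_def)
      have slope: "2 powi k / 2 ^ p = 1 / (2::real) ^ q"
      proof -
        have "(2::real) ^ p = 2 powi (k + int q)" using q(1) by simp
        also have "\<dots> = 2 powi k * 2 ^ q" by (subst power_int_add) auto
        finally show ?thesis by (simp add: field_simps)
      qed
      have scale: "2 powi k * (x / 2 ^ p) = x / 2 ^ q" for x :: real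
      proof -
        have "2 powi k * (x / 2 ^ p) = 2 powi k / 2 ^ p * x" by simp
        then show ?thesis by (simp only: slope) simp
      qed
      obtain d where d: "p = n + d" using lev I Jmp by (auto simp: le_iff_add)
      obtain d' where d': "q = e + d'" using q(2) by (auto simp: le_iff_add)
      \<comment> \<open>The numerator of the left end of the image over the denominator \<open>2^q\<close>.\<close>
      define w where "w = u * 2 ^ d' + (m - j * 2 ^ d)"
      have w: "f (lo J) = of_int w / 2 ^ q"
      proof -
        have "lo J \<in> {lo I..hi I}" "lo I \<in> {lo I..hi I}" using sub lo_less_hi[of J] lo_less_hi[of I] by auto
        then have "f (lo J) = f (lo I) + 2 powi k * (lo J - lo I)" by (simp add: aff algebra_simps)
        also have "lo J - lo I = of_int (m - j * 2 ^ d) / 2 ^ p"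
          by (simp add: I Jmp lo_simps d power_add field_simps)
        also note scale
        also have "f (lo I) = of_int (u * 2 ^ d') / 2 ^ q" by (simp add: u d' power_add)
        finally show ?thesis by (simp add: w_def add_divide_distrib)
      qed
      have "carries f J (w, q)"
        unfolding carries_def
      proof
        fix s :: real assume s: "s \<in> {0..1}"
        then have "cell_pt J s \<in> {lo I..hi I}" using sub cell_pt_in_cell by blast
        moreover have "lo J \<in> {lo I..hi I}" using sub lo_less_hi[of J] by auto
        ultimately have "f (cell_pt J s) = f (lo J) + 2 powi k * (s / 2 ^ p)"
          by (simp add: aff cell_pt_eq Jmp algebra_simps)
        also note scale
        finally show "f (cell_pt J s) = cell_pt (w, q) s" by (simp add: w add_divide_distrib)
      qed
      with ng show False by (auto simp: good_def)
    qed
    then show "J \<in> {J. lo I \<le> lo J \<and> hi J \<le> hi I \<and> snd J < nat \<bar>k\<bar> + e}"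
      using sub lo_less_hi[of J] by auto
  qed
  then show ?thesis by (rule finite_subset[OF _ finite_cells_bounded_level])
qed

text \<open>
  On a grid fine enough to contain all singularities, \<open>f\<close> is affine on each member.
  Its values at the grid points are dyadic: this passes from one grid point to the next, starting
  with \<open>f 0 = 0\<close>.
\<close>

lemma finite_bad_of_piecewise_linear:
  assumes f: "dyadic_piecewise_linear f" and f0: "f 0 = 0"
  shows "finite (bad {0..1} f)"
proof -
  obtain D where D: "finite D" "D \<subseteq> dyadic"
    and lin: "\<forall>a b. 0 \<le> a \<and> a < b \<and> b \<le> 1 \<and> {a<..<b} \<inter> D = {} \<longrightarrow>
        (\<exists>(k::int) c. \<forall>t\<in>{a..b}. f t = 2 powi k * t + c)"
    using f unfolding dyadic_piecewise_linear_def by (elim exE conjE) (rule that)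
  obtain n where n: "\<And>x. x \<in> D \<Longrightarrow> \<exists>m::int. x = of_int m / 2 ^ n"
    using dyadic_common_level[OF D] by blast
  define xs where "xs = map (\<lambda>m. (m, n)) [0..2 ^ n - 1 :: int]"
  have xs: "chain 0 xs 1" using chain_grid[of 0 "2 ^ n" n] by (simp add: xs_def)
  have aff: "\<exists>(k::int) c. \<forall>t\<in>{lo I..hi I}. f t = 2 powi k * t + c" if I: "I \<in> set xs" for I
  proof (rule lin[rule_format], intro conjI)
    show "0 \<le> lo I" "lo I < hi I" "hi I \<le> 1"
      using chain_cell_subset[OF xs I] lo_less_hi[of I] by auto
    show "{lo I<..<hi I} \<inter> D = {}"
    proof (rule ccontr)
      assume "{lo I<..<hi I} \<inter> D \<noteq> {}"
      then obtain x where x: "lo I < x" "x < hi I" "x \<in> D" by auto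
      obtain m :: int where m: "x = of_int m / 2 ^ n" using n[OF x(3)] ..
      obtain i where i: "I = (i, n)" using I by (auto simp: xs_def)
      have "real_of_int i < real_of_int m" "real_of_int m < real_of_int (i + 1)"
        using x(1,2) unfolding i m lo_simps hi_simps by (simp_all add: divide_less_cancel)
      then show False unfolding of_int_less_iff by simp
    qed
  qed
  have "\<forall>I\<in>set ys. f (lo I) \<in> dyadic"
    if "chain a ys b" "f a \<in> dyadic" "set ys \<subseteq> set xs" for a b ys
    using that
  proof (induction ys arbitrary: a)
    case (Cons I ys)
    then have Ixs: "I \<in> set xs" "lo I = a" "chain (hi I) ys b" "set ys \<subseteq> set xs" by auto
    obtain k c where k: "\<And>t. t \<in> {lo I..hi I} \<Longrightarrow> f t = 2 powi (k::int) * t + c"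
      using aff[OF Ixs(1)] by blast
    have "lo I \<in> {lo I..hi I}" "hi I \<in> {lo I..hi I}" using lo_less_hi[of I] by auto
    then have "f (hi I) = f (lo I) + 2 powi k * (hi I - lo I)" by (simp add: k algebra_simps)
    then have "f (hi I) = f (lo I) + 2 powi k / 2 ^ snd I" by (simp add: hi_eq)
    then have "f (hi I) \<in> dyadic"
      using dyadic_add[OF _ dyadic_power_int] Cons.prems(2) Ixs(2) by simp
    then have "\<forall>I\<in>set ys. f (lo I) \<in> dyadic" using Ixs(3,4) by (intro Cons.IH)
    then show ?case using Cons.prems(2) Ixs(2) by simp
  qed simp
  moreover have "f 0 \<in> dyadic" using dyadicI[of 0 0] f0 by simp
  ultimately have dy: "\<forall>I\<in>set xs. f (lo I) \<in> dyadic" using xs by blast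
  show ?thesis
  proof (rule finite_bad_of_chain[OF xs])
    fix I assume I: "I \<in> set xs"
    then obtain k c where k: "\<And>t. t \<in> {lo I..hi I} \<Longrightarrow> f t = 2 powi (k::int) * t + c"
      using aff by blast
    show "finite (bad {lo I..hi I} f)"
      by (rule finite_bad_of_affine[OF k bspec[OF dy I]])
  qed
qed

lemma finite_level_bound:
  fixes S :: "cell set"
  assumes "finite S"
  obtains K where "\<And>I. I \<in> S \<Longrightarrow> snd I < K"
proof
  show "snd I < Suc (Max (insert 0 (snd ` S)))" if "I \<in> S" for I
    using that assms by (simp add: less_Suc_eq_le)
qed

lemma unit_cell_containing:
  assumes "0 \<le> a" "a < 1"
  shows "\<exists>I. snd I = K \<and> lo I \<le> a \<and> a < hi I \<and> {lo I..hi I} \<subseteq> {0..1}"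
proof -
  define m where "m = \<lfloor>a * 2 ^ K\<rfloor>"
  have m: "of_int m \<le> a * 2 ^ K" "a * 2 ^ K < of_int m + 1" unfolding m_def by linarith+
  have "0 \<le> m" using assms by (simp add: m_def)
  have "a * 2 ^ K < 1 * 2 ^ K" using assms(2) by (intro mult_strict_right_mono) auto
  then have "of_int m < real_of_int (2 ^ K)"
    using m(1) unfolding of_int_power of_int_numeral by linarith
  then have "m < 2 ^ K" by (simp only: of_int_less_iff)
  then have "m + 1 \<le> 2 ^ K" by simp
  then have "real_of_int (m + 1) \<le> real_of_int (2 ^ K)" by (simp only: of_int_le_iff)
  then have "hi (m, K) \<le> 1" by (simp add: hi_simps)
  moreover have "0 \<le> lo (m, K)" using \<open>0 \<le> m\<close> by (simp add: lo_simps)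
  moreover have "lo (m, K) \<le> a" "a < hi (m, K)" using m by (simp_all add: lo_simps hi_simps field_simps)
  ultimately show ?thesis by (intro exI[of _ "(m, K)"]) auto
qed

lemma piecewise_linear_of_finite_bad:
  assumes "finite (bad {0..1} f)"
  shows "dyadic_piecewise_linear f"
proof -
  obtain K where K: "\<And>I. I \<in> bad {0..1} f \<Longrightarrow> snd I < K"
    using finite_level_bound[OF assms] by blast
  \<comment> \<open>Beyond the level of all bad intervals every interval is good, so the grid points of that level serve as singularities.\<close>
  define D where "D = (\<lambda>m::int. of_int m / (2::real) ^ K) ` {0..2 ^ K}"
  have "\<exists>(k::int) c. \<forall>t\<in>{a..b}. f t = 2 powi k * t + c"
    if ab: "0 \<le> a" "a < b" "b \<le> 1" "{a<..<b} \<inter> D = {}" for a b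
  proof -
    obtain I where I: "snd I = K" "lo I \<le> a" "a < hi I" "{lo I..hi I} \<subseteq> {0..1}"
      using unit_cell_containing[of a K] ab by auto
    have "hi I \<in> D"
    proof -
      obtain m where m: "I = (m, K)" using I(1) by (cases I) auto
      have "0 \<le> lo I" "hi I \<le> 1" using I(4) lo_less_hi[of I] by auto
      then have "real_of_int (m + 1) \<le> real_of_int (2 ^ K)" "real_of_int 0 \<le> of_int m"
        by (simp_all add: m lo_simps hi_simps field_simps)
      then have "m + 1 \<in> {0..2 ^ K}" by (simp only: of_int_le_iff) simp
      then have "of_int (m + 1) / 2 ^ K \<in> D" unfolding D_def by (rule imageI)
      then show ?thesis by (simp add: m hi_simps)
    qed
    then have "\<not> hi I \<in> {a<..<b}" using ab(4) by blast
    then have "b \<le> hi I" using I(3) by simp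
    have "I \<notin> bad {0..1} f" using K[of I] I(1) by auto
    then obtain J where J: "carries f I J" using I(4) by (auto simp: bad_def good_def)
    have s: "(2::real) ^ snd I / 2 ^ snd J = 2 powi (int (snd I) - int (snd J))"
      by (simp add: power_int_diff)
    have "\<forall>t\<in>{a..b}. f t = 2 powi (int (snd I) - int (snd J)) * t
        + (lo J - 2 powi (int (snd I) - int (snd J)) * lo I)"
    proof
      fix t assume "t \<in> {a..b}"
      then have "t \<in> {lo I..hi I}" using I(2) \<open>b \<le> hi I\<close> by auto
      from carries_eq[OF J this] show "f t = 2 powi (int (snd I) - int (snd J)) * t
        + (lo J - 2 powi (int (snd I) - int (snd J)) * lo I)"
        unfolding s by (simp add: algebra_simps)
    qed
    then show ?thesis by blast
  qed
  moreover have "finite D" "D \<subseteq> dyadic" using dyadicI by (auto simp: D_def)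
  ultimately show ?thesis
    unfolding dyadic_piecewise_linear_def by (intro exI[of _ D] conjI allI impI) simp_all
qed

lemma continuous_on_strict_mono_onto:
  fixes f :: "real \<Rightarrow> real"
  assumes m: "strict_mono_on {a..b} f" and im: "f ` {a..b} = {a..b}"
  shows "continuous_on {a..b} f"
proof -
  \<comment> \<open>Extended by the identity to the whole line, the map has an open image.\<close>
  define h where "h t = (if t \<in> {a..b} then f t else t)" for t
  have f: "f t \<in> {a..b}" if "t \<in> {a..b}" for t using im that by blast
  have "y \<in> range h" for y
  proof (cases "y \<in> {a..b}")
    case True
    then obtain x where "x \<in> {a..b}" "y = f x" using im by blast
    then have "y = h x" by (simp add: h_def)
    then show ?thesis by simp
  next
    case False
    then have "h y = y" unfolding h_def by (rule if_not_P)
    then show ?thesis by (metis rangeI)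
  qed
  then have "range h = UNIV" by blast
  moreover have "h x \<le> h y" if "x \<le> y" for x y
  proof (cases "x = y")
    case False
    show ?thesis
      using f[of x] f[of y] strict_mono_onD[OF m, of x y] that False
      by (auto simp: h_def split: if_splits)
  qed simp
  ultimately have "continuous_on UNIV h" by (intro continuous_onI_mono) auto
  then have "continuous_on {a..b} h" by (rule continuous_on_subset) simp
  moreover have "continuous_on {a..b} h = continuous_on {a..b} f"
    by (rule continuous_on_cong) (simp_all add: h_def)
  ultimately show ?thesis by simp
qed

text \<open>
  A piecewise linear map is affine on each member of a fine enough grid, and then sends all short
  standard intervals to standard intervals.  Conversely, past the level of the last bad interval
  the grid points serve as singularities, and continuity follows from monotonicity and
  surjectivity.
\<close>

lemma thompson_carrier_iff:
  "f \<in> carrier thompson_F \<longleftrightarrow> f \<in> extensional {0..1} \<and> strict_mono_on {0..1} f \<and>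
    f ` {0..1} = {0..1} \<and> finite (bad {0..1} f)" (is "?L \<longleftrightarrow> ?R")
proof
  assume ?L
  then have f: "f \<in> Bij {0..1}" "strict_mono_on {0..1} f" "dyadic_piecewise_linear f"
    by (auto simp: thompson_F_def)
  then have im: "f ` {0..1} = {0..1}" by (simp add: Bij_def bij_betw_def)
  then have "f 0 = 0" using strict_mono_onto_endpoints(1)[OF f(2) im] by simp
  then show ?R using f im finite_bad_of_piecewise_linear by (simp add: Bij_def)
next
  assume R: ?R
  then have "inj_on f {0..1}" using strict_mono_on_imp_inj_on by blast
  then show ?L
    using R continuous_on_strict_mono_onto[of 0 1 f] piecewise_linear_of_finite_bad[of f]
    by (auto simp: thompson_F_def Bij_def bij_betw_def)
qed

lemma thompsonD:
  assumes "f \<in> carrier thompson_F"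
  shows "f \<in> extensional {0..1}" "strict_mono_on {0..1} f" "f ` {0..1} = {0..1}"
    "finite (bad {0..1} f)" "f 0 = 0" "f 1 = 1" "inj_on f {0..1}" "f \<in> Bij {0..1}"
    "continuous_on {0..1} f"
proof -
  show *: "f \<in> extensional {0..1}" "strict_mono_on {0..1} f" "f ` {0..1} = {0..1}"
    "finite (bad {0..1} f)"
    using assms by (auto simp: thompson_carrier_iff)
  show "f 0 = 0" "f 1 = 1" using strict_mono_onto_endpoints[OF *(2,3)] by auto
  show "inj_on f {0..1}" using *(2) by (rule strict_mono_on_imp_inj_on)
  show "f \<in> Bij {0..1}" "continuous_on {0..1} f" using assms by (auto simp: thompson_F_def)
qed

lemma thompson_unit: "f \<in> carrier thompson_F \<Longrightarrow> x \<in> {0..1} \<Longrightarrow> f x \<in> {0..1}"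
  using thompsonD(3) by blast

lemma thompson_eqI:
  assumes "f \<in> carrier thompson_F" "g \<in> carrier thompson_F" "\<And>x. x \<in> {0..1} \<Longrightarrow> f x = g x"
  shows "f = g"
  by (rule extensionalityI[OF thompsonD(1)[OF assms(1)] thompsonD(1)[OF assms(2)] assms(3)])

lemma restrict_in_thompson:
  assumes "strict_mono_on {0..1} f" "f ` {0..1} = {0..1}" "finite (bad {0..1} f)"
  shows "restrict f {0..1} \<in> carrier thompson_F"
proof -
  have "bad {0..1} (restrict f {0..1}) = bad {0..1} f" by (rule bad_cong) simp
  then show ?thesis
    using assms by (auto simp: thompson_carrier_iff strict_mono_on_def image_restrict_eq)
qed

lemma map_images_carried:
  assumes "\<forall>I\<in>set xs. good f I"
  obtains ys where "list_all2 (carries f) xs ys"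
proof
  show "list_all2 (carries f) xs (map (\<lambda>I. SOME J. carries f I J) xs)"
    unfolding list.rel_map
  proof (rule list.rel_refl_strong)
    fix I assume "I \<in> set xs"
    then have "\<exists>J. carries f I J" using assms by (auto simp: good_def)
    then show "carries f I (SOME J. carries f I J)" by (rule someI_ex)
  qed
qed

lemma thompson_tree_pair:
  assumes f: "f \<in> carrier thompson_F"
  obtains S T where "num_leaves S \<le> card (bad {0..1} f) + 1" "num_leaves T = num_leaves S"
    "list_all2 (carries f) (leaves (0, 0) S) (leaves (0, 0) T)"
proof -
  have root: "lo (0, 0) = 0" "hi (0, 0) = 1" by (simp_all add: lo_simps hi_simps)
  obtain S where S: "num_leaves S \<le> card (bad {0..1} f) + 1" "\<forall>J\<in>set (leaves (0, 0) S). good f J"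
    using good_tree_exists[of "(0, 0)" f] thompsonD(4)[OF f] by (auto simp: root)
  obtain ys where ys: "list_all2 (carries f) (leaves (0, 0) S) ys"
    using map_images_carried[OF S(2)] .
  have "chain (f 0) ys (f 1)"
    using chain_images[OF ys] chain_leaves[of "(0, 0)" S] by (simp add: root)
  then have "chain (lo (0, 0)) ys (hi (0, 0))"
    using thompsonD(5,6)[OF f] by (simp add: root)
  then obtain T where T: "leaves (0, 0) T = ys" using chain_is_leaves by blast
  moreover have "num_leaves T = num_leaves S"
    using list_all2_lengthD[OF ys] unfolding T[symmetric] length_leaves by simp
  ultimately show ?thesis using that S(1) ys by blast
qed

text \<open>
  The inverse carries the members of the image subdivision back, so a subdivision into good
  intervals for \<open>f\<close> yields one for its inverse.
\<close>

lemma thompson_inv_into: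
  assumes f: "f \<in> carrier thompson_F"
  shows "restrict (inv_into {0..1} f) {0..1} \<in> carrier thompson_F"
proof (rule restrict_in_thompson)
  note F = thompsonD[OF f]
  have g: "inv_into {0..1} f y \<in> {0..1}" "f (inv_into {0..1} f y) = y" if "y \<in> {0..1}" for y
    using that F(3) inv_into_into[of y f "{0..1}"] f_inv_into_f[of y f "{0..1}"] by auto
  have gf: "inv_into {0..1} f (f x) = x" if "x \<in> {0..1}" for x
    using F(7) that by (rule inv_into_f_f)
  show "strict_mono_on {0..1} (inv_into {0..1} f)"
  proof (rule strict_mono_onI, rule ccontr)
    fix x y :: real
    assume xy: "x \<in> {0..1}" "y \<in> {0..1}" "x < y" and "\<not> inv_into {0..1} f x < inv_into {0..1} f y"
    then have le: "inv_into {0..1} f y \<le> inv_into {0..1} f x" by simp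
    have "f (inv_into {0..1} f y) \<le> f (inv_into {0..1} f x)"
      using g[OF xy(1)] g[OF xy(2)] le
      by (intro monotone_onD[OF strict_mono_on_imp_mono_on[OF F(2)]]) auto
    then show False using g xy by simp
  qed
  show "inv_into {0..1} f ` {0..1} = {0..1}"
    using inv_into_image_cancel[OF F(7) order_refl] F(3) by simp
  obtain S T where ST: "num_leaves T = num_leaves S"
    "list_all2 (carries f) (leaves (0, 0) S) (leaves (0, 0) T)"
    by (rule thompson_tree_pair[OF f], rule that)
  have root: "lo (0, 0) = 0" "hi (0, 0) = 1" by (simp_all add: lo_simps hi_simps)
  have good: "good (inv_into {0..1} f) J" if "J \<in> set (leaves (0, 0) T)" for J
  proof -
    have "\<exists>i<length (leaves (0, 0) T). J = leaves (0, 0) T ! i"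
      using that by (auto simp: in_set_conv_nth)
    then obtain i where i: "i < length (leaves (0, 0) T)" "J = leaves (0, 0) T ! i" by (elim exE conjE)
    define I where "I = leaves (0, 0) S ! i"
    have "i < length (leaves (0, 0) S)" using i(1) by (simp only: length_leaves ST(1))
    then have I: "I \<in> set (leaves (0, 0) S)" "carries f I J"
      unfolding I_def i(2) by (rule nth_mem, rule list_all2_nthD[OF ST(2)])
    have sub: "{lo I..hi I} \<subseteq> {0..1}"
      using chain_cell_subset[OF chain_leaves I(1)] unfolding root .
    have "carries (inv_into {0..1} f) J I"
      by (rule carries_inverse[OF I(2)], rule gf, rule subsetD[OF sub])
    then show ?thesis unfolding good_def by blast
  qed
  have "chain 0 (leaves (0, 0) T) 1" using chain_leaves[of "(0, 0)" T] by (simp add: root)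
  then show "finite (bad {0..1} (inv_into {0..1} f))"
    by (rule finite_bad_of_chain) (simp only: bad_eq_empty_of_good[OF good] finite.emptyI)
qed

lemma thompson_compose:
  assumes f: "f \<in> carrier thompson_F" and g: "g \<in> carrier thompson_F"
  shows "compose {0..1} f g \<in> carrier thompson_F"
    and "card (bad {0..1} (compose {0..1} f g)) \<le> card (bad {0..1} f) + card (bad {0..1} g)"
proof -
  note F = thompsonD[OF f] and G = thompsonD[OF g]
  have bad: "bad {0..1} (compose {0..1} f g) = bad {0..1} (f \<circ> g)"
    by (rule bad_cong) (simp add: compose_def)
  have im: "g ` {0..1} \<subseteq> {0..1}" using G(3) by simp
  have fin: "finite (bad {0..1} (compose {0..1} f g))"
    using bad_comp(1)[OF G(7) im G(4) F(4)] bad by simp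
  show "card (bad {0..1} (compose {0..1} f g)) \<le> card (bad {0..1} f) + card (bad {0..1} g)"
    using bad_comp(2)[OF G(7) im G(4) F(4)] bad by simp
  have "strict_mono_on {0..1} (compose {0..1} f g)"
  proof (rule strict_mono_onI)
    fix x y :: real assume xy: "x \<in> {0..1}" "y \<in> {0..1}" "x < y"
    then have "f (g x) < f (g y)"
      using thompson_unit[OF g] by (intro strict_mono_onD[OF F(2)] strict_mono_onD[OF G(2)]) auto
    then show "compose {0..1} f g x < compose {0..1} f g y" using xy by (simp add: compose_def)
  qed
  moreover have "compose {0..1} f g ` {0..1} = {0..1}"
  proof -
    have "compose {0..1} f g ` {0..1} = f ` g ` {0..1}" by (auto simp: compose_def image_image)
    then show ?thesis using F(3) G(3) by simp
  qed
  ultimately show "compose {0..1} f g \<in> carrier thompson_F"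
    using fin by (simp add: thompson_carrier_iff compose_extensional)
qed

lemma subgroup_thompson: "subgroup (carrier thompson_F) (BijGroup {0..1})"
proof (rule group.subgroupI[OF group_BijGroup])
  show "carrier thompson_F \<subseteq> carrier (BijGroup {0..1})"
    by (auto simp: thompson_F_def BijGroup_def)
  have "restrict (\<lambda>x. x) {0..1} \<in> carrier thompson_F"
  proof (rule restrict_in_thompson)
    show "finite (bad {0..1} (\<lambda>x. x))" by (subst bad_id) auto
  qed (auto intro: strict_mono_onI)
  then show "carrier thompson_F \<noteq> {}" by blast
next
  fix f assume "f \<in> carrier thompson_F"
  then show "inv\<^bsub>BijGroup {0..1}\<^esub> f \<in> carrier thompson_F"
    using thompson_inv_into inv_BijGroup[OF thompsonD(8)] by simp
next
  fix f g assume "f \<in> carrier thompson_F" "g \<in> carrier thompson_F"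
  then show "f \<otimes>\<^bsub>BijGroup {0..1}\<^esub> g \<in> carrier thompson_F"
    using thompson_compose(1) thompsonD(8) by (simp add: BijGroup_def)
qed

lemma thompson_F_eq: "thompson_F = BijGroup {0..1} \<lparr>carrier := carrier thompson_F\<rparr>"
  by (simp add: thompson_F_def)

lemma group_thompson: "group thompson_F"
  using subgroup.subgroup_is_group[OF subgroup_thompson group_BijGroup]
  unfolding thompson_F_eq[symmetric] .

interpretation thompson: group thompson_F
  by (rule group_thompson)

lemma thompson_one: "\<one>\<^bsub>thompson_F\<^esub> = (\<lambda>x\<in>{0..1}. x)"
  by (simp add: thompson_F_def BijGroup_def)

lemma thompson_mult:
  assumes "f \<in> carrier thompson_F" "g \<in> carrier thompson_F"
  shows "f \<otimes>\<^bsub>thompson_F\<^esub> g = compose {0..1} f g"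
  using thompsonD(8)[OF assms(1)] thompsonD(8)[OF assms(2)] by (simp add: thompson_F_def BijGroup_def)

lemma thompson_mult_apply:
  "f \<in> carrier thompson_F \<Longrightarrow> g \<in> carrier thompson_F \<Longrightarrow> x \<in> {0..1} \<Longrightarrow>
    (f \<otimes>\<^bsub>thompson_F\<^esub> g) x = f (g x)"
  by (simp add: thompson_mult compose_def)

lemma thompson_inv_apply:
  assumes "f \<in> carrier thompson_F" "x \<in> {0..1}"
  shows "(inv\<^bsub>thompson_F\<^esub> f) (f x) = x" "f ((inv\<^bsub>thompson_F\<^esub> f) x) = x"
proof -
  have i: "inv\<^bsub>thompson_F\<^esub> f \<in> carrier thompson_F" using assms(1) by simp
  show "(inv\<^bsub>thompson_F\<^esub> f) (f x) = x"
    using thompson_mult_apply[OF i assms] assms by (simp add: thompson_one)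
  show "f ((inv\<^bsub>thompson_F\<^esub> f) x) = x"
    using thompson_mult_apply[OF assms(1) i assms(2)] assms by (simp add: thompson_one)
qed

text \<open>
  The number of inner nodes of the smallest tree pair that represents \<open>f\<close>.
\<close>

definition complexity :: "(real \<Rightarrow> real) \<Rightarrow> nat"
  where "complexity f = card (bad {0..1} f)"

lemma complexity_one: "complexity \<one>\<^bsub>thompson_F\<^esub> = 0"
  unfolding complexity_def thompson_one by (subst bad_id) auto

lemma complexity_mult:
  "f \<in> carrier thompson_F \<Longrightarrow> g \<in> carrier thompson_F \<Longrightarrow>
    complexity (f \<otimes>\<^bsub>thompson_F\<^esub> g) \<le> complexity f + complexity g"
  unfolding complexity_def by (simp add: thompson_mult thompson_compose(2))

section \<open>Linear bound on word length in Thompson's group\<close>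

text \<open>
  The two standard generators of \<open>F\<close>: \<open>x1\<close> is the identity on the left half and a scaled copy of
  \<open>x0\<close> on the right half.
\<close>

definition x0 :: "real \<Rightarrow> real"
  where "x0 = (\<lambda>t\<in>{0..1}. if t \<le> 1 / 4 then 2 * t else if t \<le> 1 / 2 then t + 1 / 4 else t / 2 + 1 / 2)"

definition x1 :: "real \<Rightarrow> real"
  where "x1 = (\<lambda>t\<in>{0..1}. if t \<le> 1 / 2 then t else if t \<le> 5 / 8 then 2 * t - 1 / 2
    else if t \<le> 3 / 4 then t + 1 / 8 else t / 2 + 1 / 2)"

definition tree_map :: "(real \<Rightarrow> real) \<Rightarrow> tree \<Rightarrow> tree \<Rightarrow> bool"
  where "tree_map f S T \<longleftrightarrow> list_all2 (carries f) (leaves (0, 0) S) (leaves (0, 0) T)"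

lemma chain_unit_leaves: "chain 0 (leaves (0, 0) T) 1"
  using chain_leaves[of "(0, 0)" T] by (simp add: lo_simps hi_simps)

lemma leaf_unit: "I \<in> set (leaves (0, 0) T) \<Longrightarrow> {lo I..hi I} \<subseteq> {0..1}"
  using chain_cell_subset[OF chain_unit_leaves] .

lemma list_all2_carries_good:
  "list_all2 (carries f) xs ys \<Longrightarrow> I \<in> set xs \<Longrightarrow> good f I"
  unfolding good_def by (induction rule: list_all2_induct) auto

lemma finite_bad_of_chain_map:
  assumes "list_all2 (carries f) xs ys" "chain a xs b"
  shows "finite (bad {a..b} f)"
  by (rule finite_bad_of_chain[OF assms(2)])
    (simp only: bad_eq_empty_of_good[OF list_all2_carries_good[OF assms(1)]] finite.emptyI)

lemma restrict_tree_map_in_thompson: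
  assumes "tree_map f S T"
  shows "restrict f {0..1} \<in> carrier thompson_F"
proof (rule restrict_in_thompson)
  note c = assms[unfolded tree_map_def]
  show "strict_mono_on {0..1} f" "f ` {0..1} = {0..1}"
    using chain_map_strict_mono[OF c chain_unit_leaves chain_unit_leaves] by simp_all
  show "finite (bad {0..1} f)" by (rule finite_bad_of_chain_map[OF c chain_unit_leaves])
qed

lemma tree_map_mult:
  assumes f: "f \<in> carrier thompson_F" "tree_map f S T"
    and g: "g \<in> carrier thompson_F" "tree_map g T U"
  shows "tree_map (g \<otimes>\<^bsub>thompson_F\<^esub> f) S U"
proof -
  have "list_all2 (carries (g \<circ> f)) (leaves (0, 0) S) (leaves (0, 0) U)"
    by (rule list_all2_trans[OF _ f(2)[unfolded tree_map_def] g(2)[unfolded tree_map_def]])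
      (rule carries_comp)
  then show ?thesis
    unfolding tree_map_def
  proof (rule list.rel_mono_strong)
    fix I J assume I: "I \<in> set (leaves (0, 0) S)" and c: "carries (g \<circ> f) I J"
    have "(g \<circ> f) x = (g \<otimes>\<^bsub>thompson_F\<^esub> f) x" if "x \<in> {lo I..hi I}" for x
      using thompson_mult_apply[OF g(1) f(1) subsetD[OF leaf_unit[OF I] that]] by simp
    from carries_cong[of I "g \<circ> f" "g \<otimes>\<^bsub>thompson_F\<^esub> f", OF this] c show "carries (g \<otimes>\<^bsub>thompson_F\<^esub> f) I J" by blast
  qed
qed

lemma tree_map_inv:
  assumes f: "f \<in> carrier thompson_F" "tree_map f S T"
  shows "tree_map (inv\<^bsub>thompson_F\<^esub> f) T S"
  unfolding tree_map_def
proof (rule list_all2_all_nthI)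
  note c = f(2)[unfolded tree_map_def]
  show len: "length (leaves (0, 0) T) = length (leaves (0, 0) S)"
    using list_all2_lengthD[OF c] by (rule sym)
  fix i assume "i < length (leaves (0, 0) T)"
  then have i: "i < length (leaves (0, 0) S)" by (simp only: len)
  show "carries (inv\<^bsub>thompson_F\<^esub> f) (leaves (0, 0) T ! i) (leaves (0, 0) S ! i)"
    by (rule carries_inverse[OF list_all2_nthD[OF c i]])
      (rule thompson_inv_apply(1)[OF f(1) subsetD[OF leaf_unit[OF nth_mem[OF i]]]])
qed

lemma tree_map_unique:
  assumes f: "f \<in> carrier thompson_F" "tree_map f S T"
    and g: "g \<in> carrier thompson_F" "tree_map g S T"
  shows "f = g"
proof (rule thompson_eqI[OF f(1) g(1)])
  fix x :: real assume x: "x \<in> {0..1}"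
  show "f x = g x"
  proof (cases "x = 1")
    case True
    then show ?thesis using thompsonD(6)[OF f(1)] thompsonD(6)[OF g(1)] by simp
  next
    case False
    then obtain I where I: "I \<in> set (leaves (0, 0) S)" "x \<in> {lo I..<hi I}"
      using chain_covers[OF chain_unit_leaves, of x S] x by auto
    then obtain i where i: "i < length (leaves (0, 0) S)" "I = leaves (0, 0) S ! i"
      unfolding in_set_conv_nth by blast
    have xI: "x \<in> {lo I..hi I}" using I(2) by simp
    have "carries f I (leaves (0, 0) T ! i)" "carries g I (leaves (0, 0) T ! i)"
      using list_all2_nthD[OF f(2)[unfolded tree_map_def] i(1)]
        list_all2_nthD[OF g(2)[unfolded tree_map_def] i(1)] i(2) by simp_all
    from carries_eq[OF this(1) xI] carries_eq[OF this(2) xI] show ?thesis by simp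
  qed
qed

lemma tree_map_one: "tree_map \<one>\<^bsub>thompson_F\<^esub> T T"
  unfolding tree_map_def thompson_one
proof (rule list.rel_refl_strong)
  fix I assume "I \<in> set (leaves (0, 0) T)"
  from leaf_unit[OF this] show "carries (\<lambda>x\<in>{0..1}. x) I I"
    by (intro carries_id) auto
qed

lemma tree_map_x0: "tree_map x0 (Node (Node A B) C) (Node A (Node B C))"
proof -
  have "carries x0 (descendant (descendant (0, 0) 1 0) 1 0) (descendant (0, 0) 1 0)"
    "carries x0 (descendant (descendant (0, 0) 1 0) 1 1) (descendant (descendant (0, 0) 1 1) 1 0)"
    "carries x0 (descendant (0, 0) 1 1) (descendant (descendant (0, 0) 1 1) 1 1)"
    by (auto simp: carries_def x0_def field_simps)
  then show ?thesis
    unfolding tree_map_def leaves.simps append_assoc by (intro list_all2_appendI carries_leaves)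
qed

lemma tree_map_x1: "tree_map x1 (Node A (Node (Node B C) D)) (Node A (Node B (Node C D)))"
proof -
  have "carries x1 (descendant (0, 0) 1 0) (descendant (0, 0) 1 0)"
    "carries x1 (descendant (descendant (descendant (0, 0) 1 1) 1 0) 1 0)
      (descendant (descendant (0, 0) 1 1) 1 0)"
    "carries x1 (descendant (descendant (descendant (0, 0) 1 1) 1 0) 1 1)
      (descendant (descendant (descendant (0, 0) 1 1) 1 1) 1 0)"
    "carries x1 (descendant (descendant (0, 0) 1 1) 1 1)
      (descendant (descendant (descendant (0, 0) 1 1) 1 1) 1 1)"
    by (auto simp: carries_def x1_def field_simps)
  then show ?thesis
    unfolding tree_map_def leaves.simps append_assoc by (intro list_all2_appendI carries_leaves)
qed

lemma x0_x1_closed: "{x0, x1} \<subseteq> carrier thompson_F"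
proof -
  have "restrict x0 {0..1} = x0" "restrict x1 {0..1} = x1"
    unfolding x0_def x1_def by (rule restrict_restrict[THEN trans], simp)+
  then show ?thesis
    using restrict_tree_map_in_thompson[OF tree_map_x0] restrict_tree_map_in_thompson[OF tree_map_x1]
    by simp
qed

fun left_comb :: "tree list \<Rightarrow> tree"
  where "left_comb [] = Leaf"
  | "left_comb (l # ls) = Node (left_comb ls) l"

fun right_comb :: "tree list \<Rightarrow> tree"
  where "right_comb [] = Leaf"
  | "right_comb (r # rs) = Node r (right_comb rs)"

text \<open>
  A tree with a pointer: the entries of \<open>ls\<close> hang off the left spine and those of \<open>rs\<close> off the right
  spine, with the entries nearest to the root first.  Rotating at the root moves one entry from one
  list to the other.
\<close>

definition zipper :: "tree list \<Rightarrow> tree list \<Rightarrow> tree"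
  where "zipper ls rs = Node (left_comb ls) (right_comb rs)"

lemma left_comb_exists: "\<exists>ls. T = left_comb ls"
proof (induction T)
  case Leaf
  show ?case by (rule exI[of _ "[]"]) simp
next
  case (Node S T)
  then obtain ls where "S = left_comb ls" by blast
  then show ?case by (intro exI[of _ "T # ls"]) simp
qed

lemma right_comb_exists: "\<exists>rs. T = right_comb rs"
proof (induction T)
  case Leaf
  show ?case by (rule exI[of _ "[]"]) simp
next
  case (Node S T)
  then obtain rs where "T = right_comb rs" by blast
  then show ?case by (intro exI[of _ "S # rs"]) simp
qed

text \<open>
  The number of nodes, which is the number of moves that it takes to dissolve the tree: one
  expansion for each inner node and one shift for each leaf.
\<close>

fun work :: "tree \<Rightarrow> nat"
  where "work Leaf = 1"
  | "work (Node S T) = 1 + work S + work T"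

lemma work_le: "work T \<le> 2 * num_leaves T"
proof -
  have "work T + 1 = 2 * num_leaves T" by (induction T) auto
  then show ?thesis by simp
qed

abbreviation thompson_ball :: "nat \<Rightarrow> (real \<Rightarrow> real) set"
  where "thompson_ball \<equiv> word_ball thompson_F {x0, x1}"

text \<open>
  Word length transferred to trees, so that bounds add up along a sequence of trees.
\<close>

definition reachable :: "nat \<Rightarrow> tree \<Rightarrow> tree \<Rightarrow> bool"
  where "reachable n S T \<longleftrightarrow> (\<exists>f\<in>thompson_ball n. tree_map f S T)"

lemma reachable_refl: "reachable n T T"
  unfolding reachable_def using tree_map_one thompson.one_in_word_ball by blast

lemma reachable_trans:
  assumes "reachable m S T" "reachable n T U"
  shows "reachable (m + n) S U"
proof -
  obtain f where f: "f \<in> thompson_ball m" "tree_map f S T" using assms(1) unfolding reachable_def ..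
  obtain g where g: "g \<in> thompson_ball n" "tree_map g T U" using assms(2) unfolding reachable_def ..
  note c = thompson.word_ball_closed[OF f(1) x0_x1_closed] thompson.word_ball_closed[OF g(1) x0_x1_closed]
  have "tree_map (g \<otimes>\<^bsub>thompson_F\<^esub> f) S U" by (rule tree_map_mult[OF c(1) f(2) c(2) g(2)])
  moreover have "g \<otimes>\<^bsub>thompson_F\<^esub> f \<in> thompson_ball (n + m)"
    by (rule thompson.word_ball_mult[OF x0_x1_closed g(1) f(1)])
  ultimately show ?thesis unfolding reachable_def by (metis add.commute)
qed

lemma reachable_sym:
  assumes "reachable n S T"
  shows "reachable n T S"
proof -
  obtain f where f: "f \<in> thompson_ball n" "tree_map f S T" using assms unfolding reachable_def ..
  note c = thompson.word_ball_closed[OF f(1) x0_x1_closed]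
  show ?thesis
    unfolding reachable_def
    by (rule bexI, rule tree_map_inv[OF c f(2)], rule thompson.word_ball_inv[OF f(1) x0_x1_closed])
qed

lemma reachable_mono:
  assumes "reachable m S T" "m \<le> n"
  shows "reachable n S T"
proof -
  obtain f where f: "f \<in> thompson_ball m" "tree_map f S T" using assms(1) unfolding reachable_def ..
  show ?thesis
    unfolding reachable_def
    by (rule bexI, rule f(2), rule subsetD[OF word_ball_mono[OF order_refl assms(2)] f(1)])
qed

lemma reachable_shift: "reachable 1 (zipper (l # ls) rs) (zipper ls (l # rs))"
  unfolding reachable_def zipper_def left_comb.simps right_comb.simps
  by (rule bexI, rule tree_map_x0, rule thompson.generator_in_word_ball[OF _ x0_x1_closed]) simp

lemma reachable_expand: "reachable 1 (zipper ls (Node S T # rs)) (zipper ls (S # T # rs))"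
  unfolding reachable_def zipper_def right_comb.simps
  by (rule bexI, rule tree_map_x1, rule thompson.generator_in_word_ball[OF _ x0_x1_closed]) simp

text \<open>
  The first tree to the right of the pointer is expanded until it is a leaf, and then the pointer
  moves past that leaf.  Each node is touched once, so that the pointer never has to travel back.
\<close>

lemma reachable_dissolve:
  "reachable (sum_list (map work rs)) (zipper ls rs)
    (zipper (replicate (sum_list (map num_leaves rs)) Leaf @ ls) [])"
proof (induction "sum_list (map work rs)" arbitrary: ls rs rule: less_induct)
  case less
  show ?case
  proof (cases rs)
    case Nil
    then show ?thesis by (simp add: reachable_refl)
  next
    case (Cons r rs')
    show ?thesis
    proof (cases r)
      case Leaf
      have "reachable (sum_list (map work rs')) (zipper (Leaf # ls) rs')
          (zipper (replicate (sum_list (map num_leaves rs')) Leaf @ Leaf # ls) [])"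
        using less[of rs' "Leaf # ls"] Cons Leaf by simp
      from reachable_trans[OF reachable_sym[OF reachable_shift] this] show ?thesis
        using Cons Leaf by (simp add: replicate_app_Cons_same)
    next
      case (Node S T)
      have "reachable (sum_list (map work (S # T # rs'))) (zipper ls (S # T # rs'))
          (zipper (replicate (sum_list (map num_leaves (S # T # rs'))) Leaf @ ls) [])"
        using less[of "S # T # rs'" ls] Cons Node by simp
      from reachable_trans[OF reachable_expand this] show ?thesis
        using Cons Node by (simp add: add.assoc)
    qed
  qed
qed

lemma reachable_collect: "reachable (length ls) (zipper ls rs) (zipper [] (rev ls @ rs))"
proof (induction ls arbitrary: rs)
  case Nil
  then show ?case by (simp add: reachable_refl)
next
  case (Cons l ls)
  from reachable_trans[OF reachable_shift this] show ?case by simp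
qed

text \<open>
  The target depends on the number of leaves alone, so two trees with equally many leaves are
  connected through it.
\<close>

lemma reachable_comb:
  assumes "2 \<le> num_leaves T"
  shows "reachable (3 * num_leaves T) T (zipper (replicate (num_leaves T - 2) Leaf) [])"
proof -
  obtain A B where T: "T = Node A B" using assms by (cases T) auto
  obtain ls where A: "A = left_comb ls" using left_comb_exists by blast
  obtain rs where B: "B = right_comb rs" using right_comb_exists by blast
  have zip: "T = zipper ls rs" by (simp add: T A B zipper_def)
  define m where "m = sum_list (map num_leaves (rev ls @ rs))"
  have "num_leaves (left_comb us) = 1 + sum_list (map num_leaves us)" for us
    by (induction us) auto
  moreover have "num_leaves (right_comb us) = 1 + sum_list (map num_leaves us)" for us
    by (induction us) auto
  ultimately have m: "num_leaves T = m + 2"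
    by (simp add: T A B m_def rev_map[symmetric])
  have "length us \<le> sum_list (map num_leaves us)" for us
  proof (induction us)
    case (Cons T us)
    then show ?case using num_leaves_pos[of T] by (simp del: num_leaves_pos)
  qed simp
  from this[of ls] have len: "length ls \<le> m" by (simp add: m_def rev_map[symmetric])
  have "sum_list (map work us) \<le> 2 * sum_list (map num_leaves us)" for us
  proof (induction us)
    case (Cons T us)
    then show ?case using work_le[of T] by simp
  qed simp
  from this[of "rev ls @ rs"] have work: "sum_list (map work (rev ls @ rs)) \<le> 2 * m"
    unfolding m_def .
  have "reachable (length ls + sum_list (map work (rev ls @ rs))) T
      (zipper (replicate m Leaf @ []) [])"
    unfolding zip m_def by (rule reachable_trans[OF reachable_collect reachable_dissolve])
  then have "reachable (length ls + sum_list (map work (rev ls @ rs))) T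
      (zipper (replicate (num_leaves T - 2) Leaf) [])"
    by (simp only: append_Nil2 m add_diff_cancel_right')
  then show ?thesis by (rule reachable_mono) (use len work m in linarith)
qed

lemma thompson_word_bound:
  assumes f: "f \<in> carrier thompson_F"
  shows "f \<in> thompson_ball (6 * (complexity f + 1))"
proof -
  obtain S T where ST: "num_leaves S \<le> complexity f + 1" "num_leaves T = num_leaves S"
    and fST: "tree_map f S T"
    by (rule thompson_tree_pair[OF f, folded complexity_def tree_map_def], rule that)
  have "reachable (6 * num_leaves S) S T"
  proof (cases "2 \<le> num_leaves S")
    case True
    have "reachable (3 * num_leaves S) T (zipper (replicate (num_leaves S - 2) Leaf) [])"
      using reachable_comb[of T] unfolding ST(2) using True by blast
    from reachable_trans[OF reachable_comb[OF True] reachable_sym[OF this]]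
    show ?thesis by (rule reachable_mono) simp
  next
    case False
    have leaf: "U = Leaf" if "\<not> 2 \<le> num_leaves U" for U
    proof (cases U)
      case (Node A B)
      then show ?thesis using that num_leaves_pos[of A] num_leaves_pos[of B]
        by (simp del: num_leaves_pos)
    qed
    have "S = Leaf" "T = Leaf" using leaf[of S] leaf[of T, unfolded ST(2)] False by blast+
    then show ?thesis by (simp only: reachable_refl)
  qed
  then obtain h where h: "h \<in> thompson_ball (6 * num_leaves S)" "tree_map h S T"
    unfolding reachable_def ..
  have "f = h"
    by (rule tree_map_unique[OF f fST thompson.word_ball_closed[OF h(1) x0_x1_closed] h(2)])
  moreover have "thompson_ball (6 * num_leaves S) \<subseteq> thompson_ball (6 * (complexity f + 1))"
    by (rule word_ball_mono[OF order_refl]) (use ST(1) in simp)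
  ultimately show ?thesis using subsetD[OF _ h(1)] by simp
qed

section \<open>Maps supported in a dyadic interval\<close>

text \<open>
  Both the elements supported in \<open>[a,b]\<close> and the pieces of a map that fixes \<open>a\<close> and \<open>b\<close> have this form.
\<close>

definition extend_by_id :: "real \<Rightarrow> real \<Rightarrow> (real \<Rightarrow> real) \<Rightarrow> real \<Rightarrow> real"
  where "extend_by_id a b u = (\<lambda>t\<in>{0..1}. if t \<in> {a..b} then u t else t)"

text \<open>
  For dyadic \<open>a\<close> there are only finitely many of these intervals, and they are the only ones whose
  status can deteriorate when a map is cut at \<open>a\<close>.
\<close>

definition straddling :: "real \<Rightarrow> cell set"
  where "straddling a = {I. {lo I..hi I} \<subseteq> {0..1} \<and> lo I < a \<and> a < hi I}"

lemma finite_straddling: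
  assumes "a \<in> dyadic"
  shows "finite (straddling a)"
proof -
  obtain j p where a: "a = of_int (j::int) / 2 ^ p" using assms by (auto simp: dyadic_def)
  have "straddling a \<subseteq> {I. 0 \<le> lo I \<and> hi I \<le> 1 \<and> snd I < p}"
  proof
    fix I assume I: "I \<in> straddling a"
    obtain m n where mn: "I = (m, n)" by (cases I)
    have "\<not> p \<le> n"
    proof
      assume "p \<le> n"
      then obtain d where d: "n = p + d" by (auto simp: le_iff_add)
      have "lo I < a" "a < hi I" using I by (auto simp: straddling_def)
      then have "real_of_int m < real_of_int (j * 2 ^ d)" "real_of_int (j * 2 ^ d) < real_of_int (m + 1)"
        by (simp_all add: mn lo_simps hi_simps a d power_add field_simps)
      then show False unfolding of_int_less_iff by simp
    qed
    moreover have "0 \<le> lo I \<and> hi I \<le> 1" using I lo_less_hi[of I] by (auto simp: straddling_def)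
    ultimately show "I \<in> {I. 0 \<le> lo I \<and> hi I \<le> 1 \<and> snd I < p}" by (simp add: mn)
  qed
  then show ?thesis by (rule finite_subset[OF _ finite_cells_bounded_level])
qed

lemma extend_by_id_in_thompson:
  assumes ab: "a \<in> dyadic" "b \<in> dyadic" "0 \<le> a" "a \<le> b" "b \<le> 1"
    and u: "strict_mono_on {a..b} u" "u ` {a..b} = {a..b}" "finite (bad {a..b} u)"
  shows "extend_by_id a b u \<in> carrier thompson_F"
    and "complexity (extend_by_id a b u) \<le> card (bad {a..b} u) + (card (straddling a) + card (straddling b))"
proof -
  define h where "h t = (if t \<in> {a..b} then u t else t)" for t
  have ends: "u a = a" "u b = b" using strict_mono_onto_endpoints[OF u(1,2) ab(4)] by simp_all
  have uab: "u t \<in> {a..b}" if "t \<in> {a..b}" for t using u(2) that by blast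
  have hid: "h t = t" if "t \<le> a \<or> b \<le> t" for t using that ends by (auto simp: h_def)
  have "bad {0..1} h \<subseteq> bad {a..b} u \<union> (straddling a \<union> straddling b)"
  proof
    fix I assume I: "I \<in> bad {0..1} h"
    then have sub: "{lo I..hi I} \<subseteq> {0..1}" and ng: "\<not> good h I" by (auto simp: bad_def)
    have nid: "\<not> (\<forall>t\<in>{lo I..hi I}. h t = t)" using ng carries_id[of I h] unfolding good_def by blast
    show "I \<in> bad {a..b} u \<union> (straddling a \<union> straddling b)"
    proof (cases "I \<in> straddling a \<or> I \<in> straddling b")
      case False
      then have st: "lo I \<ge> a \<or> hi I \<le> a" "lo I \<ge> b \<or> hi I \<le> b"
        using sub by (auto simp: straddling_def)
      have "\<not> hi I \<le> a" "\<not> b \<le> lo I" using nid hid by auto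
      then have abI: "{lo I..hi I} \<subseteq> {a..b}" using st by auto
      have "\<not> good u I"
        using ng good_cong[of I h u] abI by (auto simp: h_def)
      then show ?thesis using abI by (simp add: bad_def)
    qed blast
  qed
  moreover have fin: "finite (bad {a..b} u \<union> (straddling a \<union> straddling b))"
    using u(3) ab finite_straddling by simp
  ultimately have finh: "finite (bad {0..1} h)"
    and card: "card (bad {0..1} h) \<le> card (bad {a..b} u \<union> (straddling a \<union> straddling b))"
    by (rule finite_subset, rule card_mono[rotated])
  have ext: "extend_by_id a b u = restrict h {0..1}"
    unfolding extend_by_id_def h_def ..
  have mono: "strict_mono_on {0..1} h"
  proof (rule strict_mono_onI)
    fix x y :: real assume "x \<in> {0..1}" "y \<in> {0..1}" "x < y"
    then show "h x < h y"
      using uab[of x] uab[of y] strict_mono_onD[OF u(1), of x y] by (auto simp: h_def split: if_splits)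
  qed
  have im: "h ` {0..1} = {0..1}"
  proof
    show "h ` {0..1} \<subseteq> {0..1}" using uab ab by (force simp: h_def)
    show "{0..1} \<subseteq> h ` {0..1}"
    proof
      fix y :: real assume y: "y \<in> {0..1}"
      show "y \<in> h ` {0..1}"
      proof (cases "y \<in> {a..b}")
        case True
        then obtain x where x: "x \<in> {a..b}" "y = u x" using u(2) by blast
        then have "y = h x" by (simp add: h_def)
        moreover have "x \<in> {0..1}" using x ab by auto
        ultimately show ?thesis by (rule image_eqI)
      next
        case False
        then have "y = h y" by (auto simp: h_def)
        then show ?thesis using y by (rule image_eqI)
      qed
    qed
  qed
  show "extend_by_id a b u \<in> carrier thompson_F"
    unfolding ext by (rule restrict_in_thompson[OF mono im finh])
  have "bad {0..1} (restrict h {0..1}) = bad {0..1} h" by (rule bad_cong) simp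
  then have "complexity (extend_by_id a b u) = card (bad {0..1} h)"
    by (simp add: complexity_def ext)
  also note card
  also have "card (bad {a..b} u \<union> (straddling a \<union> straddling b))
      \<le> card (bad {a..b} u) + (card (straddling a) + card (straddling b))"
    using card_Un_le[of "bad {a..b} u" "straddling a \<union> straddling b"]
      card_Un_le[of "straddling a" "straddling b"] by linarith
  finally show "complexity (extend_by_id a b u)
    \<le> card (bad {a..b} u) + (card (straddling a) + card (straddling b))" .
qed

lemma thompson_restrict_interval:
  assumes h: "h \<in> carrier thompson_F" "h a = a" "h b = b" and ab: "0 \<le> a" "a \<le> b" "b \<le> 1"
  shows "strict_mono_on {a..b} h" "h ` {a..b} = {a..b}" "finite (bad {a..b} h)"
    "card (bad {a..b} h) \<le> complexity h"
proof -
  note H = thompsonD[OF h(1)]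
  have ab01: "{a..b} \<subseteq> {0..1}" using ab by auto
  have sub: "bad {a..b} h \<subseteq> bad {0..1} h" using ab01 unfolding bad_def by blast
  show "finite (bad {a..b} h)" "card (bad {a..b} h) \<le> complexity h"
    unfolding complexity_def using finite_subset[OF sub H(4)] card_mono[OF H(4) sub] by simp_all
  show "strict_mono_on {a..b} h" using H(2) ab01 by (rule monotone_on_subset)
  show "h ` {a..b} = {a..b}"
  proof
    have le: "h x \<le> h y" if "x \<in> {0..1}" "y \<in> {0..1}" "x \<le> y" for x y
      using monotone_onD[OF strict_mono_on_imp_mono_on[OF H(2)] that] .
    show "h ` {a..b} \<subseteq> {a..b}"
    proof
      fix y assume "y \<in> h ` {a..b}"
      then obtain x where x: "y = h x" "x \<in> {a..b}" by blast
      then have "h a \<le> h x" "h x \<le> h b" using ab by (auto intro!: le)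
      then show "y \<in> {a..b}" using x h by simp
    qed
    show "{a..b} \<subseteq> h ` {a..b}"
    proof
      fix y assume y: "y \<in> {a..b}"
      then have "y \<in> h ` {0..1}" using H(3) ab01 by blast
      then obtain x where x: "y = h x" "x \<in> {0..1}" by blast
      have "\<not> x < a"
      proof
        assume "x < a"
        then have "h x < h a" using x(2) ab by (intro strict_mono_onD[OF H(2)]) auto
        then show False using x y h by simp
      qed
      moreover have "\<not> b < x"
      proof
        assume "b < x"
        then have "h b < h x" using x(2) ab by (intro strict_mono_onD[OF H(2)]) auto
        then show False using x y h by simp
      qed
      ultimately show "y \<in> h ` {a..b}" using x(1) by (intro image_eqI[of _ _ x]) auto
    qed
  qed
qed

lemma chain_map_left_inverse:
  assumes f: "list_all2 (carries f) xs ys" and g: "list_all2 (carries g) ys xs"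
    and xs: "chain a xs b" "xs \<noteq> []" and ys: "chain c ys d" and t: "t \<in> {a..b}"
  shows "g (f t) = t"
proof -
  have "list_all2 (carries (g \<circ> f)) xs xs"
    by (rule list_all2_trans[OF _ f g]) (rule carries_comp)
  then have same: "carries (g \<circ> f) I I" if "I \<in> set xs" for I
    using that by (auto simp: list_all2_conv_all_nth in_set_conv_nth)
  show ?thesis
  proof (cases "t = b")
    case True
    have ne: "ys \<noteq> []" using f xs(2) by auto
    have "f b = d"
      using strict_mono_onto_endpoints(2) chain_map_strict_mono[OF f xs(1) ys xs(2)] chain_le[OF xs(1)] by blast
    moreover have "g d = b"
      using strict_mono_onto_endpoints(2) chain_map_strict_mono[OF g ys xs(1) ne] chain_le[OF ys] by blast
    ultimately show ?thesis by (simp add: True)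
  next
    case False
    then obtain I where I: "I \<in> set xs" "t \<in> {lo I..<hi I}" using chain_covers[OF xs(1), of t] t by auto
    then have "t \<in> {lo I..hi I}" by simp
    from carries_eq[OF same[OF I(1)] this] show ?thesis by simp
  qed
qed

text \<open>
  Some subdivision of \<open>[a,b]\<close> into standard dyadic intervals exists, and some tree has as many leaves
  as the subdivision has members.  Matching the two in order gives the chart.
\<close>

lemma dyadic_interval_chart:
  assumes ab: "a \<in> dyadic" "b \<in> dyadic" "a < b"
  obtains \<phi> \<psi> where
    "strict_mono_on {0..1} \<phi>" "\<phi> ` {0..1} = {a..b}" "finite (bad {0..1} \<phi>)"
    "strict_mono_on {a..b} \<psi>" "\<psi> ` {a..b} = {0..1}" "finite (bad {a..b} \<psi>)"
    "\<And>t. t \<in> {0..1} \<Longrightarrow> \<psi> (\<phi> t) = t" "\<And>t. t \<in> {a..b} \<Longrightarrow> \<phi> (\<psi> t) = t"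
proof -
  obtain xs where xs: "chain a xs b" using dyadic_chain_exists[of a b] ab by auto
  have ne: "xs \<noteq> []" using xs ab(3) by auto
  define zs where "zs = leaves (0, 0) (right_comb (replicate (length xs - 1) Leaf))"
  have "num_leaves (right_comb (replicate k Leaf)) = k + 1" for k by (induction k) auto
  then have len: "length zs = length xs" using ne by (simp add: zs_def)
  have zs: "chain 0 zs 1" "zs \<noteq> []" unfolding zs_def using chain_unit_leaves by simp_all
  obtain \<phi> where \<phi>: "list_all2 (carries \<phi>) zs xs" using chain_map_exists[OF zs(1) xs len] by blast
  obtain \<psi> where \<psi>: "list_all2 (carries \<psi>) xs zs" using chain_map_exists[OF xs zs(1) len[symmetric]] by blast
  show ?thesis
  proof (rule that)
    show "strict_mono_on {0..1} \<phi>" "\<phi> ` {0..1} = {a..b}"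
      using chain_map_strict_mono[OF \<phi> zs(1) xs zs(2)] by simp_all
    show "strict_mono_on {a..b} \<psi>" "\<psi> ` {a..b} = {0..1}"
      using chain_map_strict_mono[OF \<psi> xs zs(1) ne] by simp_all
    show "finite (bad {0..1} \<phi>)" by (rule finite_bad_of_chain_map[OF \<phi> zs(1)])
    show "finite (bad {a..b} \<psi>)" by (rule finite_bad_of_chain_map[OF \<psi> xs])
    show "\<psi> (\<phi> t) = t" if "t \<in> {0..1}" for t
      by (rule chain_map_left_inverse[OF \<phi> \<psi> zs xs that])
    show "\<phi> (\<psi> t) = t" if "t \<in> {a..b}" for t
      by (rule chain_map_left_inverse[OF \<psi> \<phi> xs ne zs(1) that])
  qed
qed

lemma conjugate_of_strict_mono_onto:
  fixes \<phi> :: "real \<Rightarrow> real" and \<psi> :: "real \<Rightarrow> real" and h :: "real \<Rightarrow> real"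
  assumes \<psi>: "strict_mono_on A \<psi>" "\<psi> ` A = B" "finite (bad A \<psi>)"
    and h: "strict_mono_on B h" "h ` B = B" "finite (bad B h)"
    and \<phi>: "strict_mono_on B \<phi>" "\<phi> ` B = A" "finite (bad B \<phi>)"
  shows "strict_mono_on A (\<phi> \<circ> (h \<circ> \<psi>))" "(\<phi> \<circ> (h \<circ> \<psi>)) ` A = A" "finite (bad A (\<phi> \<circ> (h \<circ> \<psi>)))"
    "card (bad A (\<phi> \<circ> (h \<circ> \<psi>))) \<le> card (bad A \<psi>) + card (bad B h) + card (bad B \<phi>)"
proof -
  have mem: "\<psi> t \<in> B" "h (\<psi> t) \<in> B" if "t \<in> A" for t using that \<psi>(2) h(2) by blast+
  have hp: "strict_mono_on A (h \<circ> \<psi>)"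
    by (rule strict_mono_onI) (auto intro!: strict_mono_onD[OF h(1)] strict_mono_onD[OF \<psi>(1)] mem)
  show "strict_mono_on A (\<phi> \<circ> (h \<circ> \<psi>))"
    by (rule strict_mono_onI)
      (auto intro!: strict_mono_onD[OF \<phi>(1)] strict_mono_onD[OF h(1)] strict_mono_onD[OF \<psi>(1)] mem)
  show "(\<phi> \<circ> (h \<circ> \<psi>)) ` A = A" by (simp only: image_comp[symmetric] \<psi>(2) h(2) \<phi>(2))
  have im: "\<psi> ` A \<subseteq> B" "(h \<circ> \<psi>) ` A \<subseteq> B" using mem by auto
  note b1 = bad_comp[OF strict_mono_on_imp_inj_on[OF \<psi>(1)] im(1) \<psi>(3) h(3)]
  note b2 = bad_comp[OF strict_mono_on_imp_inj_on[OF hp] im(2) b1(1) \<phi>(3)]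
  show "finite (bad A (\<phi> \<circ> (h \<circ> \<psi>)))" by (rule b2(1))
  show "card (bad A (\<phi> \<circ> (h \<circ> \<psi>))) \<le> card (bad A \<psi>) + card (bad B h) + card (bad B \<phi>)"
    using b1(2) b2(2) by linarith
qed

text \<open>
  Conjugation by a chart changes the complexity by at most a constant, and turns words in \<open>x0\<close> and
  \<open>x1\<close> into words in their conjugates.
\<close>

lemma supported_word_bound:
  assumes ab: "a \<in> dyadic" "b \<in> dyadic" "0 \<le> a" "a < b" "b \<le> 1"
  obtains X C where "finite X" "X \<subseteq> carrier thompson_F"
    "\<And>x t. x \<in> X \<Longrightarrow> t \<in> {0..1} \<Longrightarrow> t \<le> a \<or> b \<le> t \<Longrightarrow> x t = t"
    "\<And>h. h \<in> carrier thompson_F \<Longrightarrow> (\<And>t. t \<in> {0..1} \<Longrightarrow> t \<le> a \<or> b \<le> t \<Longrightarrow> h t = t) \<Longrightarrow>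
      h \<in> word_ball thompson_F X (C * (complexity h + 1))"
proof -
  obtain \<phi> \<psi> where \<phi>: "strict_mono_on {0..1} \<phi>" "\<phi> ` {0..1} = {a..b}" "finite (bad {0..1} \<phi>)"
    and \<psi>: "strict_mono_on {a..b} \<psi>" "\<psi> ` {a..b} = {0..1}" "finite (bad {a..b} \<psi>)"
    and \<psi>\<phi>: "\<And>t. t \<in> {0..1} \<Longrightarrow> \<psi> (\<phi> t) = t" and \<phi>\<psi>: "\<And>t. t \<in> {a..b} \<Longrightarrow> \<phi> (\<psi> t) = t"
    using dyadic_interval_chart[OF ab(1,2,4)] by blast
  have ab': "a \<le> b" using ab(4) by simp
  have \<phi>_mem: "\<phi> t \<in> {a..b}" if "t \<in> {0..1}" for t using \<phi>(2) that by blast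
  have \<psi>_mem: "\<psi> t \<in> {0..1}" if "t \<in> {a..b}" for t using \<psi>(2) that by blast
  define \<Phi> where "\<Phi> f = extend_by_id a b (\<phi> \<circ> (f \<circ> \<psi>))" for f
  have \<Phi>_apply: "\<Phi> f t = (if t \<in> {a..b} then \<phi> (f (\<psi> t)) else t)" if "t \<in> {0..1}" for f t
    using that by (simp add: \<Phi>_def extend_by_id_def)
  have \<Phi>_closed: "\<Phi> f \<in> carrier thompson_F" if f: "f \<in> carrier thompson_F" for f
    unfolding \<Phi>_def
    by (rule extend_by_id_in_thompson(1)[OF ab(1-3) ab' ab(5)
          conjugate_of_strict_mono_onto(1-3)[OF \<psi> thompsonD(2-4)[OF f] \<phi>]])
  have \<Phi>_mult: "\<Phi> (f \<otimes>\<^bsub>thompson_F\<^esub> g) = \<Phi> f \<otimes>\<^bsub>thompson_F\<^esub> \<Phi> g"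
    if f: "f \<in> carrier thompson_F" and g: "g \<in> carrier thompson_F" for f g
  proof (rule thompson_eqI)
    fix t :: real assume t: "t \<in> {0..1}"
    have gt: "\<Phi> g t \<in> {0..1}" by (rule thompson_unit[OF \<Phi>_closed[OF g] t])
    have "(\<Phi> f \<otimes>\<^bsub>thompson_F\<^esub> \<Phi> g) t = \<Phi> f (\<Phi> g t)"
      by (rule thompson_mult_apply[OF \<Phi>_closed[OF f] \<Phi>_closed[OF g] t])
    also have "\<dots> = \<Phi> (f \<otimes>\<^bsub>thompson_F\<^esub> g) t"
    proof (cases "t \<in> {a..b}")
      case True
      have p: "\<psi> t \<in> {0..1}" by (rule \<psi>_mem[OF True])
      have gp: "g (\<psi> t) \<in> {0..1}" by (rule thompson_unit[OF g p])
      have "\<Phi> g t = \<phi> (g (\<psi> t))" using True by (simp only: \<Phi>_apply[OF t] if_True)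
      moreover have "\<Phi> f (\<Phi> g t) = \<phi> (f (\<psi> (\<phi> (g (\<psi> t)))))"
        unfolding \<Phi>_apply[OF gt] using \<phi>_mem[OF gp] calculation by (simp only: if_True)
      ultimately have "\<Phi> f (\<Phi> g t) = \<phi> (f (g (\<psi> t)))" by (simp only: \<psi>\<phi>[OF gp])
      then show ?thesis
        unfolding \<Phi>_apply[OF t] thompson_mult_apply[OF f g p] using True by (simp only: if_True)
    next
      case False
      then show ?thesis using \<Phi>_apply[OF t] by (simp only: if_False)
    qed
    finally show "\<Phi> (f \<otimes>\<^bsub>thompson_F\<^esub> g) t = (\<Phi> f \<otimes>\<^bsub>thompson_F\<^esub> \<Phi> g) t" by (rule sym)
  qed (use f g \<Phi>_closed thompson.m_closed in blast)+
  define c where "c = card (bad {0..1} \<phi>) + card (bad {a..b} \<psi>)"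
  have bound: "h \<in> word_ball thompson_F (\<Phi> ` {x0, x1}) (6 * (c + 1) * (complexity h + 1))"
    if h: "h \<in> carrier thompson_F" and supp: "\<And>t. t \<in> {0..1} \<Longrightarrow> t \<le> a \<or> b \<le> t \<Longrightarrow> h t = t" for h
  proof -
    have "h a = a" "h b = b" using supp ab by auto
    note hab = thompson_restrict_interval[OF h this ab(3) ab' ab(5)]
    note conj = conjugate_of_strict_mono_onto[OF \<phi> hab(1-3) \<psi>]
    define f where "f = restrict (\<psi> \<circ> (h \<circ> \<phi>)) {0..1}"
    have f: "f \<in> carrier thompson_F" unfolding f_def by (rule restrict_in_thompson[OF conj(1-3)])
    have "bad {0..1} f = bad {0..1} (\<psi> \<circ> (h \<circ> \<phi>))" unfolding f_def by (rule bad_cong) simp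
    then have "complexity f = card (bad {0..1} (\<psi> \<circ> (h \<circ> \<phi>)))" by (simp only: complexity_def)
    then have "complexity f \<le> c + complexity h"
      using conj(4) hab(4) unfolding c_def by linarith
    then have cf: "6 * (complexity f + 1) \<le> 6 * (c + 1) * (complexity h + 1)"
      by (simp add: algebra_simps)
    have "\<Phi> f = h"
    proof (rule thompson_eqI[OF \<Phi>_closed[OF f] h])
      fix t :: real assume t: "t \<in> {0..1}"
      show "\<Phi> f t = h t"
      proof (cases "t \<in> {a..b}")
        case True
        have "h t \<in> {a..b}" using hab(2) True by blast
        then have "\<phi> (f (\<psi> t)) = h t" using \<psi>_mem[OF True] True by (simp add: f_def \<phi>\<psi>)
        then show ?thesis unfolding \<Phi>_apply[OF t] using True by (simp only: if_True)
      next
        case False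
        then have "h t = t" using supp[OF t] by auto
        then show ?thesis unfolding \<Phi>_apply[OF t] using False by (simp only: if_False)
      qed
    qed
    moreover have "\<Phi> f \<in> word_ball thompson_F (\<Phi> ` {x0, x1}) (6 * (complexity f + 1))"
      by (rule thompson.word_ball_hom_image[OF thompson.subgroup_self x0_x1_closed \<Phi>_closed \<Phi>_mult
            thompson_word_bound[OF f]])
    ultimately show ?thesis using subsetD[OF word_ball_mono[OF order_refl cf]] by simp
  qed
  show ?thesis
  proof (rule that[of "\<Phi> ` {x0, x1}" "6 * (c + 1)"])
    show "finite (\<Phi> ` {x0, x1})" by simp
    show "\<Phi> ` {x0, x1} \<subseteq> carrier thompson_F" using x0_x1_closed \<Phi>_closed by blast
    fix x t assume "x \<in> \<Phi> ` {x0, x1}" and t: "t \<in> {0..1}" "t \<le> a \<or> b \<le> t"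
    then obtain f where f: "f \<in> carrier thompson_F" "x = \<Phi> f" using x0_x1_closed by blast
    have "\<phi> (f (\<psi> t)) = t" if "t = a \<or> t = b"
    proof -
      have *: "\<phi> 0 = a" "\<phi> 1 = b" "\<psi> a = 0" "\<psi> b = 1"
        using strict_mono_onto_endpoints[OF \<phi>(1,2)] strict_mono_onto_endpoints[OF \<psi>(1,2) ab'] by simp_all
      show ?thesis using that * thompsonD(5,6)[OF f(1)] by auto
    qed
    then show "x t = t" unfolding f(2) \<Phi>_apply[OF t(1)] using t(2) by auto
  qed (rule bound)
qed

section \<open>Slopes\<close>

text \<open>
  An element \<open>r\<close> of least positive value generates the image of \<open>\<sigma>\<close>, which consists of the multiples
  of \<open>\<sigma> r\<close>.  If \<open>\<sigma>\<close> vanishes, then \<open>r\<close> can be the neutral element.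
\<close>

lemma (in group) int_valued_hom_cyclic:
  fixes \<sigma> :: "'a \<Rightarrow> int"
  assumes A: "subgroup A G"
    and hom: "\<And>x y. x \<in> A \<Longrightarrow> y \<in> A \<Longrightarrow> \<sigma> (x \<otimes> y) = \<sigma> x + \<sigma> y"
  obtains r where "r \<in> A" "\<And>h. h \<in> A \<Longrightarrow> \<exists>q. \<bar>q\<bar> \<le> \<bar>\<sigma> h\<bar> \<and> \<sigma> (h \<otimes> inv (r [^] (q::int))) = 0"
proof -
  have Ac: "A \<subseteq> carrier G" using A by (rule subgroup.subset)
  have oneA: "\<one> \<in> A" using A by (rule subgroup.one_closed)
  have one: "\<sigma> \<one> = 0" using hom[OF oneA oneA] by simp
  have inv: "\<sigma> (inv x) = - \<sigma> x" if x: "x \<in> A" for x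
  proof -
    have "\<sigma> (inv x \<otimes> x) = \<sigma> (inv x) + \<sigma> x" using x by (intro hom subgroup.m_inv_closed[OF A])
    then show ?thesis using one x Ac by (simp add: subset_iff)
  qed
  have npow: "x [^] n \<in> A \<and> \<sigma> (x [^] n) = int n * \<sigma> x" if x: "x \<in> A" for x and n :: nat
  proof (induction n)
    case 0
    then show ?case using one oneA by simp
  next
    case (Suc n)
    then show ?case using x hom[of "x [^] n" x] subgroup.m_closed[OF A, of "x [^] n" x]
      by (simp add: algebra_simps)
  qed
  have pow: "x [^] q \<in> A \<and> \<sigma> (x [^] q) = q * \<sigma> x" if x: "x \<in> A" for x and q :: int
  proof (cases q rule: int_cases2)
    case (nonneg n)
    then show ?thesis using npow[OF x, of n] by (simp add: int_pow_int)
  next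
    case (nonpos n)
    then have "x [^] q = inv (x [^] n)" using x Ac by (auto simp: int_pow_neg int_pow_int)
    then show ?thesis using npow[OF x, of n] inv[of "x [^] n"] subgroup.m_inv_closed[OF A, of "x [^] n"] nonpos
      by simp
  qed
  define P where "P n \<longleftrightarrow> 0 < n \<and> (\<exists>h\<in>A. \<sigma> h = int n)" for n
  show ?thesis
  proof (cases "\<exists>n. P n")
    case False
    have "\<sigma> h = 0" if "h \<in> A" for h
    proof (rule ccontr)
      assume "\<sigma> h \<noteq> 0"
      then have "P (nat \<bar>\<sigma> h\<bar>)"
        unfolding P_def using that inv[OF that] subgroup.m_inv_closed[OF A that]
        by (cases "\<sigma> h > 0") force+
      with False show False by blast
    qed
    then show ?thesis using oneA Ac by (intro that[of \<one>] oneA) (auto intro!: exI[of _ 0])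
  next
    case True
    define d where "d = (LEAST n. P n)"
    have "P d" unfolding d_def using True by (rule LeastI_ex)
    then obtain r where d: "0 < d" and r: "r \<in> A" "\<sigma> r = int d" unfolding P_def by blast
    have "\<exists>q. \<bar>q\<bar> \<le> \<bar>\<sigma> h\<bar> \<and> \<sigma> (h \<otimes> inv (r [^] (q::int))) = 0" if h: "h \<in> A" for h
    proof -
      define q where "q = \<sigma> h div int d"
      define k where "k = h \<otimes> inv (r [^] q)"
      have rq: "inv (r [^] q) \<in> A" "\<sigma> (inv (r [^] q)) = - (q * int d)"
        using pow[OF r(1), of q] subgroup.m_inv_closed[OF A] inv r(2) by auto
      have k: "k \<in> A" "\<sigma> k = \<sigma> h mod int d"
        using hom[OF h rq(1)] subgroup.m_closed[OF A h rq(1)] rq(2)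
        by (auto simp: k_def q_def minus_div_mult_eq_mod[symmetric])
      have "\<sigma> k = 0"
      proof (rule ccontr)
        assume "\<sigma> k \<noteq> 0"
        moreover have "0 \<le> \<sigma> k" "\<sigma> k < int d"
          unfolding k(2) using d by (simp_all add: pos_mod_sign pos_mod_bound)
        ultimately have pos: "0 < \<sigma> k" "\<sigma> k < int d" by linarith+
        then have "P (nat (\<sigma> k))" unfolding P_def using k(1) by auto
        then have "d \<le> nat (\<sigma> k)" unfolding d_def by (rule Least_le)
        then show False using pos by simp
      qed
      moreover have "\<bar>q\<bar> \<le> \<bar>\<sigma> h\<bar>"
      proof -
        have "\<sigma> h = q * int d"
          using div_mult_mod_eq[of "\<sigma> h" "int d"] k(2) \<open>\<sigma> k = 0\<close> unfolding q_def by linarith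
        moreover have "\<bar>q\<bar> * 1 \<le> \<bar>q\<bar> * int d" using d by (intro mult_left_mono) auto
        ultimately show ?thesis by (simp add: abs_mult)
      qed
      ultimately show ?thesis unfolding k_def by blast
    qed
    from that[OF r(1) this] show ?thesis .
  qed
qed

text \<open>
  The point \<open>a\<close> is fixed, and the right derivative there is \<open>2^k\<close>.
\<close>

definition germ :: "(real \<Rightarrow> real) \<Rightarrow> real \<Rightarrow> int \<Rightarrow> bool"
  where "germ h a k \<longleftrightarrow> (\<exists>e>0. \<forall>t. a \<le> t \<and> t \<le> a + e \<longrightarrow> h t = a + 2 powi k * (t - a))"

lemma germ_unique:
  assumes "germ h a k" "germ h a l"
  shows "k = l"
proof -
  obtain e e' where e: "e > 0" "\<And>t. a \<le> t \<Longrightarrow> t \<le> a + e \<Longrightarrow> h t = a + 2 powi k * (t - a)"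
    and e': "e' > 0" "\<And>t. a \<le> t \<Longrightarrow> t \<le> a + e' \<Longrightarrow> h t = a + 2 powi l * (t - a)"
    using assms unfolding germ_def by metis
  define t where "t = a + min e e'"
  have "2 powi k * (t - a) = 2 powi l * (t - a)"
    using e(1) e'(1) e(2)[of t] e'(2)[of t] by (simp add: t_def)
  moreover have "t - a > 0" using e(1) e'(1) by (simp add: t_def)
  ultimately have "(2::real) powi k = 2 powi l" by simp
  then show ?thesis
    using power_int_strict_increasing[of k l "2::real"] power_int_strict_increasing[of l k "2::real"]
    by (cases k l rule: linorder_cases) auto
qed

lemma germ_comp:
  assumes "germ f a k" "germ h a l"
  shows "germ (f \<circ> h) a (k + l)"
proof -
  obtain e where e: "e > 0" "\<And>t. a \<le> t \<Longrightarrow> t \<le> a + e \<Longrightarrow> f t = a + 2 powi k * (t - a)"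
    using assms(1) unfolding germ_def by blast
  obtain e' where e': "e' > 0" "\<And>t. a \<le> t \<Longrightarrow> t \<le> a + e' \<Longrightarrow> h t = a + 2 powi l * (t - a)"
    using assms(2) unfolding germ_def by blast
  have pos: "(0::real) < 2 powi l" by simp
  have "(f \<circ> h) t = a + 2 powi (k + l) * (t - a)"
    if t: "a \<le> t" "t \<le> a + min e' (e / 2 powi l)" for t
  proof -
    have h: "h t = a + 2 powi l * (t - a)" using t by (intro e'(2)) auto
    have "t - a \<le> e / 2 powi l" using t by simp
    then have "2 powi l * (t - a) \<le> e" using pos by (simp add: field_simps)
    moreover have "0 \<le> 2 powi l * (t - a)" using t(1) by simp
    ultimately have "f (h t) = a + 2 powi k * (2 powi l * (t - a))"
      using e(2)[of "h t"] h by simp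
    then show ?thesis by (simp add: power_int_add)
  qed
  moreover have "min e' (e / 2 powi l) > 0" using e(1) e'(1) pos by simp
  ultimately show ?thesis unfolding germ_def by blast
qed

lemma germ_cong:
  assumes "germ f a k" "0 \<le> a" "a < 1" "\<And>x. x \<in> {0..1} \<Longrightarrow> f x = h x"
  shows "germ h a k"
proof -
  obtain e where e: "e > 0" "\<And>t. a \<le> t \<Longrightarrow> t \<le> a + e \<Longrightarrow> f t = a + 2 powi k * (t - a)"
    using assms(1) unfolding germ_def by blast
  show ?thesis
    unfolding germ_def
  proof (intro exI[of _ "min e (1 - a)"] conjI allI impI)
    show "0 < min e (1 - a)" using e(1) assms(3) by simp
    fix t assume t: "a \<le> t \<and> t \<le> a + min e (1 - a)"
    then have "f t = h t" using assms(2,3) by (intro assms(4)) auto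
    then show "h t = a + 2 powi k * (t - a)" using e(2)[of t] t by auto
  qed
qed

lemma germ_of_carries:
  assumes "carries h I J" "lo I = a" "h a = a"
  shows "germ h a (int (snd I) - int (snd J))"
proof -
  have J: "lo J = a" using carries_lo_hi(1)[OF assms(1)] assms(2,3) by simp
  have s: "(2::real) powi (int (snd I) - int (snd J)) = 2 ^ snd I / 2 ^ snd J"
    by (simp add: power_int_diff)
  show ?thesis
    unfolding germ_def
  proof (intro exI[of _ "hi I - lo I"] conjI allI impI)
    show "0 < hi I - lo I" using lo_less_hi[of I] by simp
    fix t assume "a \<le> t \<and> t \<le> a + (hi I - lo I)"
    then have "t \<in> {lo I..hi I}" using assms(2) by auto
    from carries_eq[OF assms(1) this] show "h t = a + 2 powi (int (snd I) - int (snd J)) * (t - a)"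
      by (simp add: s J assms(2))
  qed
qed

lemma dyadic_left_cells:
  assumes "a \<in> dyadic" "0 \<le> a" "a < 1"
  obtains p I where "\<And>q. p \<le> q \<Longrightarrow> snd (I q) = q \<and> lo (I q) = a \<and> {lo (I q)..hi (I q)} \<subseteq> {0..1}"
proof -
  obtain j p where a: "a = of_int (j::int) / 2 ^ p" using assms by (auto simp: dyadic_def)
  have "\<exists>I. snd I = q \<and> lo I = a \<and> {lo I..hi I} \<subseteq> {0..1}" if pq: "p \<le> q" for q
  proof -
    obtain I where I: "snd I = q" "lo I \<le> a" "a < hi I" "{lo I..hi I} \<subseteq> {0..1}"
      using unit_cell_containing[OF assms(2,3), of q] by blast
    obtain m where m: "I = (m, q)" using I(1) by (cases I) auto
    obtain d where d: "q = p + d" using pq by (auto simp: le_iff_add)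
    have "real_of_int m \<le> real_of_int (j * 2 ^ d)" "real_of_int (j * 2 ^ d) < real_of_int (m + 1)"
      using I(2,3) by (simp_all add: m a lo_simps hi_simps d power_add field_simps)
    then have "m = j * 2 ^ d" unfolding of_int_le_iff of_int_less_iff by simp
    then have "lo I = a" by (simp add: m lo_simps a d power_add)
    then show ?thesis using I by blast
  qed
  then obtain I where "\<And>q. p \<le> q \<Longrightarrow> snd (I q) = q \<and> lo (I q) = a \<and> {lo (I q)..hi (I q)} \<subseteq> {0..1}"
    by metis
  then show ?thesis by (rule that)
qed

lemma germ_exists:
  assumes h: "h \<in> carrier thompson_F" "h a = a" and a: "a \<in> dyadic" "0 \<le> a" "a < 1"
  shows "\<exists>k. germ h a k"
proof -
  obtain p I where I: "\<And>q. p \<le> q \<Longrightarrow> snd (I q) = q \<and> lo (I q) = a \<and> {lo (I q)..hi (I q)} \<subseteq> {0..1}"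
    using dyadic_left_cells[OF a] by blast
  obtain K where K: "\<And>I. I \<in> bad {0..1} h \<Longrightarrow> snd I < K"
    using finite_level_bound[OF thompsonD(4)[OF h(1)]] by blast
  define q where "q = max p K"
  have q: "snd (I q) = q" "lo (I q) = a" "{lo (I q)..hi (I q)} \<subseteq> {0..1}" using I[of q] by (auto simp: q_def)
  have "I q \<notin> bad {0..1} h" using K[of "I q"] q(1) by (auto simp: q_def)
  then obtain J where "carries h (I q) J" using q(3) by (auto simp: bad_def good_def)
  from germ_of_carries[OF this q(2) h(2)] show ?thesis ..
qed

text \<open>
  The intervals with left end \<open>a\<close> of level below \<open>k\<close> are bad, because stretched by \<open>2^k\<close>
  they would be longer than the unit interval.  The constant \<open>p\<close> accounts for the levels at which \<open>a\<close>
  is not yet an end of an interval.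
\<close>

lemma germ_le_complexity:
  assumes a: "a \<in> dyadic" "0 \<le> a" "a < 1"
  obtains p where "\<And>h k. h \<in> carrier thompson_F \<Longrightarrow> h a = a \<Longrightarrow> germ h a k \<Longrightarrow> k \<le> int (complexity h) + int p"
proof -
  obtain p I where I: "\<And>q. p \<le> q \<Longrightarrow> snd (I q) = q \<and> lo (I q) = a \<and> {lo (I q)..hi (I q)} \<subseteq> {0..1}"
    using dyadic_left_cells[OF a] by blast
  have "k \<le> int (complexity h) + int p"
    if h: "h \<in> carrier thompson_F" "h a = a" "germ h a k" for h k
  proof -
    have "I ` {p..<nat k} \<subseteq> bad {0..1} h"
    proof
      fix c assume "c \<in> I ` {p..<nat k}"
      then obtain q where q: "c = I q" "p \<le> q" "q < nat k" by auto
      have "\<not> good h (I q)"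
      proof
        assume "good h (I q)"
        then obtain J where J: "carries h (I q) J" by (auto simp: good_def)
        have "lo (I q) = a" "snd (I q) = q" using I[OF q(2)] by auto
        then have "k = int q - int (snd J)"
          using germ_unique[OF h(3) germ_of_carries[OF J _ h(2)]] by simp
        then show False using q(3) by simp
      qed
      then show "c \<in> bad {0..1} h" unfolding bad_def q(1) using I[OF q(2)] by blast
    qed
    moreover have "inj_on I {p..<nat k}"
    proof (rule inj_onI)
      fix q q' assume q: "q \<in> {p..<nat k}" "q' \<in> {p..<nat k}" "I q = I q'"
      have "snd (I q) = q" "snd (I q') = q'" using I q(1,2) by simp_all
      then show "q = q'" unfolding q(3) by simp
    qed
    ultimately have "card {p..<nat k} \<le> complexity h"
      unfolding complexity_def by (intro card_inj_on_le[OF _ _ thompsonD(4)[OF h(1)]])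
    then show ?thesis by simp
  qed
  then show ?thesis by (rule that)
qed

section \<open>Centralizers\<close>

lemma (in group) subgroup_centralizer:
  assumes "g \<in> carrier G"
  shows "subgroup (centralizer G g) G"
proof (rule subgroupI)
  show "centralizer G g \<subseteq> carrier G" by (auto simp: centralizer_def)
  show "centralizer G g \<noteq> {}" using assms by (auto simp: centralizer_def)
next
  fix h assume "h \<in> centralizer G g"
  then have h: "h \<in> carrier G" "h \<otimes> g = g \<otimes> h" by (auto simp: centralizer_def)
  have "inv h \<otimes> g = inv h \<otimes> (g \<otimes> h) \<otimes> inv h"
    using h(1) assms by (simp add: m_assoc)
  also have "\<dots> = inv h \<otimes> (h \<otimes> g) \<otimes> inv h"
    using h(2) by simp
  also have "\<dots> = g \<otimes> inv h"
    using h(1) assms by (simp add: m_assoc[symmetric])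
  finally show "inv h \<in> centralizer G g"
    using h assms by (simp add: centralizer_def)
next
  fix h k assume "h \<in> centralizer G g" "k \<in> centralizer G g"
  then have h: "h \<in> carrier G" "h \<otimes> g = g \<otimes> h" and k: "k \<in> carrier G" "k \<otimes> g = g \<otimes> k"
    by (auto simp: centralizer_def)
  have "h \<otimes> k \<otimes> g = h \<otimes> g \<otimes> k"
    using h(1) k assms by (simp add: m_assoc)
  also have "\<dots> = g \<otimes> (h \<otimes> k)"
    using h k(1) assms by (simp add: m_assoc)
  finally show "h \<otimes> k \<in> centralizer G g"
    using h k by (simp add: centralizer_def)
qed

lemma centralizerD:
  assumes "h \<in> centralizer thompson_F g"
  shows "h \<in> carrier thompson_F" "h \<otimes>\<^bsub>thompson_F\<^esub> g = g \<otimes>\<^bsub>thompson_F\<^esub> h"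
  using assms by (simp_all add: centralizer_def)

lemma centralizer_iff:
  assumes "g \<in> carrier thompson_F"
  shows "h \<in> centralizer thompson_F g \<longleftrightarrow>
    h \<in> carrier thompson_F \<and> (\<forall>t\<in>{0..1}. h (g t) = g (h t))" (is "_ \<longleftrightarrow> ?R")
proof
  assume h: "h \<in> centralizer thompson_F g"
  note hc = centralizerD(1)[OF h]
  have "h (g t) = g (h t)" if t: "t \<in> {0..1}" for t
    using thompson_mult_apply[OF hc assms t] thompson_mult_apply[OF assms hc t]
    unfolding centralizerD(2)[OF h] by simp
  with hc show ?R by blast
next
  assume R: ?R
  then have hc: "h \<in> carrier thompson_F" by blast
  have "h \<otimes>\<^bsub>thompson_F\<^esub> g = g \<otimes>\<^bsub>thompson_F\<^esub> h"
  proof (rule thompson_eqI)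
    fix t :: real assume t: "t \<in> {0..1}"
    show "(h \<otimes>\<^bsub>thompson_F\<^esub> g) t = (g \<otimes>\<^bsub>thompson_F\<^esub> h) t"
      unfolding thompson_mult_apply[OF hc assms t] thompson_mult_apply[OF assms hc t] using R t by blast
  qed (rule thompson.m_closed[OF hc assms], rule thompson.m_closed[OF assms hc])
  then show "h \<in> centralizer thompson_F g" using hc unfolding centralizer_def by blast
qed

lemma thompson_less_iff:
  assumes "f \<in> carrier thompson_F" "x \<in> {0..1}" "y \<in> {0..1}"
  shows "f x < f y \<longleftrightarrow> x < y"
  using strict_mono_onD[OF thompsonD(2)[OF assms(1)] assms(2,3)]
    strict_mono_onD[OF thompsonD(2)[OF assms(1)] assms(3,2)]
  by (cases x y rule: linorder_cases) auto

lemma thompson_le_iff: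
  assumes "f \<in> carrier thompson_F" "x \<in> {0..1}" "y \<in> {0..1}"
  shows "f x \<le> f y \<longleftrightarrow> x \<le> y"
  using thompson_less_iff[OF assms(1,3,2)] by linarith

lemma thompson_inj:
  assumes "f \<in> carrier thompson_F" "x \<in> {0..1}" "y \<in> {0..1}" "f x = f y"
  shows "x = y"
  using inj_onD[OF thompsonD(7)[OF assms(1)] assms(4,2,3)] .

lemma thompson_continuous:
  assumes "f \<in> carrier thompson_F" "x \<in> {0..1}" "e > 0"
  obtains d where "d > 0" "\<And>t. t \<in> {0..1} \<Longrightarrow> \<bar>t - x\<bar> < d \<Longrightarrow> \<bar>f t - f x\<bar> < e"
proof -
  have "(f \<longlongrightarrow> f x) (at x within {0..1})"
    using thompsonD(9)[OF assms(1)] assms(2) unfolding continuous_on_def by blast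
  from tendstoD[OF this assms(3)] obtain d where d: "d > 0"
    "\<forall>t\<in>{0..1}. t \<noteq> x \<and> dist t x < d \<longrightarrow> dist (f t) (f x) < e"
    unfolding eventually_at by blast
  have "\<bar>f t - f x\<bar> < e" if "t \<in> {0..1}" "\<bar>t - x\<bar> < d" for t
    using d(2) that assms(3) by (cases "t = x") (auto simp: dist_real_def)
  with d(1) show ?thesis by (rule that)
qed

definition id_near :: "(real \<Rightarrow> real) \<Rightarrow> real \<Rightarrow> bool"
  where "id_near f x \<longleftrightarrow> (\<exists>e>0. \<forall>t\<in>{0..1}. \<bar>t - x\<bar> < e \<longrightarrow> f t = t)"

text \<open>
  The frontier of the fixed point set within \<open>[0,1]\<close>.
\<close>

definition fix_frontier :: "(real \<Rightarrow> real) \<Rightarrow> real set"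
  where "fix_frontier f = {x \<in> {0..1}. f x = x \<and> \<not> id_near f x}"

lemma carries_two_fixed_points:
  assumes c: "carries f I J" and xy: "x \<in> {lo I..hi I}" "y \<in> {lo I..hi I}" "x \<noteq> y" "f x = x" "f y = y"
    and t: "t \<in> {lo I..hi I}"
  shows "f t = t"
proof -
  define s where "s = (2::real) ^ snd I / 2 ^ snd J"
  have eq: "f z = lo J + s * (z - lo I)" if "z \<in> {lo I..hi I}" for z
    using carries_eq[OF c that] by (simp add: s_def)
  have "x - y = s * (x - y)" using eq[OF xy(1)] eq[OF xy(2)] xy(4,5) by (simp add: algebra_simps)
  then have "s = 1" using xy(3) by simp
  then show ?thesis using eq[OF xy(1)] eq[OF t] xy(4) by simp
qed

lemma id_nearI_interior:
  assumes "lo I < x" "x < hi I" "\<And>t. t \<in> {lo I..hi I} \<Longrightarrow> f t = t"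
  shows "id_near f x"
  unfolding id_near_def
proof (intro exI[of _ "min (x - lo I) (hi I - x)"] conjI ballI impI)
  show "0 < min (x - lo I) (hi I - x)" using assms(1,2) by simp
  fix t :: real assume "\<bar>t - x\<bar> < min (x - lo I) (hi I - x)"
  then show "f t = t" by (intro assms(3)) auto
qed

lemma thompson_good_chain:
  assumes f: "f \<in> carrier thompson_F"
  obtains xs where "chain 0 xs 1" "\<And>I. I \<in> set xs \<Longrightarrow> good f I"
proof -
  obtain S T where "list_all2 (carries f) (leaves (0, 0) S) (leaves (0, 0) T)"
    by (rule thompson_tree_pair[OF f], rule that)
  from that[OF chain_unit_leaves list_all2_carries_good[OF this]] show ?thesis .
qed

text \<open>
  On a good interval the map is affine, hence either the identity or with at most one fixed point.
\<close>

lemma finite_fix_frontier: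
  assumes f: "f \<in> carrier thompson_F"
  shows "finite (fix_frontier f)"
proof -
  obtain xs where xs: "chain 0 xs 1" "\<And>I. I \<in> set xs \<Longrightarrow> good f I"
    by (rule thompson_good_chain[OF f], rule that)
  define W where "W I = fix_frontier f \<inter> {lo I<..<hi I}" for I
  have "finite (W I)" if I: "I \<in> set xs" for I
  proof (cases "W I = {}")
    case False
    then obtain x where x: "x \<in> W I" by blast
    obtain J where J: "carries f I J" using xs(2)[OF I] by (auto simp: good_def)
    have "y = x" if y: "y \<in> W I" for y
    proof (rule ccontr)
      assume "y \<noteq> x"
      have "x \<in> {lo I..hi I}" "y \<in> {lo I..hi I}" "f x = x" "f y = y" "lo I < x" "x < hi I" "\<not> id_near f x"
        using x y by (auto simp: W_def fix_frontier_def)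
      then show False
        using id_nearI_interior[of I x f] carries_two_fixed_points[OF J, of x y] \<open>y \<noteq> x\<close> by blast
    qed
    then have "W I \<subseteq> {x}" by blast
    then show ?thesis by (rule finite_subset) simp
  qed simp
  then have "finite ((\<Union>I\<in>set xs. W I) \<union> (lo ` set xs \<union> {1}))" by simp
  moreover have "fix_frontier f \<subseteq> (\<Union>I\<in>set xs. W I) \<union> (lo ` set xs \<union> {1})"
  proof
    fix x assume x: "x \<in> fix_frontier f"
    show "x \<in> (\<Union>I\<in>set xs. W I) \<union> (lo ` set xs \<union> {1})"
    proof (cases "x = 1")
      case False
      then have "x \<in> {0..<1}" using x by (auto simp: fix_frontier_def)
      then obtain I where I: "I \<in> set xs" "x \<in> {lo I..<hi I}" using chain_covers[OF xs(1)] by blast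
      show ?thesis
      proof (cases "x = lo I")
        case False
        then have "x \<in> W I" using I(2) x by (auto simp: W_def)
        then show ?thesis using I(1) by blast
      qed (use I in blast)
    qed blast
  qed
  ultimately show ?thesis by (rule finite_subset[rotated])
qed

text \<open>
  The map permutes the set.  The preimage of the least point that is moved would lie above it, so
  this point is moved down, to a fixed point, against injectivity.
\<close>

lemma strict_mono_fixes_finite_invariant_set:
  fixes f :: "real \<Rightarrow> real"
  assumes fin: "finite S" and inv: "f ` S \<subseteq> S" and mono: "strict_mono_on S f" and x: "x \<in> S"
  shows "f x = x"
proof (rule ccontr)
  assume "f x \<noteq> x"
  define m where "m = Min {x \<in> S. f x \<noteq> x}"
  have fin': "finite {x \<in> S. f x \<noteq> x}" "{x \<in> S. f x \<noteq> x} \<noteq> {}" using fin x \<open>f x \<noteq> x\<close> by auto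
  have m: "m \<in> S" "f m \<noteq> m" using Min_in[OF fin'] by (simp_all add: m_def)
  have below: "f z = z" if "z \<in> S" "z < m" for z
    using Min_le[OF fin'(1), of z] that unfolding m_def by auto
  have inj: "inj_on f S" using mono by (rule strict_mono_on_imp_inj_on)
  have "f ` S = S" using fin inv inj by (rule endo_inj_surj)
  then obtain y where y: "y \<in> S" "f y = m" using m(1) by (metis imageE)
  consider "y < m" | "y = m" | "m < y" by linarith
  then show False
  proof cases
    case 1
    then show False using below[OF y(1)] y(2) by simp
  next
    case 2
    then show False using y(2) m(2) by simp
  next
    case 3
    have "f m < f y" using mono m(1) y(1) 3 by (rule strict_mono_onD)
    then have less: "f m < m" using y(2) by simp
    have fm: "f m \<in> S" using inv m(1) by blast
    then have "f (f m) = f m" using less by (rule below)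
    then show False using inj_onD[OF inj _ fm m(1)] m(2) by blast
  qed
qed

text \<open>
  Conjugation by \<open>h\<close> fixes \<open>g\<close>, so \<open>h\<close> maps fixed points to fixed points, and a neighbourhood on
  which \<open>g\<close> is the identity to another one.
\<close>

lemma centralizer_fixes_frontier:
  assumes g: "g \<in> carrier thompson_F" and h: "h \<in> centralizer thompson_F g" and x: "x \<in> fix_frontier g"
  shows "h x = x"
proof (rule strict_mono_fixes_finite_invariant_set[OF finite_fix_frontier[OF g] _ _ x])
  have hc: "h \<in> carrier thompson_F" and comm: "\<And>t. t \<in> {0..1} \<Longrightarrow> h (g t) = g (h t)"
    using h unfolding centralizer_iff[OF g] by blast+
  have sub: "fix_frontier g \<subseteq> {0..1}" by (auto simp: fix_frontier_def)
  show "strict_mono_on (fix_frontier g) h" using thompsonD(2)[OF hc] sub by (rule monotone_on_subset)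
  show "h ` fix_frontier g \<subseteq> fix_frontier g"
  proof
    fix y assume "y \<in> h ` fix_frontier g"
    then obtain x where x: "x \<in> {0..1}" "g x = x" "\<not> id_near g x" and y: "y = h x"
      by (auto simp: fix_frontier_def)
    have hx: "h x \<in> {0..1}" by (rule thompson_unit[OF hc x(1)])
    have "g (h x) = h x" using comm[OF x(1)] x(2) by simp
    moreover have "\<not> id_near g (h x)"
    proof
      assume "id_near g (h x)"
      then obtain e where e: "e > 0" "\<And>t. t \<in> {0..1} \<Longrightarrow> \<bar>t - h x\<bar> < e \<Longrightarrow> g t = t"
        unfolding id_near_def by blast
      obtain d where d: "d > 0" "\<And>t. t \<in> {0..1} \<Longrightarrow> \<bar>t - x\<bar> < d \<Longrightarrow> \<bar>h t - h x\<bar> < e"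
        by (rule thompson_continuous[OF hc x(1) e(1)], rule that)
      have "g t = t" if t: "t \<in> {0..1}" "\<bar>t - x\<bar> < d" for t
      proof (rule thompson_inj[OF hc thompson_unit[OF g t(1)] t(1)])
        show "h (g t) = h t"
          using e(2)[OF thompson_unit[OF hc t(1)] d(2)[OF t]] comm[OF t(1)] by simp
      qed
      then show False using x(3) d(1) unfolding id_near_def by blast
    qed
    ultimately show "y \<in> fix_frontier g" using hx y by (simp add: fix_frontier_def)
  qed
qed

text \<open>
  Cutting is possible at dyadic points only: at a fixed point that is not dyadic, the slopes on
  the two sides agree, so the maps on the two sides are not independent of each other.
\<close>

definition cut_points :: "(real \<Rightarrow> real) \<Rightarrow> real set"
  where "cut_points g = {0, 1} \<union> (fix_frontier g \<inter> dyadic)"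

lemma cut_points:
  assumes g: "g \<in> carrier thompson_F" and q: "q \<in> cut_points g"
  shows "q \<in> dyadic" "q \<in> {0..1}" "h \<in> centralizer thompson_F g \<Longrightarrow> h q = q" "g q = q"
proof -
  have "0 \<in> dyadic" "1 \<in> dyadic" using dyadicI[of 0 0] dyadicI[of 1 0] by simp_all
  then show "q \<in> dyadic" "q \<in> {0..1}" using q by (auto simp: cut_points_def fix_frontier_def)
  show hq: "h q = q" if h: "h \<in> centralizer thompson_F g" for h
    using q centralizer_fixes_frontier[OF g h] thompsonD(5,6)[OF centralizerD(1)[OF h]]
    by (auto simp: cut_points_def)
  show "g q = q" by (rule hq) (simp add: centralizer_def g)
qed

subsection \<open>Cutting an element of the centralizer into pieces\<close>

lemma extend_by_id_apply:
  "t \<in> {0..1} \<Longrightarrow> extend_by_id a b h t = (if t \<in> {a..b} then h t else t)"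
  by (simp add: extend_by_id_def)

lemma piece_in_thompson:
  assumes g: "g \<in> carrier thompson_F" and ab: "a \<in> cut_points g" "b \<in> cut_points g" "a \<le> b"
    and h: "h \<in> centralizer thompson_F g"
  shows "extend_by_id a b h \<in> carrier thompson_F"
    "complexity (extend_by_id a b h) \<le> complexity h + (card (straddling a) + card (straddling b))"
    "t \<in> {a..b} \<Longrightarrow> h t \<in> {a..b}"
proof -
  note A = cut_points[OF g ab(1)] and B = cut_points[OF g ab(2)]
  have ab01: "0 \<le> a" "b \<le> 1" using A(2) B(2) by auto
  note r = thompson_restrict_interval[OF centralizerD(1)[OF h] A(3)[OF h] B(3)[OF h] ab01(1) ab(3) ab01(2)]
  note e = extend_by_id_in_thompson[OF A(1) B(1) ab01(1) ab(3) ab01(2) r(1-3)]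
  show "extend_by_id a b h \<in> carrier thompson_F" by (rule e(1))
  show "complexity (extend_by_id a b h) \<le> complexity h + (card (straddling a) + card (straddling b))"
    using e(2) r(4) by linarith
  show "t \<in> {a..b} \<Longrightarrow> h t \<in> {a..b}" using r(2) by blast
qed

lemma piece_mult:
  assumes g: "g \<in> carrier thompson_F" and ab: "a \<in> cut_points g" "b \<in> cut_points g" "a \<le> b"
    and h: "h \<in> centralizer thompson_F g" and k: "k \<in> centralizer thompson_F g"
  shows "extend_by_id a b (h \<otimes>\<^bsub>thompson_F\<^esub> k) =
    extend_by_id a b h \<otimes>\<^bsub>thompson_F\<^esub> extend_by_id a b k"
proof -
  note H = piece_in_thompson[OF g ab h] and K = piece_in_thompson[OF g ab k]
  have hk: "h \<otimes>\<^bsub>thompson_F\<^esub> k \<in> centralizer thompson_F g"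
    by (rule subgroup.m_closed[OF thompson.subgroup_centralizer[OF g] h k])
  show ?thesis
  proof (rule thompson_eqI[OF piece_in_thompson(1)[OF g ab hk] thompson.m_closed[OF H(1) K(1)]])
    fix t :: real assume t: "t \<in> {0..1}"
    note m = thompson_mult_apply[OF centralizerD(1)[OF h] centralizerD(1)[OF k] t]
    show "extend_by_id a b (h \<otimes>\<^bsub>thompson_F\<^esub> k) t
      = (extend_by_id a b h \<otimes>\<^bsub>thompson_F\<^esub> extend_by_id a b k) t"
    proof (cases "t \<in> {a..b}")
      case True
      have "extend_by_id a b k t = k t" unfolding extend_by_id_apply[OF t] using True by (rule if_P)
      moreover have "extend_by_id a b h (k t) = h (k t)"
        unfolding extend_by_id_apply[OF thompson_unit[OF centralizerD(1)[OF k] t]] using K(3)[OF True] by (rule if_P)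
      ultimately show ?thesis
        unfolding thompson_mult_apply[OF H(1) K(1) t] extend_by_id_apply[OF t, of a b "h \<otimes>\<^bsub>thompson_F\<^esub> k"] m
        using True by simp
    next
      case False
      then have "extend_by_id a b u t = t" for u
        unfolding extend_by_id_apply[OF t] by (rule if_not_P)
      then show ?thesis
        unfolding thompson_mult_apply[OF H(1) K(1) t] by simp
    qed
  qed
qed

lemma piece_in_centralizer:
  assumes g: "g \<in> carrier thompson_F" and ab: "a \<in> cut_points g" "b \<in> cut_points g" "a \<le> b"
    and h: "h \<in> centralizer thompson_F g"
  shows "extend_by_id a b h \<in> centralizer thompson_F g"
  unfolding centralizer_iff[OF g]
proof (intro conjI ballI)
  show "extend_by_id a b h \<in> carrier thompson_F" by (rule piece_in_thompson(1)[OF g ab h])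
  fix t :: real assume t: "t \<in> {0..1}"
  have gC: "g \<in> centralizer thompson_F g" by (simp add: centralizer_def g)
  have gt: "g t \<in> {0..1}" by (rule thompson_unit[OF g t])
  have gab: "g a = a" "g b = b" using cut_points(4)[OF g] ab by simp_all
  have iff: "g t \<in> {a..b} \<longleftrightarrow> t \<in> {a..b}"
    using thompson_le_iff[OF g cut_points(2)[OF g ab(1)] t] thompson_le_iff[OF g t cut_points(2)[OF g ab(2)]]
    unfolding gab by simp
  have comm: "h (g t) = g (h t)" using h t unfolding centralizer_iff[OF g] by blast
  show "extend_by_id a b h (g t) = g (extend_by_id a b h t)"
    unfolding extend_by_id_apply[OF t] extend_by_id_apply[OF gt] iff comm by (rule if_distrib[symmetric])
qed

text \<open>
  The complexity of the inverse enters because \<open>germ_le_complexity\<close> bounds slopes from above;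
  applied to the inverse, it bounds them from below.
\<close>

definition undistorted_piece :: "(real \<Rightarrow> real) \<Rightarrow> real \<Rightarrow> real \<Rightarrow> bool"
  where "undistorted_piece g a b \<longleftrightarrow> (\<exists>X C. finite X \<and> X \<subseteq> centralizer thompson_F g \<and>
    (\<forall>h\<in>centralizer thompson_F g. extend_by_id a b h
      \<in> word_ball thompson_F X (C * (complexity h + complexity (inv\<^bsub>thompson_F\<^esub> h) + 1))))"

lemma undistorted_piece_join:
  assumes g: "g \<in> carrier thompson_F"
    and q: "a \<in> cut_points g" "c \<in> cut_points g" "b \<in> cut_points g" "a \<le> c" "c \<le> b"
    and ac: "undistorted_piece g a c" and cb: "undistorted_piece g c b"
  shows "undistorted_piece g a b"
proof -
  obtain X C where X: "finite X" "X \<subseteq> centralizer thompson_F g"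
    and XC: "\<And>h. h \<in> centralizer thompson_F g \<Longrightarrow> extend_by_id a c h
      \<in> word_ball thompson_F X (C * (complexity h + complexity (inv\<^bsub>thompson_F\<^esub> h) + 1))"
    using ac unfolding undistorted_piece_def by blast
  obtain Y D where Y: "finite Y" "Y \<subseteq> centralizer thompson_F g"
    and YD: "\<And>h. h \<in> centralizer thompson_F g \<Longrightarrow> extend_by_id c b h
      \<in> word_ball thompson_F Y (D * (complexity h + complexity (inv\<^bsub>thompson_F\<^esub> h) + 1))"
    using cb unfolding undistorted_piece_def by blast
  have Zc: "X \<union> Y \<subseteq> carrier thompson_F"
    using X(2) Y(2) subgroup.subset[OF thompson.subgroup_centralizer[OF g]] by blast
  have "extend_by_id a b h \<in> word_ball thompson_F (X \<union> Y)
      ((C + D) * (complexity h + complexity (inv\<^bsub>thompson_F\<^esub> h) + 1))"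
    if h: "h \<in> centralizer thompson_F g" for h
  proof -
    define N where "N = complexity h + complexity (inv\<^bsub>thompson_F\<^esub> h) + 1"
    note P = piece_in_thompson[OF g q(1,2,4) h] and Q = piece_in_thompson[OF g q(2,3,5) h]
    have "extend_by_id a b h = extend_by_id a c h \<otimes>\<^bsub>thompson_F\<^esub> extend_by_id c b h"
    proof (rule thompson_eqI)
      show "extend_by_id a b h \<in> carrier thompson_F"
        by (rule piece_in_thompson(1)[OF g q(1,3) order_trans[OF q(4,5)] h])
      show "extend_by_id a c h \<otimes>\<^bsub>thompson_F\<^esub> extend_by_id c b h \<in> carrier thompson_F"
        by (rule thompson.m_closed[OF P(1) Q(1)])
      fix t :: real assume t: "t \<in> {0..1}"
      have hc: "h c = c" by (rule cut_points(3)[OF g q(2) h])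
      have ht: "h t \<in> {0..1}" by (rule thompson_unit[OF centralizerD(1)[OF h] t])
      show "extend_by_id a b h t = (extend_by_id a c h \<otimes>\<^bsub>thompson_F\<^esub> extend_by_id c b h) t"
      proof (cases "t \<in> {c..b}")
        case True
        have "extend_by_id a c h (h t) = h t"
        proof (cases "h t = c")
          case True
          then show ?thesis unfolding extend_by_id_apply[OF ht] using hc by simp
        next
          case False
          then show ?thesis unfolding extend_by_id_apply[OF ht] using Q(3)[OF True] by simp
        qed
        then show ?thesis
          unfolding thompson_mult_apply[OF P(1) Q(1) t] extend_by_id_apply[OF t] using True q(4,5) by simp
      next
        case False
        then show ?thesis
          unfolding thompson_mult_apply[OF P(1) Q(1) t] extend_by_id_apply[OF t, of c b]
            if_not_P[OF False] extend_by_id_apply[OF t]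
          using q(4,5) by auto
      qed
    qed
    moreover have "extend_by_id a c h \<in> word_ball thompson_F (X \<union> Y) (C * N)"
      using subsetD[OF word_ball_mono[OF Un_upper1 order_refl] XC[OF h]] unfolding N_def .
    moreover have "extend_by_id c b h \<in> word_ball thompson_F (X \<union> Y) (D * N)"
      using subsetD[OF word_ball_mono[OF Un_upper2 order_refl] YD[OF h]] unfolding N_def .
    ultimately have "extend_by_id a b h \<in> word_ball thompson_F (X \<union> Y) (C * N + D * N)"
      using thompson.word_ball_mult[OF Zc] by simp
    then show ?thesis unfolding N_def[symmetric] add_mult_distrib .
  qed
  then show ?thesis
    unfolding undistorted_piece_def using X Y by (intro exI[of _ "X \<union> Y"] exI[of _ "C + D"]) simp
qed

text \<open>
  Here every element supported in \<open>[a,b]\<close> commutes with \<open>g\<close>, so the bound for supported elements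
  applies.
\<close>

lemma undistorted_piece_identity:
  assumes g: "g \<in> carrier thompson_F" and q: "a \<in> cut_points g" "b \<in> cut_points g" "a < b"
    and gid: "\<And>t. t \<in> {a..b} \<Longrightarrow> g t = t"
  shows "undistorted_piece g a b"
proof -
  note A = cut_points[OF g q(1)] and B = cut_points[OF g q(2)]
  have ab: "0 \<le> a" "a \<le> b" "b \<le> 1" using A(2) B(2) q(3) by auto
  obtain X C where X: "finite X" "X \<subseteq> carrier thompson_F"
    and supp: "\<And>x t. x \<in> X \<Longrightarrow> t \<in> {0..1} \<Longrightarrow> t \<le> a \<or> b \<le> t \<Longrightarrow> x t = t"
    and bound: "\<And>h. h \<in> carrier thompson_F \<Longrightarrow> (\<And>t. t \<in> {0..1} \<Longrightarrow> t \<le> a \<or> b \<le> t \<Longrightarrow> h t = t) \<Longrightarrow>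
      h \<in> word_ball thompson_F X (C * (complexity h + 1))"
    using supported_word_bound[OF A(1) B(1) ab(1) q(3) ab(3)] by blast
  have "X \<subseteq> centralizer thompson_F g"
  proof
    fix x assume x: "x \<in> X"
    then have xc: "x \<in> carrier thompson_F" using X(2) by blast
    have "x a = a" "x b = b" using supp[OF x] A(2) B(2) by simp_all
    note xab = thompson_restrict_interval(2)[OF xc this ab]
    have "x (g t) = g (x t)" if t: "t \<in> {0..1}" for t
    proof (cases "t \<in> {a..b}")
      case True
      then have "x t \<in> {a..b}" using xab by blast
      then show ?thesis using gid True by simp
    next
      case False
      then have tab: "t \<le> a \<or> b \<le> t" by auto
      have "g t \<le> g a \<or> g b \<le> g t"
        using tab thompson_le_iff[OF g t A(2)] thompson_le_iff[OF g B(2) t] by blast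
      then have "g t \<le> a \<or> b \<le> g t" unfolding A(4) B(4) .
      then have "x (g t) = g t" by (rule supp[OF x thompson_unit[OF g t]])
      then show ?thesis using supp[OF x t tab] by simp
    qed
    then show "x \<in> centralizer thompson_F g" using xc unfolding centralizer_iff[OF g] by blast
  qed
  moreover define s where "s = card (straddling a) + card (straddling b)"
  have "extend_by_id a b h \<in> word_ball thompson_F X
      (C * (s + 1) * (complexity h + complexity (inv\<^bsub>thompson_F\<^esub> h) + 1))"
    if h: "h \<in> centralizer thompson_F g" for h
  proof -
    note P = piece_in_thompson[OF g q(1,2) ab(2) h]
    have "extend_by_id a b h \<in> word_ball thompson_F X (C * (complexity (extend_by_id a b h) + 1))"
    proof (rule bound[OF P(1)])
      fix t :: real assume t: "t \<in> {0..1}" "t \<le> a \<or> b \<le> t"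
      have "h a = a" "h b = b" using A(3)[OF h] B(3)[OF h] by simp_all
      then show "extend_by_id a b h t = t" unfolding extend_by_id_apply[OF t(1)] using t(2) by auto
    qed
    moreover have "C * (complexity (extend_by_id a b h) + 1)
        \<le> C * (s + 1) * (complexity h + complexity (inv\<^bsub>thompson_F\<^esub> h) + 1)"
    proof -
      have "complexity (extend_by_id a b h) + 1 \<le> (s + 1) * (complexity h + complexity (inv\<^bsub>thompson_F\<^esub> h) + 1)"
        using P(2) unfolding s_def[symmetric] by (simp add: algebra_simps)
      then show ?thesis unfolding mult.assoc by (rule mult_le_mono2)
    qed
    ultimately show ?thesis by (rule word_ball_le)
  qed
  ultimately show ?thesis
    unfolding undistorted_piece_def using X(1) by (intro exI[of _ X] exI[of _ "C * (s + 1)"]) simp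
qed

lemma nondyadic_in_good_interior:
  assumes f: "f \<in> carrier thompson_F" and x: "x \<in> {0..1}" "x \<notin> dyadic"
  obtains I J where "carries f I J" "lo I < x" "x < hi I"
proof -
  obtain xs where xs: "chain 0 xs 1" "\<And>I. I \<in> set xs \<Longrightarrow> good f I"
    by (rule thompson_good_chain[OF f], rule that)
  have "x \<noteq> 1" using x(2) dyadicI[of 1 0] by auto
  then obtain I where I: "I \<in> set xs" "x \<in> {lo I..<hi I}"
    using chain_covers[OF xs(1), of x] x(1) by auto
  have "lo I \<in> dyadic" using dyadicI by (cases I) (simp add: lo_simps)
  then have "lo I \<noteq> x" using x(2) by blast
  then have "lo I < x" "x < hi I" using I(2) by auto
  moreover obtain J where "carries f I J" using xs(2)[OF I(1)] by (auto simp: good_def)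
  ultimately show ?thesis using that by blast
qed

text \<open>
  Both sets of points are open, and \<open>]a,b[\<close> is connected.  For the second set, the critical case is a
  frontier point of the fixed point set of \<open>g\<close>.  It is not dyadic, since there is no cut point
  in \<open>]a,b[\<close>, so \<open>g\<close> is affine across it.  As \<open>g\<close> is not the identity there, the point is an
  isolated fixed point.
\<close>

lemma id_near_everywhere_or_nowhere:
  assumes g: "g \<in> carrier thompson_F" and ab: "0 \<le> a" "b \<le> 1"
    and noq: "cut_points g \<inter> {a<..<b} = {}"
  shows "(\<forall>x\<in>{a<..<b}. id_near g x) \<or> (\<forall>x\<in>{a<..<b}. \<not> id_near g x)"
proof -
  define U where "U = {x \<in> {a<..<b}. id_near g x}"
  define V where "V = {x \<in> {a<..<b}. \<not> id_near g x}"
  have "open U"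
    unfolding open_dist
  proof
    fix x assume x: "x \<in> U"
    then obtain e where e: "e > 0" "\<forall>t\<in>{0..1}. \<bar>t - x\<bar> < e \<longrightarrow> g t = t"
      unfolding U_def id_near_def by blast
    define d where "d = min (e / 2) (min (x - a) (b - x))"
    have d: "0 < d" using e(1) x by (simp add: d_def U_def)
    have "y \<in> U" if "dist y x < d" for y
    proof -
      have y: "\<bar>y - x\<bar> < d" using that by (simp add: dist_real_def)
      then have "y \<in> {a<..<b}" by (auto simp: d_def)
      moreover have "id_near g y"
        unfolding id_near_def
      proof (intro exI[of _ "e / 2"] conjI ballI impI)
        show "0 < e / 2" using e(1) by simp
        fix t :: real assume t: "t \<in> {0..1}" "\<bar>t - y\<bar> < e / 2"
        have "\<bar>t - x\<bar> < e" using t(2) y unfolding d_def by linarith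
        then show "g t = t" using e(2) t(1) by blast
      qed
      ultimately show ?thesis by (simp add: U_def)
    qed
    with d show "\<exists>e>0. \<forall>y. dist y x < e \<longrightarrow> y \<in> U" by blast
  qed
  moreover have "open V"
    unfolding open_dist
  proof
    fix x assume xV: "x \<in> V"
    then have x: "a < x" "x < b" "x \<in> {0..1}" "\<not> id_near g x" using ab by (auto simp: V_def)
    have "\<exists>d>0. \<forall>y\<in>{0..1}. \<bar>y - x\<bar> < d \<longrightarrow> \<not> id_near g y"
    proof (cases "g x = x")
      case False
      define e where "e = \<bar>g x - x\<bar> / 2"
      have e: "e > 0" using False by (simp add: e_def)
      obtain d where d: "d > 0" "\<And>t. t \<in> {0..1} \<Longrightarrow> \<bar>t - x\<bar> < d \<Longrightarrow> \<bar>g t - g x\<bar> < e"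
        by (rule thompson_continuous[OF g x(3) e], rule that)
      have "\<not> id_near g y" if y: "y \<in> {0..1}" "\<bar>y - x\<bar> < min d e" for y
      proof
        assume "id_near g y"
        then have "g y = y" using y(1) unfolding id_near_def by auto
        then have "\<bar>y - g x\<bar> < e" using d(2)[OF y(1)] y(2) by simp
        moreover have "\<bar>y - x\<bar> < e" using y(2) by simp
        ultimately have "\<bar>y - g x\<bar> + \<bar>y - x\<bar> < e + e" by (rule add_strict_mono)
        moreover have "\<bar>g x - x\<bar> \<le> \<bar>y - g x\<bar> + \<bar>y - x\<bar>" by simp
        ultimately have "\<bar>g x - x\<bar> < e + e" by (rule le_less_trans[rotated])
        then show False by (simp add: e_def)
      qed
      moreover have "min d e > 0" using d(1) e by simp
      ultimately show ?thesis by blast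
    next
      case True
      then have "x \<in> fix_frontier g" using x by (simp add: fix_frontier_def)
      then have "x \<notin> dyadic" using noq x(1,2) by (auto simp: cut_points_def)
      then obtain I J where IJ: "carries g I J" "lo I < x" "x < hi I"
        using nondyadic_in_good_interior[OF g x(3)] by blast
      define d where "d = min (min (x - lo I) (hi I - x)) (min (x - a) (b - x))"
      have d: "d > 0" using IJ x by (simp add: d_def)
      have "\<not> id_near g y" if y: "y \<in> {0..1}" "\<bar>y - x\<bar> < d" for y
      proof
        assume "id_near g y"
        then obtain e where e: "e > 0" "\<forall>t\<in>{0..1}. \<bar>t - y\<bar> < e \<longrightarrow> g t = t"
          unfolding id_near_def by blast
        have yI: "lo I < y" "y < hi I" "a < y" "y < b" using y(2) by (auto simp: d_def)
        \<comment> \<open>A second fixed point of \<open>g\<close> on the affine part around \<open>x\<close>.\<close>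
        define z where "z = y + min (e / 2) (min ((hi I - y) / 2) ((b - y) / 2))"
        have z: "y < z" "z < hi I" "z < b" "\<bar>z - y\<bar> < e"
          using e(1) yI by (auto simp: z_def min_def field_simps)
        have "g y = y" using e y(1) by auto
        moreover have "z \<in> {0..1}" using z(1,3) yI ab by auto
        then have "g z = z" using e(2) z(4) by blast
        ultimately have "\<And>t. t \<in> {lo I..hi I} \<Longrightarrow> g t = t"
          using carries_two_fixed_points[OF IJ(1), of y z] yI z by auto
        then have "id_near g x" by (rule id_nearI_interior[OF IJ(2,3)])
        then show False using x(4) by blast
      qed
      with d show ?thesis by blast
    qed
    then obtain d where d: "d > 0" "\<And>y. y \<in> {0..1} \<Longrightarrow> \<bar>y - x\<bar> < d \<Longrightarrow> \<not> id_near g y" by blast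
    have "y \<in> V" if "dist y x < min d (min (x - a) (b - x))" for y
    proof -
      have y: "\<bar>y - x\<bar> < min d (min (x - a) (b - x))" using that by (simp add: dist_real_def)
      then have yab: "y \<in> {a<..<b}" by auto
      then have "y \<in> {0..1}" using ab by auto
      then have "\<not> id_near g y" by (rule d(2)) (use y in simp)
      with yab show ?thesis by (simp add: V_def)
    qed
    moreover have "min d (min (x - a) (b - x)) > 0" using d(1) x by simp
    ultimately show "\<exists>e>0. \<forall>y. dist y x < e \<longrightarrow> y \<in> V" by blast
  qed
  ultimately have "U \<inter> {a<..<b} = {} \<or> V \<inter> {a<..<b} = {}"
    by (intro connectedD[OF connected_Ioo]) (auto simp: U_def V_def)
  then show ?thesis by (auto simp: U_def V_def)
qed

text \<open>
  Let \<open>s\<close> be the supremum of the points up to which \<open>h\<close> is the identity.  If \<open>g\<close> moves \<open>s\<close>, then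
  \<open>g\<close> or its inverse moves a right neighbourhood of \<open>s\<close> into the region below \<open>s\<close>, and commutation
  transports the identity back.  If \<open>g\<close> fixes \<open>s\<close>, then \<open>s\<close> is a frontier point that is not a cut
  point, hence not dyadic, and \<open>h\<close> is affine across \<open>s\<close>.  In both cases \<open>h\<close> is the identity beyond
  \<open>s\<close>, so that \<open>s\<close> must be \<open>b\<close>.
\<close>

lemma centralizer_identity_propagates:
  assumes g: "g \<in> carrier thompson_F" and q: "a \<in> cut_points g" "b \<in> cut_points g" "a < b"
    and noq: "cut_points g \<inter> {a<..<b} = {}"
    and nowhere: "\<And>x. x \<in> {a<..<b} \<Longrightarrow> \<not> id_near g x"
    and h: "h \<in> centralizer thompson_F g"
    and e: "e > 0" "\<And>t. a \<le> t \<Longrightarrow> t \<le> a + e \<Longrightarrow> h t = t"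
    and t: "t \<in> {a..b}"
  shows "h t = t"
proof -
  note hc = centralizerD(1)[OF h]
  note A = cut_points[OF g q(1)] and B = cut_points[OF g q(2)]
  have ab: "0 \<le> a" "b \<le> 1" using A(2) B(2) by auto
  define S where "S = {x \<in> {a..b}. \<forall>t\<in>{a..x}. h t = t}"
  define s where "s = Sup S"
  have bdd: "bdd_above S" by (rule bdd_aboveI[of _ b]) (auto simp: S_def)
  have "a + min e (b - a) \<in> S" using e q(3) by (auto simp: S_def)
  then have "a + min e (b - a) \<le> s" unfolding s_def using bdd by (rule cSup_upper)
  then have as: "a < s" using e(1) q(3) by (auto simp: min_def split: if_splits)
  have ne: "S \<noteq> {}" using \<open>a + min e (b - a) \<in> S\<close> by blast
  have sb: "s \<le> b" unfolding s_def by (rule cSup_least[OF ne]) (auto simp: S_def)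
  have s01: "s \<in> {0..1}" using as sb ab by auto
  have below: "h t = t" if t: "a \<le> t" "t < s" for t
  proof -
    obtain x where "x \<in> S" "t < x" using t(2) unfolding s_def less_cSup_iff[OF ne bdd] by blast
    then show ?thesis using t(1) by (auto simp: S_def)
  qed
  have hs: "h s = s"
  proof (rule order_antisym)
    show "s \<le> h s"
    proof (rule ccontr)
      assume "\<not> s \<le> h s"
      then have less: "max a (h s) < s" using as by simp
      define u where "u = (max a (h s) + s) / 2"
      have u: "max a (h s) < u" "u < s" using less by (simp_all add: u_def)
      then have "h u = u" by (intro below) auto
      moreover have "h u < h s" using thompson_less_iff[OF hc _ s01, of u] u ab s01 by auto
      ultimately show False using u by simp
    qed
    show "h s \<le> s"
    proof (rule ccontr)
      assume "\<not> h s \<le> s"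
      obtain u where u: "u \<in> {0..1}" "h u = s" using thompsonD(3)[OF hc] s01 by (metis imageE)
      then have "u < s" using \<open>\<not> h s \<le> s\<close> thompson_less_iff[OF hc u(1) s01] by simp
      moreover have "a \<le> u" using thompson_le_iff[OF hc A(2) u(1)] u(2) A(3)[OF h] as by simp
      ultimately have "h u = u" by (intro below)
      then show False using u(2) \<open>u < s\<close> by simp
    qed
  qed
  have upto: "h t = t" if "a \<le> t" "t \<le> s" for t
    using below[of t] hs that by (cases "t = s") auto
  have "s = b"
  proof (rule ccontr)
    assume "s \<noteq> b"
    then have sb': "s < b" using sb by simp
    have "\<exists>v>s. \<forall>t. s \<le> t \<and> t \<le> v \<and> t \<le> b \<longrightarrow> h t = t"
    proof (cases "g s = s")
      case True
      have sab: "s \<in> {a<..<b}" using as sb' by simp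
      then have "s \<in> fix_frontier g" using True s01 nowhere by (simp add: fix_frontier_def)
      then have "s \<notin> dyadic" using noq sab by (auto simp: cut_points_def)
      then obtain I J where IJ: "carries h I J" "lo I < s" "s < hi I"
        using nondyadic_in_good_interior[OF hc s01] by blast
      \<comment> \<open>A second fixed point of \<open>h\<close> on the affine part around \<open>s\<close>.\<close>
      define u where "u = max a (lo I)"
      have u: "u < s" "a \<le> u" "lo I \<le> u" using as IJ(2) by (simp_all add: u_def)
      have "h u = u" using u by (intro upto) auto
      then have "h t = t" if "t \<in> {lo I..hi I}" for t
        using carries_two_fixed_points[OF IJ(1) _ _ _ _ hs that, of u] u IJ by auto
      then show ?thesis using IJ by (intro exI[of _ "hi I"]) auto
    next
      case False
      \<comment> \<open>One of \<open>g\<close> and its inverse moves \<open>s\<close> down.\<close>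
      have "\<exists>f. f \<in> carrier thompson_F \<and> f s < s \<and> f a = a \<and> (\<forall>t\<in>{0..1}. h (f t) = f (h t))"
      proof (cases "g s < s")
        case True
        then show ?thesis using g A(4) h unfolding centralizer_iff[OF g] by blast
      next
        case nless: False
        have ig: "inv\<^bsub>thompson_F\<^esub> g \<in> carrier thompson_F" using g by simp
        note ga = thompson_inv_apply[OF g]
        have igs: "(inv\<^bsub>thompson_F\<^esub> g) s \<in> {0..1}" by (rule thompson_unit[OF ig s01])
        have "(inv\<^bsub>thompson_F\<^esub> g) s < s"
          using thompson_less_iff[OF g igs s01] ga(2)[OF s01] False nless by simp
        moreover have "(inv\<^bsub>thompson_F\<^esub> g) a = a" using ga(1)[OF A(2)] A(4) by simp
        moreover have "h ((inv\<^bsub>thompson_F\<^esub> g) t) = (inv\<^bsub>thompson_F\<^esub> g) (h t)" if t: "t \<in> {0..1}" for t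
        proof -
          define u where "u = (inv\<^bsub>thompson_F\<^esub> g) t"
          have u: "u \<in> {0..1}" unfolding u_def by (rule thompson_unit[OF ig t])
          have gu: "g u = t" unfolding u_def by (rule ga(2)[OF t])
          have "h (g u) = g (h u)" using h u unfolding centralizer_iff[OF g] by blast
          then have "(inv\<^bsub>thompson_F\<^esub> g) (h t) = (inv\<^bsub>thompson_F\<^esub> g) (g (h u))" by (simp only: gu)
          also have "\<dots> = h u" by (rule ga(1)[OF thompson_unit[OF hc u]])
          finally show ?thesis unfolding u_def by (rule sym)
        qed
        ultimately show ?thesis using ig by blast
      qed
      then obtain f where f: "f \<in> carrier thompson_F" "f s < s" "f a = a"
        and comm: "\<And>t. t \<in> {0..1} \<Longrightarrow> h (f t) = f (h t)" by blast
      have fs: "f s \<in> {0..1}" by (rule thompson_unit[OF f(1) s01])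
      then have "(f s + s) / 2 \<in> {0..1}" using s01 by auto
      \<comment> \<open>A point beyond \<open>s\<close> that \<open>f\<close> still moves below \<open>s\<close>.\<close>
      then obtain v where v: "v \<in> {0..1}" "f v = (f s + s) / 2" using thompsonD(3)[OF f(1)] by (metis imageE)
      have "f s < f v" "f v < s" using f(2) v(2) by simp_all
      then have sv: "s < v" using thompson_less_iff[OF f(1) s01 v(1)] by simp
      have "h t = t" if t: "s \<le> t" "t \<le> v" "t \<le> b" for t
      proof -
        have t01: "t \<in> {0..1}" using t s01 v(1) by auto
        have "f t \<le> f v" using thompson_le_iff[OF f(1) t01 v(1)] t by simp
        moreover have "a \<le> f t" using thompson_le_iff[OF f(1) A(2) t01] f(3) as t by simp
        ultimately have "h (f t) = f t" using \<open>f v < s\<close> by (intro below) auto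
        then have "f (h t) = f t" using comm[OF t01] by simp
        then show ?thesis by (rule thompson_inj[OF f(1) thompson_unit[OF hc t01] t01])
      qed
      with sv show ?thesis by blast
    qed
    then obtain v where v: "s < v" "\<And>t. s \<le> t \<Longrightarrow> t \<le> v \<Longrightarrow> t \<le> b \<Longrightarrow> h t = t" by blast
    have "h t = t" if "t \<in> {a..min v b}" for t
      using upto[of t] v(2)[of t] that by (cases "t \<le> s") auto
    then have "min v b \<in> S" using as v(1) sb' by (auto simp: S_def)
    then have "min v b \<le> s" unfolding s_def using bdd by (rule cSup_upper)
    then show False using v(1) sb' by (simp add: min_def split: if_splits)
  qed
  then show ?thesis using upto[of t] t by simp
qed

text \<open>
  An element of the centralizer with slope \<open>1\<close> at \<open>a\<close> has a trivial piece.  So all pieces are powers of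
  one of them, with an exponent bounded by the binary logarithm of the slope.
\<close>

lemma undistorted_piece_cyclic:
  assumes g: "g \<in> carrier thompson_F" and q: "a \<in> cut_points g" "b \<in> cut_points g" "a < b"
    and noq: "cut_points g \<inter> {a<..<b} = {}"
    and nowhere: "\<And>x. x \<in> {a<..<b} \<Longrightarrow> \<not> id_near g x"
  shows "undistorted_piece g a b"
proof -
  note A = cut_points[OF g q(1)] and B = cut_points[OF g q(2)]
  have ab: "0 \<le> a" "a < 1" "a \<le> b" using A(2) B(2) q(3) by auto
  have sub: "subgroup (centralizer thompson_F g) thompson_F" by (rule thompson.subgroup_centralizer[OF g])
  define \<sigma> where "\<sigma> h = (SOME k. germ h a k)" for h
  have germ: "germ h a (\<sigma> h)" if h: "h \<in> centralizer thompson_F g" for h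
    unfolding \<sigma>_def by (rule someI_ex[OF germ_exists[OF centralizerD(1)[OF h] A(3)[OF h] A(1) ab(1,2)]])
  have \<sigma>_mult: "\<sigma> (h \<otimes>\<^bsub>thompson_F\<^esub> k) = \<sigma> h + \<sigma> k"
    if h: "h \<in> centralizer thompson_F g" and k: "k \<in> centralizer thompson_F g" for h k
  proof -
    have hk: "h \<otimes>\<^bsub>thompson_F\<^esub> k \<in> centralizer thompson_F g"
      by (rule subgroup.m_closed[OF sub h k])
    have "germ (h \<otimes>\<^bsub>thompson_F\<^esub> k) a (\<sigma> h + \<sigma> k)"
    proof (rule germ_cong[OF germ_comp[OF germ[OF h] germ[OF k]] ab(1,2)])
      fix x :: real assume "x \<in> {0..1}"
      from thompson_mult_apply[OF centralizerD(1)[OF h] centralizerD(1)[OF k] this]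
      show "(h \<circ> k) x = (h \<otimes>\<^bsub>thompson_F\<^esub> k) x" by simp
    qed
    from germ_unique[OF germ[OF hk] this] show ?thesis .
  qed
  obtain r where r: "r \<in> centralizer thompson_F g"
    and cyc: "\<And>h. h \<in> centralizer thompson_F g \<Longrightarrow>
      \<exists>q. \<bar>q\<bar> \<le> \<bar>\<sigma> h\<bar> \<and> \<sigma> (h \<otimes>\<^bsub>thompson_F\<^esub> inv\<^bsub>thompson_F\<^esub> (r [^]\<^bsub>thompson_F\<^esub> (q::int))) = 0"
    using thompson.int_valued_hom_cyclic[OF sub \<sigma>_mult] by blast
  obtain p where p: "\<And>h k. h \<in> carrier thompson_F \<Longrightarrow> h a = a \<Longrightarrow> germ h a k \<Longrightarrow>
      k \<le> int (complexity h) + int p"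
    using germ_le_complexity[OF A(1) ab(1,2)] by blast
  have bound: "extend_by_id a b h \<in> word_ball thompson_F {extend_by_id a b r}
      ((p + 1) * (complexity h + complexity (inv\<^bsub>thompson_F\<^esub> h) + 1))"
    if h: "h \<in> centralizer thompson_F g" for h
  proof -
    define N where "N = complexity h + complexity (inv\<^bsub>thompson_F\<^esub> h) + 1"
    obtain n where n: "\<bar>n\<bar> \<le> \<bar>\<sigma> h\<bar>"
      and zero: "\<sigma> (h \<otimes>\<^bsub>thompson_F\<^esub> inv\<^bsub>thompson_F\<^esub> (r [^]\<^bsub>thompson_F\<^esub> (n::int))) = 0"
      using cyc[OF h] by blast
    define w where "w = r [^]\<^bsub>thompson_F\<^esub> n"
    define k where "k = h \<otimes>\<^bsub>thompson_F\<^esub> inv\<^bsub>thompson_F\<^esub> w"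
    have w: "w \<in> centralizer thompson_F g"
      unfolding w_def by (rule thompson.subgroup_int_pow_closed[OF sub r])
    have k: "k \<in> centralizer thompson_F g"
      unfolding k_def by (rule subgroup.m_closed[OF sub h subgroup.m_inv_closed[OF sub w]])
    have "germ k a 0" using germ[OF k] zero unfolding k_def w_def by simp
    then obtain e where e: "e > 0" "\<And>t. a \<le> t \<Longrightarrow> t \<le> a + e \<Longrightarrow> k t = a + 2 powi 0 * (t - a)"
      unfolding germ_def by blast
    have e2: "k t = t" if "a \<le> t" "t \<le> a + e" for t using e(2)[OF that] by simp
    have kid: "k t = t" if "t \<in> {a..b}" for t
      by (rule centralizer_identity_propagates[OF g q noq nowhere k e(1) e2 that])
    have "extend_by_id a b k = \<one>\<^bsub>thompson_F\<^esub>"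
      unfolding thompson_one extend_by_id_def using kid by (intro restrict_ext) simp
    moreover have "h = k \<otimes>\<^bsub>thompson_F\<^esub> w"
      unfolding k_def using centralizerD(1)[OF h] centralizerD(1)[OF w] by (simp add: thompson.m_assoc)
    ultimately have "extend_by_id a b h = extend_by_id a b w"
      using piece_mult[OF g q(1,2) ab(3) k w] piece_in_thompson(1)[OF g q(1,2) ab(3) w] by simp
    moreover have "extend_by_id a b w \<in> word_ball thompson_F (extend_by_id a b ` {r}) (nat \<bar>n\<bar>)"
    proof (rule thompson.word_ball_hom_image[OF sub])
      show "{r} \<subseteq> centralizer thompson_F g" using r by simp
      show "w \<in> word_ball thompson_F {r} (nat \<bar>n\<bar>)"
        unfolding w_def by (rule thompson.word_ball_int_pow[OF centralizerD(1)[OF r]])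
      show "extend_by_id a b x \<in> carrier thompson_F" if "x \<in> centralizer thompson_F g" for x
        by (rule piece_in_thompson(1)[OF g q(1,2) ab(3) that])
      show "extend_by_id a b (x \<otimes>\<^bsub>thompson_F\<^esub> y) =
          extend_by_id a b x \<otimes>\<^bsub>thompson_F\<^esub> extend_by_id a b y"
        if "x \<in> centralizer thompson_F g" "y \<in> centralizer thompson_F g" for x y
        by (rule piece_mult[OF g q(1,2) ab(3) that])
    qed
    ultimately have mem: "extend_by_id a b h \<in> word_ball thompson_F {extend_by_id a b r} (nat \<bar>n\<bar>)" by simp
    have ih: "inv\<^bsub>thompson_F\<^esub> h \<in> centralizer thompson_F g" by (rule subgroup.m_inv_closed[OF sub h])
    have "\<sigma> (h \<otimes>\<^bsub>thompson_F\<^esub> inv\<^bsub>thompson_F\<^esub> h) = 0"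
    proof -
      have "h \<otimes>\<^bsub>thompson_F\<^esub> inv\<^bsub>thompson_F\<^esub> h = \<one>\<^bsub>thompson_F\<^esub>"
        by (rule thompson.r_inv[OF centralizerD(1)[OF h]])
      moreover have "\<one>\<^bsub>thompson_F\<^esub> \<in> centralizer thompson_F g" by (rule subgroup.one_closed[OF sub])
      from \<sigma>_mult[OF this this] have "\<sigma> \<one>\<^bsub>thompson_F\<^esub> = 0" by simp
      ultimately show ?thesis by simp
    qed
    then have "\<sigma> (inv\<^bsub>thompson_F\<^esub> h) = - \<sigma> h" using \<sigma>_mult[OF h ih] by linarith
    moreover have "\<sigma> h \<le> int (complexity h) + int p"
      by (rule p[OF centralizerD(1)[OF h] A(3)[OF h] germ[OF h]])
    moreover have "\<sigma> (inv\<^bsub>thompson_F\<^esub> h) \<le> int (complexity (inv\<^bsub>thompson_F\<^esub> h)) + int p"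
      by (rule p[OF centralizerD(1)[OF ih] A(3)[OF ih] germ[OF ih]])
    ultimately have "\<bar>n\<bar> \<le> int (N + p)" using n unfolding N_def by linarith
    then have "nat \<bar>n\<bar> \<le> N + p" by simp
    also have "\<dots> \<le> (p + 1) * N" by (simp add: N_def)
    finally show ?thesis unfolding N_def[symmetric] by (rule word_ball_le[OF mem])
  qed
  have "{extend_by_id a b r} \<subseteq> centralizer thompson_F g"
    using piece_in_centralizer[OF g q(1,2) ab(3) r] by simp
  then show ?thesis
    unfolding undistorted_piece_def using bound
    by (intro exI[of _ "{extend_by_id a b r}"] exI[of _ "p + 1"]) simp
qed

lemma undistorted_piece_between_cut_points:
  assumes g: "g \<in> carrier thompson_F" and q: "a \<in> cut_points g" "b \<in> cut_points g" "a < b"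
  shows "undistorted_piece g a b"
  using q
proof (induction "card (cut_points g \<inter> {a<..<b})" arbitrary: a b rule: less_induct)
  case less
  have fin: "finite (cut_points g)"
    unfolding cut_points_def using finite_fix_frontier[OF g] by simp
  show ?case
  proof (cases "cut_points g \<inter> {a<..<b} = {}")
    case True
    note A = cut_points[OF g less.prems(1)] and B = cut_points[OF g less.prems(2)]
    have ab: "0 \<le> a" "b \<le> 1" using A(2) B(2) by auto
    show ?thesis
    proof (cases "\<forall>x\<in>{a<..<b}. id_near g x")
      case all: True
      have "g t = t" if t: "t \<in> {a..b}" for t
      proof (cases "t = a \<or> t = b")
        case True
        then show ?thesis using A(4) B(4) by blast
      next
        case False
        then have "t \<in> {a<..<b}" using t by auto
        then have "id_near g t" using all by blast
        then show ?thesis using t ab unfolding id_near_def by auto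
      qed
      then show ?thesis by (rule undistorted_piece_identity[OF g less.prems])
    next
      case False
      then have "\<forall>x\<in>{a<..<b}. \<not> id_near g x"
        using id_near_everywhere_or_nowhere[OF g ab True] by blast
      then show ?thesis using undistorted_piece_cyclic[OF g less.prems True] by blast
    qed
  next
    case False
    then obtain c where c: "c \<in> cut_points g" "a < c" "c < b" by auto
    have "cut_points g \<inter> {a<..<c} \<subset> cut_points g \<inter> {a<..<b}"
      "cut_points g \<inter> {c<..<b} \<subset> cut_points g \<inter> {a<..<b}"
      using c by auto
    then have "card (cut_points g \<inter> {a<..<c}) < card (cut_points g \<inter> {a<..<b})"
      "card (cut_points g \<inter> {c<..<b}) < card (cut_points g \<inter> {a<..<b})"
      using fin by (auto intro!: psubset_card_mono)
    then have "undistorted_piece g a c" "undistorted_piece g c b"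
      using less.hyps less.prems c by blast+
    then show ?thesis
      using c less.prems by (intro undistorted_piece_join[OF g less.prems(1) c(1) less.prems(2)]) auto
  qed
qed

theorem theorem35:
  fixes g :: "real \<Rightarrow> real"
  assumes "g \<in> carrier thompson_F"
  shows "qi_embedded (centralizer thompson_F g) thompson_F"
proof -
  define N where "N h = complexity h + complexity (inv\<^bsub>thompson_F\<^esub> h)" for h
  have "0 \<in> cut_points g" "1 \<in> cut_points g" by (simp_all add: cut_points_def)
  then have "undistorted_piece g 0 1"
    by (rule undistorted_piece_between_cut_points[OF assms]) simp
  then obtain X C where X: "finite X" "X \<subseteq> centralizer thompson_F g"
    and bound: "\<And>h. h \<in> centralizer thompson_F g \<Longrightarrow> extend_by_id 0 1 h \<in> word_ball thompson_F X (C * (N h + 1))"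
    unfolding undistorted_piece_def N_def by blast
  show ?thesis
  proof (rule thompson.qi_embeddedI_subadditive)
    show "subgroup (centralizer thompson_F g) thompson_F"
      by (rule thompson.subgroup_centralizer[OF assms])
    have "carrier thompson_F \<subseteq> generate thompson_F {x0, x1}"
      using thompson_word_bound thompson.word_ball_subset_generate[OF x0_x1_closed] by blast
    then have "generate thompson_F {x0, x1} = carrier thompson_F"
      using thompson.generate_incl[OF x0_x1_closed] by blast
    then show "finite_generating_set thompson_F (carrier thompson_F) {x0, x1}"
      using x0_x1_closed by (simp add: finite_generating_set_def)
    show "N \<one>\<^bsub>thompson_F\<^esub> = 0" by (simp add: N_def complexity_one)
    show "N (x \<otimes>\<^bsub>thompson_F\<^esub> y) \<le> N x + N y"
      if "x \<in> carrier thompson_F" "y \<in> carrier thompson_F" for x y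
      using complexity_mult[OF that] complexity_mult[of "inv\<^bsub>thompson_F\<^esub> y" "inv\<^bsub>thompson_F\<^esub> x"] that
      by (simp add: N_def thompson.inv_mult_group)
    show "finite X" "X \<subseteq> centralizer thompson_F g" by (rule X)+
    show "h \<in> word_ball thompson_F X (C * (N h + 1))" if h: "h \<in> centralizer thompson_F g" for h
    proof -
      have "extend_by_id 0 1 h = restrict h {0..1}"
        unfolding extend_by_id_def by (rule restrict_ext) simp
      also have "\<dots> = h" using thompsonD(1)[OF centralizerD(1)[OF h]] by (rule extensional_restrict)
      finally show ?thesis using bound[OF h] by simp
    qed
  qed
qed

end
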